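(* Let $\Bbbk$ be a field and let $G=C\times H$, where $C,H$ are finite groups with $C$ abelian and $H$ purely non-abelian. Then, under the identification $\mathcal D(G)\cong\mathcal D(C)\otimes\mathcal D(H)$, $$\operatorname{Aut}(\mathcal D(G))=\begin{pmatrix}\operatorname{Aut}(\mathcal D(C))&\operatorname{Hom}^c(\mathcal D(H),\mathcal D(C))\\ \operatorname{Hom}^c(\mathcal D(C),\mathcal D(H))&\operatorname{Aut}(\mathcal D(H))\end{pmatrix}.$$
   Context: All Hopf algebras are over the field $\Bbbk$; $\operatorname{Hom}$ and $\operatorname{Aut}$ refer to Hopf algebra morphisms. $\Bbbk^G$ is the dual of the group algebra $\Bbbk G$. $\mathcal D(G)$ is the Drinfeld double of the finite group $G$: as a coalgebra it is $(\Bbbk^{G})^{\mathrm{cop}}\otimes\Bbbk G$, with elements written $a\# g$, and multiplication $(a\# g)(b\# h)=a(g\rightharpoonup b)\# gh$, where $g\rightharpoonup$ is the conjugation action of $G$ on $\Bbbk^G$. A finite group is purely non-abelian if it has no non-trivial abelian direct factor. For Hopf algebras $A,B$, $\operatorname{Hom}^c(A,B)$ is the set of Hopf algebra morphisms $b\colon A\to B$ that commute with $\operatorname{id}_B$, i.e. $b(x)y=yb(x)$ for all $x\in A,y\in B$, and cocommute with $\operatorname{id}_A$, i.e. $b(x_{(1)})\otimes x_{(2)}=b(x_{(2)})\otimes x_{(1)}$ for all $x\in A$. For Hopf algebras $A,B$, a matrix $\begin{pmatrix}\alpha&\beta\\ \gamma&\delta\end{pmatrix}$ with Hopf algebra morphisms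 $\alpha\colon A\to A$, $\beta\colon B\to A$, $\gamma\colon A\to B$, $\delta\colon B\to B$ is identified with the map $A\otimes B\to A\otimes B$, $x\otimes y\mapsto\alpha(x_{(1)})\beta(y_{(1)})\otimes\gamma(x_{(2)})\delta(y_{(2)})$ (a Hopf algebra endomorphism is always of this form, with $\alpha,\beta$ commuting, $\gamma,\delta$ commuting, $\alpha,\gamma$ cocommuting and $\beta,\delta$ cocommuting). The right-hand side in the claim denotes the set of all such matrices with entries in the indicated sets, with $A=\mathcal D(C)$, $B=\mathcal D(H)$. *)

theory Defs
  imports "HOL-Algebra.Algebra"
begin

section \<open>Hopf algebras with a chosen finite basis\<close>

text \<open>
  A finite-dimensional vector space is given by a finite basis \<open>I\<close>: its elements are the functions
  \<open>'i \<Rightarrow> 'k\<close> vanishing outside \<open>I\<close>, and the tensor product of the spaces with bases \<open>I\<close> and \<open>J\<close>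
  is the space with basis \<open>I \<times> J\<close>.
\<close>

definition fspace :: "'i set \<Rightarrow> ('i \<Rightarrow> 'k::field) set" where
  "fspace I = {v. \<forall>i. i \<notin> I \<longrightarrow> v i = 0}"

definition bvec :: "'i \<Rightarrow> 'i \<Rightarrow> 'k::field" where
  "bvec i = (\<lambda>j. if j = i then 1 else 0)"

definition tens :: "('i \<Rightarrow> 'k) \<Rightarrow> ('j \<Rightarrow> 'k) \<Rightarrow> 'i \<times> 'j \<Rightarrow> 'k::field" where
  "tens v w = (\<lambda>(i, j). v i * w j)"

definition tensor_map ::
  "'i set \<Rightarrow> 'j set \<Rightarrow> (('i \<Rightarrow> 'k) \<Rightarrow> 'p \<Rightarrow> 'k) \<Rightarrow> (('j \<Rightarrow> 'k) \<Rightarrow> 'q \<Rightarrow> 'k)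
    \<Rightarrow> ('i \<times> 'j \<Rightarrow> 'k) \<Rightarrow> 'p \<times> 'q \<Rightarrow> 'k::field" where
  "tensor_map I J f g T = (\<lambda>r. \<Sum>i\<in>I. \<Sum>j\<in>J. T (i, j) * tens (f (bvec i)) (g (bvec j)) r)"

definition linear_on :: "'i set \<Rightarrow> 'j set \<Rightarrow> (('i \<Rightarrow> 'k::field) \<Rightarrow> 'j \<Rightarrow> 'k) \<Rightarrow> bool" where
  "linear_on I J f \<longleftrightarrow> f ` fspace I \<subseteq> fspace J \<and>
     (\<forall>v\<in>fspace I. \<forall>w\<in>fspace I. \<forall>a b. f (\<lambda>i. a * v i + b * w i) = (\<lambda>j. a * f v j + b * f w j))"

record ('i, 'k) hopf =
  hbasis :: "'i set"
  hmult :: "('i \<Rightarrow> 'k) \<Rightarrow> ('i \<Rightarrow> 'k) \<Rightarrow> 'i \<Rightarrow> 'k"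
  hunit :: "'i \<Rightarrow> 'k"
  hcomult :: "('i \<Rightarrow> 'k) \<Rightarrow> 'i \<times> 'i \<Rightarrow> 'k"
  hcounit :: "('i \<Rightarrow> 'k) \<Rightarrow> 'k"
  hantipode :: "('i \<Rightarrow> 'k) \<Rightarrow> 'i \<Rightarrow> 'k"

abbreviation hspace :: "('i, 'k::field) hopf \<Rightarrow> ('i \<Rightarrow> 'k) set" where
  "hspace A \<equiv> fspace (hbasis A)"

definition hopf_tensor ::
  "('i, 'k) hopf \<Rightarrow> ('j, 'k::field) hopf \<Rightarrow> ('i \<times> 'j, 'k) hopf" where
  "hopf_tensor A B = \<lparr>
     hbasis = hbasis A \<times> hbasis B,
     hmult = (\<lambda>S T r. \<Sum>i\<in>hbasis A. \<Sum>j\<in>hbasis B. \<Sum>i'\<in>hbasis A. \<Sum>j'\<in>hbasis B.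
       S (i, j) * T (i', j') * tens (hmult A (bvec i) (bvec i')) (hmult B (bvec j) (bvec j')) r),
     hunit = tens (hunit A) (hunit B),
     hcomult = (\<lambda>T ((p, q), (p', q')). \<Sum>i\<in>hbasis A. \<Sum>j\<in>hbasis B.
       T (i, j) * hcomult A (bvec i) (p, p') * hcomult B (bvec j) (q, q')),
     hcounit = (\<lambda>T. \<Sum>i\<in>hbasis A. \<Sum>j\<in>hbasis B.
       T (i, j) * hcounit A (bvec i) * hcounit B (bvec j)),
     hantipode = tensor_map (hbasis A) (hbasis B) (hantipode A) (hantipode B) \<rparr>"

definition hopf_algebra :: "('i, 'k::field) hopf \<Rightarrow> bool" where
  "hopf_algebra A \<longleftrightarrow>
     finite (hbasis A) \<and>
     (\<forall>x\<in>hspace A. linear_on (hbasis A) (hbasis A) (hmult A x)) \<and>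
     (\<forall>y\<in>hspace A. linear_on (hbasis A) (hbasis A) (\<lambda>x. hmult A x y)) \<and>
     (\<forall>x\<in>hspace A. \<forall>y\<in>hspace A. \<forall>z\<in>hspace A.
        hmult A (hmult A x y) z = hmult A x (hmult A y z)) \<and>
     hunit A \<in> hspace A \<and>
     (\<forall>x\<in>hspace A. hmult A (hunit A) x = x \<and> hmult A x (hunit A) = x) \<and>
     linear_on (hbasis A) (hbasis A \<times> hbasis A) (hcomult A) \<and>
     (\<forall>x\<in>hspace A. \<forall>i j k.
        tensor_map (hbasis A) (hbasis A) (hcomult A) id (hcomult A x) ((i, j), k) =
        tensor_map (hbasis A) (hbasis A) id (hcomult A) (hcomult A x) (i, (j, k))) \<and>
     linear_on (hbasis A) (UNIV :: unit set) (\<lambda>x _. hcounit A x) \<and>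
     (\<forall>x\<in>hspace A. \<forall>j.
        (\<Sum>i\<in>hbasis A. hcounit A (bvec i) * hcomult A x (i, j)) = x j \<and>
        (\<Sum>i\<in>hbasis A. hcomult A x (j, i) * hcounit A (bvec i)) = x j) \<and>
     (\<forall>x\<in>hspace A. \<forall>y\<in>hspace A.
        hcomult A (hmult A x y) = hmult (hopf_tensor A A) (hcomult A x) (hcomult A y)) \<and>
     hcomult A (hunit A) = tens (hunit A) (hunit A) \<and>
     (\<forall>x\<in>hspace A. \<forall>y\<in>hspace A. hcounit A (hmult A x y) = hcounit A x * hcounit A y) \<and>
     hcounit A (hunit A) = 1 \<and>
     linear_on (hbasis A) (hbasis A) (hantipode A) \<and>
     (\<forall>x\<in>hspace A. \<forall>k.
        (\<Sum>i\<in>hbasis A. \<Sum>j\<in>hbasis A.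
           hcomult A x (i, j) * hmult A (hantipode A (bvec i)) (bvec j) k)
          = hcounit A x * hunit A k \<and>
        (\<Sum>i\<in>hbasis A. \<Sum>j\<in>hbasis A.
           hcomult A x (i, j) * hmult A (bvec i) (hantipode A (bvec j)) k)
          = hcounit A x * hunit A k)"

section \<open>Morphisms\<close>

text \<open>Morphisms are \<^const>\<open>undefined\<close> outside the underlying space, so that equality of morphisms is
  equality of functions.\<close>

definition hopf_hom ::
  "('i, 'k::field) hopf \<Rightarrow> ('j, 'k) hopf \<Rightarrow> (('i \<Rightarrow> 'k) \<Rightarrow> 'j \<Rightarrow> 'k) set" where
  "hopf_hom A B = {f \<in> extensional (hspace A).
     linear_on (hbasis A) (hbasis B) f \<and>
     (\<forall>x\<in>hspace A. \<forall>y\<in>hspace A. f (hmult A x y) = hmult B (f x) (f y)) \<and>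
     f (hunit A) = hunit B \<and>
     (\<forall>x\<in>hspace A. hcomult B (f x) = tensor_map (hbasis A) (hbasis A) f f (hcomult A x)) \<and>
     (\<forall>x\<in>hspace A. hcounit B (f x) = hcounit A x) \<and>
     (\<forall>x\<in>hspace A. f (hantipode A x) = hantipode B (f x))}"

definition hopf_aut :: "('i, 'k::field) hopf \<Rightarrow> (('i \<Rightarrow> 'k) \<Rightarrow> 'i \<Rightarrow> 'k) set" where
  "hopf_aut A = {f \<in> hopf_hom A A. bij_betw f (hspace A) (hspace A)}"

definition hopf_homc ::
  "('i, 'k::field) hopf \<Rightarrow> ('j, 'k) hopf \<Rightarrow> (('i \<Rightarrow> 'k) \<Rightarrow> 'j \<Rightarrow> 'k) set" where
  "hopf_homc A B = {b \<in> hopf_hom A B.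
     (\<forall>x\<in>hspace A. \<forall>y\<in>hspace B. hmult B (b x) y = hmult B y (b x)) \<and>
     (\<forall>x\<in>hspace A. tensor_map (hbasis A) (hbasis A) b id (hcomult A x) =
        tensor_map (hbasis A) (hbasis A) b id (\<lambda>(i, j). hcomult A x (j, i)))}"

text \<open>The linear map \<open>x \<otimes> y \<mapsto> \<alpha>(x\<^sub>1) \<beta>(y\<^sub>1) \<otimes> \<gamma>(x\<^sub>2) \<delta>(y\<^sub>2)\<close> of a matrix, where
  \<open>\<Delta>(x) = x\<^sub>1 \<otimes> x\<^sub>2\<close> in Sweedler notation.\<close>

definition hopf_matrix ::
  "('i, 'k::field) hopf \<Rightarrow> ('j, 'k) hopf \<Rightarrow>
    (('i \<Rightarrow> 'k) \<Rightarrow> 'i \<Rightarrow> 'k) \<Rightarrow> (('j \<Rightarrow> 'k) \<Rightarrow> 'i \<Rightarrow> 'k) \<Rightarrow>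
    (('i \<Rightarrow> 'k) \<Rightarrow> 'j \<Rightarrow> 'k) \<Rightarrow> (('j \<Rightarrow> 'k) \<Rightarrow> 'j \<Rightarrow> 'k) \<Rightarrow>
    ('i \<times> 'j \<Rightarrow> 'k) \<Rightarrow> 'i \<times> 'j \<Rightarrow> 'k" where
  "hopf_matrix A B \<alpha> \<beta> \<gamma> \<delta> = restrict
     (\<lambda>T r. \<Sum>i\<in>hbasis A. \<Sum>j\<in>hbasis B. T (i, j) *
        (\<Sum>p\<in>hbasis A. \<Sum>p'\<in>hbasis A. \<Sum>q\<in>hbasis B. \<Sum>q'\<in>hbasis B.
           hcomult A (bvec i) (p, p') * hcomult B (bvec j) (q, q') *
           tens (hmult A (\<alpha> (bvec p)) (\<beta> (bvec q))) (hmult B (\<gamma> (bvec p')) (\<delta> (bvec q'))) r))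
     (hspace (hopf_tensor A B))"

section \<open>The Drinfeld double of a finite group\<close>

text \<open>
  The basis vector \<open>(x, g)\<close> is \<open>e\<^sub>x # g\<close>, where \<open>e\<^sub>x\<close> is the indicator function of \<open>x\<close>; so the
  element \<open>a # g\<close> is \<open>tens a (bvec g)\<close>. The multiplication is the bilinear extension of
  \<open>(a # g)(b # h) = a (g \<rightharpoonup> b) # g h\<close> with \<open>(g \<rightharpoonup> b)(x) = b (g\<^sup>-\<^sup>1 x g)\<close>. Since the comultiplication of
  the dual of the group algebra is \<open>\<Delta>(a)(x, y) = a (x y)\<close>, the co-opposite one used here is
  \<open>(x, y) \<mapsto> a (y x)\<close>. The antipode is \<open>S(e\<^sub>x # g) = e\<^sub>z # g\<^sup>-\<^sup>1\<close> with \<open>z = g\<^sup>-\<^sup>1 x\<^sup>-\<^sup>1 g\<close>.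
\<close>

definition conj_act :: "('g, 'm) monoid_scheme \<Rightarrow> 'g \<Rightarrow> ('g \<Rightarrow> 'k) \<Rightarrow> 'g \<Rightarrow> 'k" where
  "conj_act G g b = (\<lambda>x. b (inv\<^bsub>G\<^esub> g \<otimes>\<^bsub>G\<^esub> x \<otimes>\<^bsub>G\<^esub> g))"

definition double :: "('g, 'm) monoid_scheme \<Rightarrow> ('g \<times> 'g, 'k::field) hopf" where
  "double G = \<lparr>
     hbasis = carrier G \<times> carrier G,
     hmult = (\<lambda>u v (x, k). if x \<in> carrier G \<and> k \<in> carrier G
       then \<Sum>g\<in>carrier G. u (x, g) * conj_act G g (\<lambda>y. v (y, inv\<^bsub>G\<^esub> g \<otimes>\<^bsub>G\<^esub> k)) x else 0),
     hunit = (\<lambda>(x, g). if x \<in> carrier G \<and> g = \<one>\<^bsub>G\<^esub> then 1 else 0),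
     hcomult = (\<lambda>u ((x, g), (y, h)).
       if x \<in> carrier G \<and> y \<in> carrier G \<and> g \<in> carrier G \<and> g = h then u (y \<otimes>\<^bsub>G\<^esub> x, g) else 0),
     hcounit = (\<lambda>u. \<Sum>g\<in>carrier G. u (\<one>\<^bsub>G\<^esub>, g)),
     hantipode = (\<lambda>u (x, g). if x \<in> carrier G \<and> g \<in> carrier G
       then u (inv\<^bsub>G\<^esub> g \<otimes>\<^bsub>G\<^esub> inv\<^bsub>G\<^esub> x \<otimes>\<^bsub>G\<^esub> g, inv\<^bsub>G\<^esub> g) else 0) \<rparr>"

text \<open>The identification of the double of \<open>C \<times> H\<close> with the tensor product of the doubles,
  \<open>e\<^sub>(\<^sub>x\<^sub>,\<^sub>y\<^sub>) # (c, h) \<mapsto> (e\<^sub>x # c) \<otimes> (e\<^sub>y # h)\<close>, and the resulting transport of linear endomorphisms.\<close>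

definition double_ident ::
  "(('c \<times> 'h) \<times> ('c \<times> 'h) \<Rightarrow> 'k) \<Rightarrow> ('c \<times> 'c) \<times> ('h \<times> 'h) \<Rightarrow> 'k" where
  "double_ident u = (\<lambda>((x, c), (y, h)). u ((x, y), (c, h)))"

definition double_transport ::
  "('c, 'm) monoid_scheme \<Rightarrow> ('h, 'n) monoid_scheme \<Rightarrow>
    ((('c \<times> 'h) \<times> ('c \<times> 'h) \<Rightarrow> 'k::field) \<Rightarrow> ('c \<times> 'h) \<times> ('c \<times> 'h) \<Rightarrow> 'k) \<Rightarrow>
    (('c \<times> 'c) \<times> ('h \<times> 'h) \<Rightarrow> 'k) \<Rightarrow> ('c \<times> 'c) \<times> ('h \<times> 'h) \<Rightarrow> 'k" where
  "double_transport C H f = restrict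
     (\<lambda>t. double_ident (f (\<lambda>((x, y), (c, h)). t ((x, c), (y, h)))))
     (hspace (hopf_tensor (double C) (double H)))"

section \<open>Purely non-abelian groups\<close>

definition direct_factor :: "'g set \<Rightarrow> ('g, 'm) monoid_scheme \<Rightarrow> bool" where
  "direct_factor K G \<longleftrightarrow> K \<lhd> G \<and>
     (\<exists>L. L \<lhd> G \<and> K \<inter> L = {\<one>\<^bsub>G\<^esub>} \<and> K <#>\<^bsub>G\<^esub> L = carrier G)"

definition purely_nonabelian :: "('g, 'm) monoid_scheme \<Rightarrow> bool" where
  "purely_nonabelian G \<longleftrightarrow>
     (\<forall>K. direct_factor K G \<and> comm_group (G\<lparr>carrier := K\<rparr>) \<longrightarrow> K = {\<one>\<^bsub>G\<^esub>})"

section \<open>The double is a Hopf algebra, and the identification is a Hopf isomorphism\<close>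


lemma fspace_sum_bvec:
  fixes v :: "'i \<Rightarrow> 'k::field"
  assumes "finite I" "v \<in> fspace I"
  shows "(\<Sum>i\<in>I. v i * bvec i j) = v j"
proof -
  have "(\<Sum>i\<in>I. v i * bvec i j) = (\<Sum>i\<in>I. if i = j then v i else 0)"
    by (rule sum.cong) (auto simp: bvec_def)
  also have "\<dots> = v j"
    using assms by (auto simp: sum.delta' fspace_def)
  finally show ?thesis .
qed

lemma bvec_in_fspace [simp]: "i \<in> I \<Longrightarrow> bvec i \<in> fspace I"
  by (auto simp: bvec_def fspace_def)

lemma linear_on_0:
  assumes "linear_on I J f" shows "f (\<lambda>_. 0) = (\<lambda>_. 0)"
proof -
  have 0: "(\<lambda>_. 0) \<in> fspace I" by (simp add: fspace_def)
  show ?thesis using assms[unfolded linear_on_def, THEN conjunct2, rule_format, OF 0 0, of 0 0] by simp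
qed

lemma linear_on_sum:
  fixes v :: "'a \<Rightarrow> 'i \<Rightarrow> 'k::field"
  assumes f: "linear_on I J f" and S: "finite S" and v: "\<And>s. s \<in> S \<Longrightarrow> v s \<in> fspace I"
  shows "f (\<lambda>i. \<Sum>s\<in>S. c s * v s i) = (\<lambda>j. \<Sum>s\<in>S. c s * f (v s) j)"
  using S v
proof (induction S rule: finite_induct)
  case empty then show ?case using linear_on_0[OF f] by simp
next
  case (insert s S)
  have 1: "(\<lambda>i. \<Sum>s\<in>S. c s * v s i) \<in> fspace I" "v s \<in> fspace I"
    using insert by (auto simp: fspace_def)
  have "f (\<lambda>i. c s * v s i + 1 * (\<Sum>s\<in>S. c s * v s i)) =
    (\<lambda>j. c s * f (v s) j + 1 * f (\<lambda>i. \<Sum>s\<in>S. c s * v s i) j)"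
    by (rule f[unfolded linear_on_def, THEN conjunct2, rule_format, OF 1(2,1)])
  then show ?case using insert by simp
qed

lemma linear_on_expand:
  assumes f: "linear_on I J f" and I: "finite I" and v: "v \<in> fspace I"
  shows "(\<Sum>i\<in>I. v i * f (bvec i) j) = f v j"
proof -
  have "f v = f (\<lambda>j. \<Sum>i\<in>I. v i * bvec i j)"
    using fspace_sum_bvec[OF I v] by simp
  also have "\<dots> = (\<lambda>j. \<Sum>i\<in>I. v i * f (bvec i) j)"
    by (rule linear_on_sum[OF f I]) simp
  finally show ?thesis by simp
qed

lemma tensor_map_left:
  assumes f: "linear_on I J f" and I: "finite I" "finite I'" and T: "T \<in> fspace (I \<times> I')"
  shows "tensor_map I I' f id T (p, q) = f (\<lambda>i. T (i, q)) p"
proof -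
  have T1: "(\<lambda>j. T (i, j)) \<in> fspace I'" "(\<lambda>i. T (i, j)) \<in> fspace I" for i j
    using T by (auto simp: fspace_def simp del: split_paired_All)
  have "tensor_map I I' f id T (p, q) = (\<Sum>i\<in>I. (\<Sum>j\<in>I'. T (i, j) * bvec j q) * f (bvec i) p)"
    unfolding sum_distrib_right by (simp add: tensor_map_def tens_def mult_ac)
  also have "\<dots> = f (\<lambda>i. T (i, q)) p"
    by (simp only: fspace_sum_bvec[OF I(2) T1(1)] linear_on_expand[OF f I(1) T1(2)])
  finally show ?thesis .
qed

lemma tensor_map_right:
  assumes f: "linear_on I' J f" and I: "finite I" "finite I'" and T: "T \<in> fspace (I \<times> I')"
  shows "tensor_map I I' id f T (p, q) = f (\<lambda>j. T (p, j)) q"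
proof -
  have T1: "(\<lambda>j. T (i, j)) \<in> fspace I'" "(\<lambda>i. T (i, j)) \<in> fspace I" for i j
    using T by (auto simp: fspace_def simp del: split_paired_All)
  have "tensor_map I I' id f T (p, q) = (\<Sum>j\<in>I'. \<Sum>i\<in>I. T (i, j) * bvec i p * f (bvec j) q)"
    unfolding tensor_map_def by (subst sum.swap) (simp add: tens_def mult_ac)
  also have "\<dots> = (\<Sum>j\<in>I'. (\<Sum>i\<in>I. T (i, j) * bvec i p) * f (bvec j) q)"
    by (simp only: sum_distrib_right)
  also have "\<dots> = f (\<lambda>j. T (p, j)) q"
    by (simp only: fspace_sum_bvec[OF I(1) T1(2)] linear_on_expand[OF f I(2) T1(1)])
  finally show ?thesis .
qed

context group begin

lemma double_sel:
  fixes u v :: "'a \<times> 'a \<Rightarrow> 'k::field"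
  shows
  "hbasis (double G :: ('a \<times> 'a, 'k) hopf) = carrier G \<times> carrier G"
  "hmult (double G) u v (x, k) = (if x \<in> carrier G \<and> k \<in> carrier G
     then \<Sum>g\<in>carrier G. u (x, g) * v (inv g \<otimes> x \<otimes> g, inv g \<otimes> k) else 0)"
  "hunit (double G) (x, k) = (if x \<in> carrier G \<and> k = \<one> then 1 else 0 :: 'k)"
  "hcomult (double G) u ((x, g), (y, h)) =
       (if x \<in> carrier G \<and> y \<in> carrier G \<and> g \<in> carrier G \<and> g = h then u (y \<otimes> x, g) else 0)"
  "hcounit (double G) u = (\<Sum>g\<in>carrier G. u (\<one>, g))"
  "hantipode (double G) u (x, g) = (if x \<in> carrier G \<and> g \<in> carrier G
       then u (inv g \<otimes> inv x \<otimes> g, inv g) else 0)"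
  by (auto simp: double_def conj_act_def)

lemma cancel_left [simp]:
  "\<lbrakk>x \<in> carrier G; y \<in> carrier G\<rbrakk> \<Longrightarrow> inv x \<otimes> (x \<otimes> y) = y"
  "\<lbrakk>x \<in> carrier G; y \<in> carrier G\<rbrakk> \<Longrightarrow> x \<otimes> (inv x \<otimes> y) = y"
  by (simp_all flip: m_assoc)

lemma double_linear:
  assumes "finite (carrier G)"
  defines "I \<equiv> carrier G \<times> carrier G" and "A \<equiv> (double G :: ('a \<times> 'a, 'k::field) hopf)"
  shows "linear_on I I (hmult A u)" "linear_on I I (\<lambda>u. hmult A u v)"
    "linear_on I (I \<times> I) (hcomult A)" "linear_on I (UNIV :: unit set) (\<lambda>u _. hcounit A u)"
    "linear_on I I (hantipode A)"
proof -
  show "linear_on I I (hmult A u)"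
    unfolding linear_on_def A_def I_def
    by (auto simp: fspace_def double_sel fun_eq_iff sum_distrib_left distrib_left mult_ac
        simp flip: sum.distrib)
  show "linear_on I I (\<lambda>u. hmult A u v)"
    unfolding linear_on_def A_def I_def
    by (auto simp: fspace_def double_sel fun_eq_iff sum_distrib_left distrib_right mult_ac
        simp flip: sum.distrib)
  show "linear_on I (I \<times> I) (hcomult A)"
    unfolding linear_on_def A_def I_def
    by (auto simp: fspace_def double_sel fun_eq_iff split: if_splits)
  show "linear_on I (UNIV :: unit set) (\<lambda>u _. hcounit A u)"
    unfolding linear_on_def A_def I_def
    by (auto simp: fspace_def double_sel fun_eq_iff sum_distrib_left simp flip: sum.distrib)
  show "linear_on I I (hantipode A)"
    unfolding linear_on_def A_def I_def
    by (auto simp: fspace_def double_sel fun_eq_iff split: if_splits)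
qed

end

lemma tensor_mult_double:
  fixes G :: "('g, 'm) monoid_scheme" (structure) and H :: "('h, 'n) monoid_scheme"
  assumes grp: "group G" "group H" and fin: "finite (carrier G)" "finite (carrier H)"
  defines "I \<equiv> carrier G \<times> carrier G" and "A \<equiv> (double G :: ('g \<times> 'g, 'k::field) hopf)"
  defines "J \<equiv> carrier H \<times> carrier H" and "B \<equiv> (double H :: ('h \<times> 'h, 'k) hopf)"
  assumes S: "S \<in> fspace (I \<times> J)" and T: "T \<in> fspace (I \<times> J)"
    and c: "x \<in> carrier G" "k \<in> carrier G" "y \<in> carrier H" "l \<in> carrier H"
  shows "hmult (hopf_tensor A B) S T ((x, k), (y, l)) =
    (\<Sum>g\<in>carrier G. \<Sum>h\<in>carrier H. S ((x, g), (y, h)) *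
       T ((inv g \<otimes> x \<otimes> g, inv g \<otimes> k),
          (inv\<^bsub>H\<^esub> h \<otimes>\<^bsub>H\<^esub> y \<otimes>\<^bsub>H\<^esub> h, inv\<^bsub>H\<^esub> h \<otimes>\<^bsub>H\<^esub> l)))"
proof -
  let ?y = "\<lambda>h. inv\<^bsub>H\<^esub> h \<otimes>\<^bsub>H\<^esub> y \<otimes>\<^bsub>H\<^esub> h" and ?l = "\<lambda>h. inv\<^bsub>H\<^esub> h \<otimes>\<^bsub>H\<^esub> l"
  have I: "finite I" "finite J" using fin by (simp_all add: I_def J_def)
  note lin = group.double_linear[OF grp(1) fin(1), where ?'k = 'k, folded I_def A_def]
    group.double_linear[OF grp(2) fin(2), where ?'k = 'k, folded J_def B_def]
  note linA = lin(1-5) and linB = lin(6-10)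
  have S1: "(\<lambda>i. S (i, j)) \<in> fspace I" "(\<lambda>i. T (i, j)) \<in> fspace I" for j
    using S T by (auto simp: fspace_def simp del: split_paired_All)
  have S2: "(\<lambda>j. S (i, j)) \<in> fspace J" "(\<lambda>j. T (i, j)) \<in> fspace J" for i
    using S T by (auto simp: fspace_def simp del: split_paired_All)
  have "hmult (hopf_tensor A B) S T ((x, k), (y, l)) =
    (\<Sum>i\<in>I. \<Sum>j\<in>J. \<Sum>i'\<in>I. \<Sum>j'\<in>J. S (i, j) * T (i', j') *
       (hmult A (bvec i) (bvec i') (x, k) * hmult B (bvec j) (bvec j') (y, l)))"
    by (simp add: hopf_tensor_def tens_def A_def I_def B_def J_def
        group.double_sel(1)[OF grp(1)] group.double_sel(1)[OF grp(2)])
  also have "\<dots> = (\<Sum>i\<in>I. \<Sum>j\<in>J. \<Sum>i'\<in>I. S (i, j) * hmult A (bvec i) (bvec i') (x, k) *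
       (\<Sum>j'\<in>J. T (i', j') * hmult B (bvec j) (bvec j') (y, l)))"
    by (simp only: sum_distrib_left mult_ac)
  also have "\<dots> = (\<Sum>i\<in>I. \<Sum>j\<in>J. \<Sum>i'\<in>I. S (i, j) * hmult A (bvec i) (bvec i') (x, k) *
       hmult B (bvec j) (\<lambda>j'. T (i', j')) (y, l))"
    by (simp only: linear_on_expand[OF linB(1) I(2) S2(2)])
  also have "\<dots> = (\<Sum>i\<in>I. \<Sum>i'\<in>I. hmult A (bvec i) (bvec i') (x, k) *
       (\<Sum>j\<in>J. S (i, j) * hmult B (bvec j) (\<lambda>j'. T (i', j')) (y, l)))"
    unfolding sum_distrib_left by (rule sum.cong[OF refl], subst sum.swap) (simp add: mult_ac)
  also have "\<dots> = (\<Sum>i\<in>I. \<Sum>i'\<in>I. hmult A (bvec i) (bvec i') (x, k) *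
       hmult B (\<lambda>j. S (i, j)) (\<lambda>j'. T (i', j')) (y, l))"
    by (simp only: linear_on_expand[OF linB(2) I(2) S2(1)])
  also have "\<dots> = (\<Sum>i\<in>I. \<Sum>i'\<in>I. hmult A (bvec i) (bvec i') (x, k) *
       (\<Sum>h\<in>carrier H. S (i, (y, h)) * T (i', (?y h, ?l h))))"
    using c unfolding B_def by (simp only: group.double_sel(2)[OF grp(2)] simp_thms if_True)
  also have "\<dots> = (\<Sum>i\<in>I. \<Sum>h\<in>carrier H. \<Sum>i'\<in>I. hmult A (bvec i) (bvec i') (x, k) *
       (S (i, (y, h)) * T (i', (?y h, ?l h))))"
    unfolding sum_distrib_left by (intro sum.cong refl sum.swap)
  also have "\<dots> = (\<Sum>h\<in>carrier H. \<Sum>i\<in>I. \<Sum>i'\<in>I. hmult A (bvec i) (bvec i') (x, k) *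
       (S (i, (y, h)) * T (i', (?y h, ?l h))))"
    by (rule sum.swap)
  also have "\<dots> = (\<Sum>h\<in>carrier H. \<Sum>i\<in>I. S (i, (y, h)) *
       (\<Sum>i'\<in>I. T (i', (?y h, ?l h)) * hmult A (bvec i) (bvec i') (x, k)))"
    by (simp only: sum_distrib_left mult_ac)
  also have "\<dots> = (\<Sum>h\<in>carrier H. \<Sum>i\<in>I. S (i, (y, h)) *
       hmult A (bvec i) (\<lambda>i'. T (i', (?y h, ?l h))) (x, k))"
    by (simp only: linear_on_expand[OF linA(1) I(1) S1(2)])
  also have "\<dots> = (\<Sum>h\<in>carrier H.
       hmult A (\<lambda>i. S (i, (y, h))) (\<lambda>i'. T (i', (?y h, ?l h))) (x, k))"
    by (simp only: linear_on_expand[OF linA(2) I(1) S1(1)])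
  also have "\<dots> = (\<Sum>h\<in>carrier H. \<Sum>g\<in>carrier G. S ((x, g), (y, h)) *
       T ((inv g \<otimes> x \<otimes> g, inv g \<otimes> k), (?y h, ?l h)))"
    using c unfolding A_def by (simp only: group.double_sel(2)[OF grp(1)] simp_thms if_True)
  also have "\<dots> = (\<Sum>g\<in>carrier G. \<Sum>h\<in>carrier H. S ((x, g), (y, h)) *
       T ((inv g \<otimes> x \<otimes> g, inv g \<otimes> k), (?y h, ?l h)))"
    by (rule sum.swap)
  finally show ?thesis .
qed

context group begin

lemma double_mult_smash:
  assumes fin: "finite (carrier G)" and g: "g \<in> carrier G" "h \<in> carrier G"
    and a: "a \<in> fspace (carrier G)"
  shows "hmult (double G) (tens a (bvec g)) (tens b (bvec h)) =
    tens (\<lambda>x. a x * conj_act G g b x) (bvec (g \<otimes> h))"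
proof (rule ext, clarify)
  fix x k
  have e: "inv g \<otimes> k = h \<longleftrightarrow> k = g \<otimes> h" if "k \<in> carrier G"
    using that g by auto
  have "(\<Sum>f\<in>carrier G. a x * bvec g f * (b (inv f \<otimes> x \<otimes> f) * bvec h (inv f \<otimes> k))) =
    (\<Sum>f\<in>carrier G. if f = g then a x * (b (inv g \<otimes> x \<otimes> g) * bvec h (inv g \<otimes> k)) else 0)"
    by (rule sum.cong) (auto simp: bvec_def)
  then show "hmult (double G) (tens a (bvec g)) (tens b (bvec h)) (x, k) =
      tens (\<lambda>x. a x * conj_act G g b x) (bvec (g \<otimes> h)) (x, k)"
    using g fin a e by (auto simp: double_sel tens_def conj_act_def bvec_def fspace_def)
qed

lemma sum_translate:
  "a \<in> carrier G \<Longrightarrow> (\<Sum>g\<in>carrier G. f g) = (\<Sum>g\<in>carrier G. f (a \<otimes> g))"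
  by (rule sum.reindex_bij_witness[where i = "\<lambda>g. a \<otimes> g" and j = "\<lambda>g. inv a \<otimes> g"]) auto

lemma sum_inv: "(\<Sum>g\<in>carrier G. f g) = (\<Sum>g\<in>carrier G. f (inv g))"
  by (rule sum.reindex_bij_witness[where i = "\<lambda>g. inv g" and j = "\<lambda>g. inv g"]) auto

lemma hopf_algebra_double:
  assumes fin: "finite (carrier G)"
  shows "hopf_algebra (double G :: ('a \<times> 'a, 'k::field) hopf)"
proof -
  define I where "I = carrier G \<times> carrier G"
  define A where "A = (double G :: ('a \<times> 'a, 'k) hopf)"
  have I: "finite I" using fin by (simp add: I_def)
  have b: "hbasis A = I" by (simp add: A_def I_def double_sel)
  note lin = double_linear[OF fin, where ?'k = 'k, folded I_def A_def]
  note sel = double_sel(2-)[where ?'k = 'k, folded A_def]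
  have lin_in: "f v \<in> fspace J'" if "linear_on J J' f" "v \<in> fspace J"
    for f and v :: "'i \<Rightarrow> 'k" and J :: "'i set" and J' :: "'j set"
    using that by (auto simp: linear_on_def)
  have eqI: "v = w" if "v \<in> fspace I" "w \<in> fspace I"
    "\<And>x k. x \<in> carrier G \<Longrightarrow> k \<in> carrier G \<Longrightarrow> v (x, k) = w (x, k)" for v w :: "'a \<times> 'a \<Rightarrow> 'k"
  proof (rule ext, clarify)
    fix x k show "v (x, k) = w (x, k)"
      using that(1,2) that(3)[of x k] by (cases "(x, k) \<in> I") (simp_all add: fspace_def I_def)
  qed
  have unit_in: "hunit A \<in> fspace I" by (auto simp: fspace_def I_def sel)
  have assoc: "hmult A (hmult A x y) z = hmult A x (hmult A y z)"
    if "x \<in> fspace I" "y \<in> fspace I" "z \<in> fspace I" for x y z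
  proof (rule eqI)
    fix p k assume c: "p \<in> carrier G" "k \<in> carrier G"
    have "hmult A (hmult A x y) z (p, k) = (\<Sum>a\<in>carrier G. \<Sum>g\<in>carrier G.
        x (p, a) * y (inv a \<otimes> p \<otimes> a, inv a \<otimes> g) * z (inv g \<otimes> p \<otimes> g, inv g \<otimes> k))"
      using c by (subst sum.swap) (simp add: sel sum_distrib_right)
    also have "\<dots> = (\<Sum>a\<in>carrier G. \<Sum>g\<in>carrier G. x (p, a) * y (inv a \<otimes> p \<otimes> a, g) *
        z (inv g \<otimes> (inv a \<otimes> p \<otimes> a) \<otimes> g, inv g \<otimes> (inv a \<otimes> k)))"
      by (rule sum.cong[OF refl], subst sum_translate) (auto simp: m_assoc inv_mult_group c)
    also have "\<dots> = hmult A x (hmult A y z) (p, k)"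
      using c by (simp add: sel sum_distrib_left mult_ac)
    finally show "hmult A (hmult A x y) z (p, k) = hmult A x (hmult A y z) (p, k)" .
  qed (use that lin_in[OF lin(1)] in auto)
  have unit: "hmult A (hunit A) x = x" "hmult A x (hunit A) = x" if x: "x \<in> fspace I" for x
  proof -
    have "hmult A (hunit A) x (p, k) = x (p, k)" if "p \<in> carrier G" "k \<in> carrier G" for p k
    proof -
      have "hmult A (hunit A) x (p, k) =
        (\<Sum>g\<in>carrier G. if g = \<one> then x (inv g \<otimes> p \<otimes> g, inv g \<otimes> k) else 0)"
        using that by (auto simp: sel intro!: sum.cong)
      then show ?thesis using fin that by simp
    qed
    then show "hmult A (hunit A) x = x"
      by (intro eqI lin_in[OF lin(1)] x) auto
    have "hmult A x (hunit A) (p, k) = x (p, k)" if "p \<in> carrier G" "k \<in> carrier G" for p k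
    proof -
      have "inv g \<otimes> k = \<one> \<longleftrightarrow> g = k" if "g \<in> carrier G" for g
        using that \<open>k \<in> carrier G\<close> by (metis inv_equality inv_inv inv_closed l_inv)
      then have "hmult A x (hunit A) (p, k) = (\<Sum>g\<in>carrier G. if g = k then x (p, g) else 0)"
        using that by (auto simp: sel intro!: sum.cong)
      then show ?thesis using fin that by simp
    qed
    then show "hmult A x (hunit A) = x"
      by (intro eqI lin_in[OF lin(1)] x unit_in) auto
  qed
  have D: "hcomult A x \<in> fspace (I \<times> I)" if "x \<in> fspace I" for x
    using lin_in[OF lin(3) that] .
  have D1: "(\<lambda>i. hcomult A x (i, j)) \<in> fspace I" "(\<lambda>i. hcomult A x (j, i)) \<in> fspace I"
    if "x \<in> fspace I" for x j
    using D[OF that] by (auto simp: fspace_def simp del: split_paired_All)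
  have coassoc: "tensor_map I I (hcomult A) id (hcomult A x) ((i, j), k) =
        tensor_map I I id (hcomult A) (hcomult A x) (i, (j, k))" if "x \<in> fspace I" for x i j k
  proof (cases i; cases j; cases k)
    fix a b c d e f assume "i = (a, b)" "j = (c, d)" "k = (e, f)"
    then show ?thesis
      unfolding tensor_map_left[OF lin(3) I I D[OF that]] tensor_map_right[OF lin(3) I I D[OF that]]
      by (auto simp: sel m_assoc)
  qed
  have counit: "(\<Sum>i\<in>I. hcounit A (bvec i) * hcomult A x (i, j)) = x j"
    "(\<Sum>i\<in>I. hcomult A x (j, i) * hcounit A (bvec i)) = x j" if x: "x \<in> fspace I" for x j
  proof -
    obtain p k where j: "j = (p, k)" by (cases j)
    have 0: "x (p, k) = 0" if "\<not> (p \<in> carrier G \<and> k \<in> carrier G)"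
      using x that by (auto simp: fspace_def I_def)
    have "(\<Sum>i\<in>I. hcomult A x (i, j) * hcounit A (bvec i)) = hcounit A (\<lambda>i. hcomult A x (i, j))"
      by (rule linear_on_expand[OF lin(4) I D1(1)[OF x]])
    also have "\<dots> = (\<Sum>g\<in>carrier G. if g = k then if p \<in> carrier G then x (p, g) else 0 else 0)"
      unfolding j sel by (intro sum.cong) auto
    also have "\<dots> = x j" using fin 0 by (auto simp: j)
    finally show "(\<Sum>i\<in>I. hcounit A (bvec i) * hcomult A x (i, j)) = x j"
      by (simp add: mult.commute)
    have "(\<Sum>i\<in>I. hcomult A x (j, i) * hcounit A (bvec i)) = hcounit A (\<lambda>i. hcomult A x (j, i))"
      by (rule linear_on_expand[OF lin(4) I D1(2)[OF x]])
    also have "\<dots> = (\<Sum>g\<in>carrier G. if g = k then if p \<in> carrier G then x (p, g) else 0 else 0)"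
      unfolding j sel by (intro sum.cong) auto
    also have "\<dots> = x j" using fin 0 by (auto simp: j)
    finally show "(\<Sum>i\<in>I. hcomult A x (j, i) * hcounit A (bvec i)) = x j" .
  qed
  have comult_mult: "hcomult A (hmult A x y) = hmult (hopf_tensor A A) (hcomult A x) (hcomult A y)"
    if xy: "x \<in> fspace I" "y \<in> fspace I" for x y
  proof (rule ext, clarify)
    fix p k q l
    show "hcomult A (hmult A x y) ((p, k), (q, l)) =
      hmult (hopf_tensor A A) (hcomult A x) (hcomult A y) ((p, k), (q, l))"
    proof (cases "p \<in> carrier G \<and> k \<in> carrier G \<and> q \<in> carrier G \<and> l \<in> carrier G")
      case True
      then have c: "p \<in> carrier G" "k \<in> carrier G" "q \<in> carrier G" "l \<in> carrier G" by auto
      have "hmult (hopf_tensor A A) (hcomult A x) (hcomult A y) ((p, k), (q, l)) =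
        (\<Sum>g\<in>carrier G. \<Sum>h\<in>carrier G. hcomult A x ((p, g), (q, h)) *
          hcomult A y ((inv g \<otimes> p \<otimes> g, inv g \<otimes> k), (inv h \<otimes> q \<otimes> h, inv h \<otimes> l)))"
        using tensor_mult_double[OF is_group is_group fin fin
              D[OF xy(1), unfolded I_def] D[OF xy(2), unfolded I_def] c]
        by (simp add: A_def)
      also have "\<dots> = (\<Sum>g\<in>carrier G. \<Sum>h\<in>carrier G. if h = g then
          if k = l then x (q \<otimes> p, g) * y (inv g \<otimes> (q \<otimes> p) \<otimes> g, inv g \<otimes> k) else 0 else 0)"
        using c by (intro sum.cong) (auto simp: sel m_assoc)
      also have "\<dots> = hcomult A (hmult A x y) ((p, k), (q, l))"
        using c fin by (auto simp: sel)
      finally show ?thesis by simp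
    next
      case False
      then have "hmult A (bvec i) (bvec i') (p, k) = 0 \<or> hmult A (bvec j) (bvec j') (q, l) = 0"
        for i i' j j' by (auto simp: sel(1))
      then have "hmult (hopf_tensor A A) (hcomult A x) (hcomult A y) ((p, k), (q, l)) = 0"
        by (auto simp: hopf_tensor_def tens_def b intro!: sum.neutral)
      then show ?thesis using False by (auto simp: sel)
    qed
  qed
  have comult_unit: "hcomult A (hunit A) = tens (hunit A) (hunit A)"
  proof (rule ext, clarify)
    fix p k q l
    show "hcomult A (hunit A) ((p, k), (q, l)) = tens (hunit A) (hunit A) ((p, k), (q, l))"
      by (auto simp: sel tens_def)
  qed
  have counit_mult: "hcounit A (hmult A x y) = hcounit A x * hcounit A y" for x y
  proof -
    have "hcounit A (hmult A x y) = (\<Sum>g\<in>carrier G. \<Sum>k\<in>carrier G. x (\<one>, g) * y (\<one>, inv g \<otimes> k))"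
      by (subst sum.swap) (simp add: sel)
    also have "\<dots> = (\<Sum>g\<in>carrier G. \<Sum>k\<in>carrier G. x (\<one>, g) * y (\<one>, k))"
      by (rule sum.cong[OF refl], subst sum_translate) auto
    finally show ?thesis by (simp add: sel sum_product)
  qed
  have antipode: "(\<Sum>i\<in>I. \<Sum>j\<in>I. hcomult A x (i, j) * hmult A (hantipode A (bvec i)) (bvec j) k)
        = hcounit A x * hunit A k" (is ?th1)
    "(\<Sum>i\<in>I. \<Sum>j\<in>I. hcomult A x (i, j) * hmult A (bvec i) (hantipode A (bvec j)) k)
        = hcounit A x * hunit A k" (is ?th2) if x: "x \<in> fspace I" for x k
  proof -
    obtain p g where k: "k = (p, g)" by (cases k)
    have e: "h = h \<otimes> g \<longleftrightarrow> g = \<one>" "h = inv g \<otimes> h \<longleftrightarrow> g = \<one>"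
      if "g \<in> carrier G" "h \<in> carrier G" for h
      using that by (auto simp: eq_commute[of h])
    have z: "hunit A k = 0" "\<And>u v. hmult A u v k = 0" if "\<not> (p \<in> carrier G \<and> g \<in> carrier G)"
      using that by (auto simp: sel k)
    have "(\<Sum>i\<in>I. \<Sum>j\<in>I. hcomult A x (i, j) * hmult A (hantipode A (bvec i)) (bvec j) k) =
      (\<Sum>i\<in>I. hmult A (hantipode A (bvec i)) (\<lambda>j. hcomult A x (i, j)) k)"
      by (simp only: linear_on_expand[OF lin(1) I D1(2)[OF x]])
    also have "\<dots> = hcounit A x * hunit A k"
    proof (cases "p \<in> carrier G \<and> g \<in> carrier G")
      case True
      then have "(\<Sum>i\<in>I. hmult A (hantipode A (bvec i)) (\<lambda>j. hcomult A x (i, j)) k) =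
        (\<Sum>i\<in>I. \<Sum>h\<in>carrier G. hantipode A (bvec i) (p, h) *
          hcomult A x (i, (inv h \<otimes> p \<otimes> h, inv h \<otimes> g)))"
        unfolding k sel(1) by simp
      also have "\<dots> = (\<Sum>h\<in>carrier G. \<Sum>i\<in>I.
          hcomult A x (i, (inv h \<otimes> p \<otimes> h, inv h \<otimes> g)) * hantipode A (bvec i) (p, h))"
        by (subst sum.swap) (simp only: mult.commute)
      also have "\<dots> = (\<Sum>h\<in>carrier G.
          hantipode A (\<lambda>i. hcomult A x (i, (inv h \<otimes> p \<otimes> h, inv h \<otimes> g))) (p, h))"
        by (simp only: linear_on_expand[OF lin(5) I D1(1)[OF x]])
      also have "\<dots> = (\<Sum>h\<in>carrier G. if g = \<one> then x (\<one>, inv h) else 0)"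
        using True by (intro sum.cong) (auto simp: sel m_assoc e)
      also have "\<dots> = (if g = \<one> then (\<Sum>h\<in>carrier G. x (\<one>, inv h)) else 0)" by simp
      also have "(\<Sum>h\<in>carrier G. x (\<one>, inv h)) = hcounit A x"
        unfolding sel by (rule sum_inv[symmetric])
      finally show ?thesis using True by (simp add: k sel)
    qed (simp add: z)
    finally show ?th1 .
    have "(\<Sum>i\<in>I. \<Sum>j\<in>I. hcomult A x (i, j) * hmult A (bvec i) (hantipode A (bvec j)) k) =
      (\<Sum>j\<in>I. hmult A (\<lambda>i. hcomult A x (i, j)) (hantipode A (bvec j)) k)"
      by (subst sum.swap) (simp only: linear_on_expand[OF lin(2) I D1(1)[OF x]])
    also have "\<dots> = hcounit A x * hunit A k"
    proof (cases "p \<in> carrier G \<and> g \<in> carrier G")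
      case True
      then have "(\<Sum>j\<in>I. hmult A (\<lambda>i. hcomult A x (i, j)) (hantipode A (bvec j)) k) =
        (\<Sum>j\<in>I. \<Sum>h\<in>carrier G. hcomult A x ((p, h), j) *
          hantipode A (bvec j) (inv h \<otimes> p \<otimes> h, inv h \<otimes> g))"
        unfolding k sel(1) by simp
      also have "\<dots> = (\<Sum>h\<in>carrier G. \<Sum>j\<in>I. hcomult A x ((p, h), j) *
          hantipode A (bvec j) (inv h \<otimes> p \<otimes> h, inv h \<otimes> g))"
        by (rule sum.swap)
      also have "\<dots> = (\<Sum>h\<in>carrier G.
          hantipode A (\<lambda>j. hcomult A x ((p, h), j)) (inv h \<otimes> p \<otimes> h, inv h \<otimes> g))"
        by (simp only: linear_on_expand[OF lin(5) I D1(2)[OF x]])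
      also have "\<dots> = (\<Sum>h\<in>carrier G. if g = \<one> then x (\<one>, h) else 0)"
        using True by (intro sum.cong) (auto simp: sel m_assoc e inv_mult_group)
      also have "\<dots> = (if g = \<one> then hcounit A x else 0)" by (simp add: sel)
      finally show ?thesis using True by (simp add: k sel)
    qed (simp add: z)
    finally show ?th2 .
  qed
  have "hcounit A (hunit A) = 1"
    using fin by (simp add: sel)
  then show ?thesis
    unfolding hopf_algebra_def A_def[symmetric] b
    using I lin assoc unit_in unit coassoc counit comult_mult comult_unit counit_mult antipode
    by (intro conjI ballI allI) auto
qed

end

lemma double_ident_iso:
  fixes C :: "('c, 'm) monoid_scheme" and H :: "('h, 'n) monoid_scheme"
  assumes grp: "group C" "group H" and fin: "finite (carrier C)" "finite (carrier H)"
  defines "D \<equiv> (double (C \<times>\<times> H) :: (('c \<times> 'h) \<times> ('c \<times> 'h), 'k::field) hopf)"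
  defines "E \<equiv> hopf_tensor (double C) (double H)"
  shows "restrict double_ident (hspace D) \<in> hopf_hom D E"
    and "bij_betw (restrict double_ident (hspace D)) (hspace D) (hspace E)"
proof -
  interpret C: group C by fact
  interpret H: group H by fact
  interpret P: group "C \<times>\<times> H" by (rule DirProd_group) fact+
  let ?A = "double C :: ('c \<times> 'c, 'k) hopf" and ?B = "double H :: ('h \<times> 'h, 'k) hopf"
  define I J K where "I = carrier C \<times> carrier C" and "J = carrier H \<times> carrier H"
    and "K = (carrier C \<times> carrier H) \<times> (carrier C \<times> carrier H)"
  have [simp]: "finite I" "finite J" "finite K" using fin by (auto simp: I_def J_def K_def)
  have finP: "finite (carrier (C \<times>\<times> H))" using fin by simp
  have bE: "hbasis E = I \<times> J" and bD: "hbasis D = K"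
    by (simp_all add: E_def D_def hopf_tensor_def C.double_sel(1) H.double_sel(1) P.double_sel(1)
        I_def J_def K_def)
  have id_in: "double_ident u \<in> fspace (I \<times> J)" if "u \<in> fspace K" for u :: "_ \<Rightarrow> 'k"
    using that by (auto simp: fspace_def double_ident_def I_def J_def K_def)
  have id_lin: "linear_on K (I \<times> J) (double_ident :: _ \<Rightarrow> _ \<Rightarrow> 'k)"
    using id_in by (auto simp: linear_on_def double_ident_def fun_eq_iff)
  have inv_in: "(\<lambda>((x, y), (c, h)). t ((x, c), (y, h))) \<in> fspace K"
    if "t \<in> fspace (I \<times> J)" for t :: "_ \<Rightarrow> 'k"
    using that by (auto simp: fspace_def I_def J_def K_def)
  have "bij_betw double_ident (fspace K) (fspace (I \<times> J) :: (_ \<Rightarrow> 'k) set)"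
    by (rule bij_betw_byWitness[where f' = "\<lambda>t ((x, y), (c, h)). t ((x, c), (y, h))"])
      (use id_in inv_in in \<open>auto simp: double_ident_def fun_eq_iff\<close>)
  then show bij: "bij_betw (restrict double_ident (hspace D)) (hspace D) (hspace E)"
    unfolding bE bD by (simp cong: bij_betw_cong)
  note linA = C.double_linear[OF fin(1), where ?'k = 'k, folded I_def]
  note linB = H.double_linear[OF fin(2), where ?'k = 'k, folded J_def]
  note linD = P.double_linear[OF finP, where ?'k = 'k, folded D_def,
      unfolded DirProd_def, simplified, folded DirProd_def K_def]
  have slice: "(\<lambda>i. t (i, j)) \<in> fspace I" "(\<lambda>j. t (i, j)) \<in> fspace J"
    if "t \<in> fspace (I \<times> J)" for t :: "_ \<Rightarrow> 'k" and i j
    using that by (auto simp: fspace_def simp del: split_paired_All)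
  have expand2: "(\<Sum>i\<in>I. \<Sum>j\<in>J. t (i, j) * f (bvec i) p * g (bvec j) q) =
      f (\<lambda>i. g (\<lambda>j. t (i, j)) q) p"
    if t: "t \<in> fspace (I \<times> J)" and f: "linear_on I I' f" and g: "linear_on J J' g"
    for t :: "_ \<Rightarrow> 'k" and f :: "_ \<Rightarrow> 'p \<Rightarrow> 'k" and g :: "_ \<Rightarrow> 'q \<Rightarrow> 'k" and I' J' p q
  proof -
    have "(\<Sum>i\<in>I. \<Sum>j\<in>J. t (i, j) * f (bvec i) p * g (bvec j) q) =
      (\<Sum>i\<in>I. (\<Sum>j\<in>J. t (i, j) * g (bvec j) q) * f (bvec i) p)"
      unfolding sum_distrib_right by (simp add: mult_ac)
    also have "\<dots> = (\<Sum>i\<in>I. g (\<lambda>j. t (i, j)) q * f (bvec i) p)"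
      by (simp only: linear_on_expand[OF g \<open>finite J\<close> slice(2)[OF t]])
    also have "\<dots> = f (\<lambda>i. g (\<lambda>j. t (i, j)) q) p"
    proof (rule linear_on_expand[OF f \<open>finite I\<close>])
      have "g (\<lambda>j. t (i, j)) q = 0" if "i \<notin> I" for i
      proof -
        have "(\<lambda>j. t (i, j)) = (\<lambda>_. 0)" using t that by (auto simp: fspace_def simp del: split_paired_All)
        then show ?thesis using linear_on_0[OF g] by simp
      qed
      then show "(\<lambda>i. g (\<lambda>j. t (i, j)) q) \<in> fspace I" by (simp add: fspace_def)
    qed
    finally show ?thesis .
  qed
  have mult: "double_ident (hmult D u v) = hmult E (double_ident u) (double_ident v)"
    if uv: "u \<in> fspace K" "v \<in> fspace K" for u v
  proof (rule ext, clarify)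
    fix x k y l
    show "double_ident (hmult D u v) ((x, k), (y, l)) =
      hmult E (double_ident u) (double_ident v) ((x, k), (y, l))"
    proof (cases "x \<in> carrier C \<and> k \<in> carrier C \<and> y \<in> carrier H \<and> l \<in> carrier H")
      case True
      then have c: "x \<in> carrier C" "k \<in> carrier C" "y \<in> carrier H" "l \<in> carrier H" by auto
      show ?thesis
        unfolding E_def tensor_mult_double[OF grp fin id_in[OF uv(1), unfolded I_def J_def]
            id_in[OF uv(2), unfolded I_def J_def] c]
        using c by (auto simp: double_ident_def D_def P.double_sel(2) sum.cartesian_product
            inv_DirProd[OF grp] intro!: sum.cong)
    next
      case False
      then have "hmult ?A (bvec i) (bvec i') (x, k) = 0 \<or> hmult ?B (bvec j) (bvec j') (y, l) = 0"
        for i i' j j' by (auto simp: C.double_sel(2) H.double_sel(2))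
      then have "hmult E (double_ident u) (double_ident v) ((x, k), (y, l)) = 0"
        by (auto simp: E_def hopf_tensor_def tens_def intro!: sum.neutral)
      then show ?thesis using False by (auto simp: double_ident_def D_def P.double_sel(2))
    qed
  qed
  have unit: "double_ident (hunit D) = hunit E"
    by (auto simp: fun_eq_iff double_ident_def D_def E_def hopf_tensor_def tens_def
        C.double_sel H.double_sel P.double_sel)
  have comult: "hcomult E (double_ident u) = tensor_map K K double_ident double_ident (hcomult D u)"
    if u: "u \<in> fspace K" for u
  proof (rule ext, clarify)
    fix x c y h x' c' y' h'
    have T: "hcomult D u \<in> fspace (K \<times> K)" using linD(3) u by (auto simp: linear_on_def)
    have T1: "(\<lambda>j. hcomult D u (i, j)) \<in> fspace K" "(\<lambda>i. hcomult D u (i, j)) \<in> fspace K" for i j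
      using T by (auto simp: fspace_def simp del: split_paired_All)
    have "hcomult E (double_ident u) (((x, c), (y, h)), ((x', c'), (y', h'))) =
      hcomult ?A (\<lambda>i. hcomult ?B (\<lambda>j. double_ident u (i, j)) ((y, h), (y', h'))) ((x, c), (x', c'))"
      unfolding expand2[OF id_in[OF u] linA(3) linB(3), symmetric]
      by (simp add: E_def hopf_tensor_def C.double_sel(1) H.double_sel(1) I_def J_def)
    also have "\<dots> = hcomult D u (((x, y), (c, h)), ((x', y'), (c', h')))"
      by (auto simp: C.double_sel(4) H.double_sel(4) P.double_sel(4) D_def double_ident_def)
    also have "\<dots> = (\<Sum>i\<in>K. \<Sum>j\<in>K. hcomult D u (i, j) * bvec j ((x', y'), (c', h')) *
        bvec i ((x, y), (c, h)))"
      by (simp only: sum_distrib_right[symmetric] fspace_sum_bvec[OF \<open>finite K\<close> T1(1)]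
          fspace_sum_bvec[OF \<open>finite K\<close> T1(2)])
    also have "\<dots> = tensor_map K K double_ident double_ident (hcomult D u)
        (((x, c), (y, h)), ((x', c'), (y', h')))"
      by (simp add: tensor_map_def tens_def double_ident_def mult_ac)
    finally show "hcomult E (double_ident u) (((x, c), (y, h)), ((x', c'), (y', h'))) =
      tensor_map K K double_ident double_ident (hcomult D u)
        (((x, c), (y, h)), ((x', c'), (y', h')))" .
  qed
  have tm_restrict: "tensor_map K K (restrict f (fspace K)) (restrict g (fspace K)) t =
      tensor_map K K f g t" for t and f g :: "_ \<Rightarrow> _ \<Rightarrow> 'k"
    by (simp add: tensor_map_def fun_eq_iff)
  have counit: "hcounit E (double_ident u) = hcounit D u" if u: "u \<in> fspace K" for u
  proof -
    have "hcounit E (double_ident u) = hcounit ?A (\<lambda>i. hcounit ?B (\<lambda>j. double_ident u (i, j)))"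
      unfolding expand2[OF id_in[OF u] linA(4) linB(4), symmetric]
      by (simp add: E_def hopf_tensor_def C.double_sel(1) H.double_sel(1) I_def J_def)
    also have "\<dots> = hcounit D u"
      by (simp add: C.double_sel(5) H.double_sel(5) P.double_sel(5) D_def double_ident_def
          sum.cartesian_product split_def)
    finally show ?thesis .
  qed
  have antipode: "double_ident (hantipode D u) = hantipode E (double_ident u)"
    if u: "u \<in> fspace K" for u
  proof (rule ext, clarify)
    fix x c y h
    have "hantipode E (double_ident u) ((x, c), (y, h)) =
      hantipode ?A (\<lambda>i. hantipode ?B (\<lambda>j. double_ident u (i, j)) (y, h)) (x, c)"
      unfolding expand2[OF id_in[OF u] linA(5) linB(5), symmetric]
      by (simp add: E_def hopf_tensor_def tensor_map_def tens_def C.double_sel(1) H.double_sel(1)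
          I_def J_def mult_ac)
    also have "\<dots> = double_ident (hantipode D u) ((x, c), (y, h))"
      by (auto simp: C.double_sel(6) H.double_sel(6) P.double_sel(6) D_def double_ident_def
          inv_DirProd[OF grp])
    finally show "double_ident (hantipode D u) ((x, c), (y, h)) =
      hantipode E (double_ident u) ((x, c), (y, h))" ..
  qed
  have unit_in: "hunit D \<in> fspace K"
    by (auto simp: fspace_def D_def P.double_sel K_def)
  have in_D: "hmult D u v \<in> fspace K" "hantipode D v \<in> fspace K" if "v \<in> fspace K" for u v
    using that linD(1)[of u] linD(5) by (auto simp: linear_on_def)
  have lin_r: "linear_on K (I \<times> J) (restrict double_ident (fspace K) :: _ \<Rightarrow> _ \<Rightarrow> 'k)"
  proof -
    have "(\<lambda>i. a * v i + b * w i) \<in> fspace K" if "v \<in> fspace K" "w \<in> fspace K"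
      for a b and v w :: "_ \<Rightarrow> 'k"
      using that by (simp add: fspace_def)
    then show ?thesis using id_lin by (simp add: linear_on_def)
  qed
  show "restrict double_ident (hspace D) \<in> hopf_hom D E"
    unfolding hopf_hom_def bD bE using lin_r mult unit comult counit antipode unit_in in_D
    by (simp add: tm_restrict)
qed

end

theory Submission
  imports Defs "HOL-Computational_Algebra.Polynomial" "HOL-Library.Function_Algebras"
begin

text \<open>
  Write \<open>*\<close> for the convolution product and \<open>1 = \<iota>\<^sub>A \<pi>\<^sub>A * \<iota>\<^sub>B \<pi>\<^sub>B\<close> on \<open>\<D>(C \<times> H) = A \<otimes> B\<close>. For an automorphism
  with components \<open>\<alpha>, \<beta>, \<gamma>, \<delta>\<close> and inverse with components \<open>\<alpha>', \<beta>', \<gamma>', \<delta>'\<close> one gets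
  \<open>\<gamma>\<beta>' * \<delta>\<delta>' = 1\<close> and \<open>\<alpha>\<alpha>' * \<beta>\<gamma>' = 1\<close>. As \<open>A = \<D>(C)\<close> is commutative, \<open>\<gamma>\<beta>'\<close> is a central endomorphism
  of \<open>\<D>(H)\<close>. If \<open>\<phi> * \<psi> = 1\<close> with \<open>\<phi>\<close> nilpotent, then the image of \<open>\<psi>\<close>, a subalgebra, contains the image
  of \<open>\<phi>\<^sup>m\<close> for all \<open>m\<close> by downward induction, so that \<open>\<psi>\<close> is onto. Hence everything follows once central
  endomorphisms of \<open>\<D>(H)\<close> are known to be nilpotent, and a similar induction on images shows
  that the matrices in the claim are onto.

  Let \<open>\<theta>\<close> be a central endomorphism of \<open>\<D>(H)\<close>. The group-like elements are finite in number, so some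
  power \<open>e\<close> of \<open>\<theta>\<close> is idempotent on them. Now \<open>e(1 # g) = r(g) # v(g)\<close>, and the \<open>k\<^sup>H\<close>-part of
  \<open>e(a # 1)\<close> is \<open>a \<circ> w\<close>, for homomorphisms \<open>v, w\<close> from \<open>H\<close> to its centre and a bicharacter \<open>r\<close>. By
  Fitting's lemma \<open>v\<close> and \<open>w\<close> are nilpotent. Idempotence gives \<open>r(g, y) = r(g, w y) r(v g, y)\<close>, which
  forces \<open>r\<close>, then \<open>v\<close>, to be trivial; a power of \<open>e\<close> also kills \<open>w\<close>, and its square is trivial.
\<close>

section \<open>Multilinear algebra over finite bases\<close>

text \<open>The hypothesis on \<open>H\<close> speaks about groups, so it reaches only
  \<open>v\<close> and \<open>w\<close>; the obstacle is \<open>r\<close>, which couples them. With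
  \<open>q y = y (w y)^-1\<close> the idempotence relation becomes
  \<open>r(g, q y) = r(v g, y)\<close>. A nilpotent \<open>w\<close> has no nontrivial fixed point,
  so \<open>q\<close> is bijective, and iterating until \<open>v\<close> has died gives
  \<open>r = 1\<close>. Idempotence is sought on group-like elements only: over an infinite field
  the whole double offers no pigeonhole, and its function part is handled through \<open>w\<close>
  instead. Nilpotency is available on \<open>\<D>(H)\<close> only; the entry on
  \<open>\<D>(C)\<close> is reached through \<open>(\<beta>\<gamma>')^(k+1) = \<beta>
  (\<gamma>'\<beta>)^k \<gamma>'\<close>. As \<open>\<D>(C)\<close> is commutative and
  cocommutative, half of each \<open>Hom^c\<close> condition is automatic: commutation for
  \<open>\<beta>\<close>, cocommutation for \<open>\<gamma>\<close>. The other halves hold relative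
  to \<open>\<delta>\<close>, since the two factors of the tensor product commute and its two
  projections cocommute; bijectivity of \<open>\<delta>\<close> then replaces
  \<open>\<delta>\<close> by the identity.\<close>

lemma fspace_comb: "v \<in> fspace I \<Longrightarrow> w \<in> fspace I \<Longrightarrow> (\<lambda>i. a * v i + b * w i) \<in> fspace I"
  by (simp add: fspace_def)

lemma fspace_sum: "(\<And>s. s \<in> S \<Longrightarrow> v s \<in> fspace I) \<Longrightarrow> (\<lambda>i. \<Sum>s\<in>S. c s * v s i) \<in> fspace I"
  by (simp add: fspace_def)

lemma linear_on_in: "linear_on I J f \<Longrightarrow> v \<in> fspace I \<Longrightarrow> f v \<in> fspace J"
  by (auto simp: linear_on_def)

lemma linear_on_comb:
  "linear_on I J f \<Longrightarrow> v \<in> fspace I \<Longrightarrow> w \<in> fspace I \<Longrightarrow>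
    f (\<lambda>i. a * v i + b * w i) = (\<lambda>j. a * f v j + b * f w j)"
  by (auto simp: linear_on_def)

lemma linear_on_scale:
  assumes "linear_on I J f" "v \<in> fspace I"
  shows "f (\<lambda>i. a * v i) = (\<lambda>j. a * f v j)"
  using linear_on_comb[OF assms assms(2), of a 0] by simp

lemma linear_onI:
  assumes "\<And>v. v \<in> fspace I \<Longrightarrow> f v \<in> fspace J"
    and "\<And>v w a b. v \<in> fspace I \<Longrightarrow> w \<in> fspace I \<Longrightarrow>
      f (\<lambda>i. a * v i + b * w i) = (\<lambda>j. a * f v j + b * f w j)"
  shows "linear_on I J f"
  using assms by (auto simp: linear_on_def)

lemma linear_on_compose:
  assumes f: "linear_on I J f" and g: "linear_on J K g"
  shows "linear_on I K (\<lambda>x. g (f x))"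
  by (rule linear_onI)
    (simp_all add: linear_on_in[OF f] linear_on_in[OF g] linear_on_comb[OF f] linear_on_comb[OF g])

lemma linear_on_cong:
  assumes "linear_on I J f" "\<And>v. v \<in> fspace I \<Longrightarrow> g v = f v"
  shows "linear_on I J g"
  using assms by (intro linear_onI) (auto simp: linear_on_in linear_on_comb fspace_comb)

lemma linear_on_id: "linear_on I I (\<lambda>x. x)"
  by (rule linear_onI) auto

lemma linear_on_eqI:
  assumes f: "linear_on I J f" and g: "linear_on I K g" and I: "finite I"
    and e: "\<And>i. i \<in> I \<Longrightarrow> f (bvec i) = g (bvec i)" and v: "v \<in> fspace I"
  shows "f v = g v"
proof
  fix j show "f v j = g v j"
    unfolding linear_on_expand[OF f I v, symmetric] linear_on_expand[OF g I v, symmetric]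
    by (simp add: e)
qed

lemma bvec_apply: "bvec i j = (if j = i then 1 else 0)"
  by (simp add: bvec_def)

lemma bvec_pair: "bvec (i, j) = (tens (bvec i) (bvec j) :: _ \<Rightarrow> 'k::field)"
  by (auto simp: bvec_def tens_def fun_eq_iff)

lemma tens_in: "x \<in> fspace I \<Longrightarrow> y \<in> fspace J \<Longrightarrow> tens x y \<in> fspace (I \<times> J)"
  by (auto simp: tens_def fspace_def)

section \<open>Bilinear maps and the linear maps they induce on tensor products\<close>

definition bilinear_on ::
  "'i set \<Rightarrow> 'j set \<Rightarrow> 'l set \<Rightarrow> (('i \<Rightarrow> 'k::field) \<Rightarrow> ('j \<Rightarrow> 'k) \<Rightarrow> 'l \<Rightarrow> 'k) \<Rightarrow> bool" where
  "bilinear_on I J K \<beta> \<longleftrightarrow>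
     (\<forall>x\<in>fspace I. linear_on J K (\<beta> x)) \<and> (\<forall>y\<in>fspace J. linear_on I K (\<lambda>x. \<beta> x y))"

lemma bilinear_onI:
  assumes "\<And>x. x \<in> fspace I \<Longrightarrow> linear_on J K (\<beta> x)"
    and "\<And>y. y \<in> fspace J \<Longrightarrow> linear_on I K (\<lambda>x. \<beta> x y)"
  shows "bilinear_on I J K \<beta>"
  using assms by (simp add: bilinear_on_def)

lemma bilinear_on_left: "bilinear_on I J K \<beta> \<Longrightarrow> y \<in> fspace J \<Longrightarrow> linear_on I K (\<lambda>x. \<beta> x y)"
  by (simp add: bilinear_on_def)

lemma bilinear_on_right: "bilinear_on I J K \<beta> \<Longrightarrow> x \<in> fspace I \<Longrightarrow> linear_on J K (\<beta> x)"
  by (simp add: bilinear_on_def)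

lemma bilinear_on_in:
  assumes "bilinear_on I J K \<beta>" "x \<in> fspace I" "y \<in> fspace J"
  shows "\<beta> x y \<in> fspace K"
  by (rule linear_on_in[OF bilinear_on_right[OF assms(1,2)] assms(3)])

lemma bilinear_on_compose:
  fixes \<beta> :: "('i \<Rightarrow> 'k::field) \<Rightarrow> ('j \<Rightarrow> 'k) \<Rightarrow> 'l \<Rightarrow> 'k"
    and f :: "('a \<Rightarrow> 'k) \<Rightarrow> 'i \<Rightarrow> 'k" and g :: "('b \<Rightarrow> 'k) \<Rightarrow> 'j \<Rightarrow> 'k"
  assumes b: "bilinear_on I J K \<beta>" and f: "linear_on I' I f" and g: "linear_on J' J g"
  shows "bilinear_on I' J' K (\<lambda>x y. \<beta> (f x) (g y))"
proof (rule bilinear_onI)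
  fix x :: "'a \<Rightarrow> 'k" assume "x \<in> fspace I'"
  then show "linear_on J' K (\<lambda>y. \<beta> (f x) (g y))"
    by (intro linear_on_compose[OF g] bilinear_on_right[OF b] linear_on_in[OF f])
next
  fix y :: "'b \<Rightarrow> 'k" assume "y \<in> fspace J'"
  then show "linear_on I' K (\<lambda>x. \<beta> (f x) (g y))"
    using linear_on_compose[OF f bilinear_on_left[OF b linear_on_in[OF g]]] by blast
qed

lemma bilinear_on_flip: "bilinear_on I J K \<beta> \<Longrightarrow> bilinear_on J I K (\<lambda>x y. \<beta> y x)"
  by (simp add: bilinear_on_def)

lemma bilinear_tens: "bilinear_on I J (I \<times> J) tens"
  by (intro bilinear_onI linear_onI tens_in; assumption?)
    (simp_all add: tens_def split_def distrib_left distrib_right mult_ac)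

text \<open>The linear map on the tensor product induced by a bilinear map; applied to \<open>\<Delta>(x)\<close> it is
  the Sweedler expression \<open>\<phi>(x\<^sub>1, x\<^sub>2)\<close>.\<close>

definition lift ::
  "'i set \<Rightarrow> 'j set \<Rightarrow> (('i \<Rightarrow> 'k) \<Rightarrow> ('j \<Rightarrow> 'k) \<Rightarrow> 'r \<Rightarrow> 'k) \<Rightarrow> ('i \<times> 'j \<Rightarrow> 'k) \<Rightarrow> 'r \<Rightarrow> 'k::field" where
  "lift I J \<phi> T = (\<lambda>r. \<Sum>p\<in>I \<times> J. T p * \<phi> (bvec (fst p)) (bvec (snd p)) r)"

lemma lift_double_sum:
  "lift I J \<phi> T = (\<lambda>r. \<Sum>i\<in>I. \<Sum>j\<in>J. T (i, j) * \<phi> (bvec i) (bvec j) r)"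
  by (simp add: lift_def sum.cartesian_product split_def)

lemma lift_cong:
  assumes "\<And>i j. i \<in> I \<Longrightarrow> j \<in> J \<Longrightarrow> \<phi> (bvec i) (bvec j) = \<psi> (bvec i) (bvec j)"
  shows "lift I J \<phi> T = lift I J \<psi> T"
  using assms by (auto simp: lift_def fun_eq_iff intro!: sum.cong)

lemma lift_in:
  assumes "\<And>i j. i \<in> I \<Longrightarrow> j \<in> J \<Longrightarrow> \<phi> (bvec i) (bvec j) \<in> fspace K"
  shows "lift I J \<phi> T \<in> fspace K"
  unfolding lift_def using assms by (intro fspace_sum) auto

lemma lift_linear:
  assumes "\<And>i j. i \<in> I \<Longrightarrow> j \<in> J \<Longrightarrow> \<phi> (bvec i) (bvec j) \<in> fspace K"
  shows "linear_on (I \<times> J) K (lift I J \<phi>)"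
proof (rule linear_onI)
  show "lift I J \<phi> T \<in> fspace K" for T by (rule lift_in) fact
  show "lift I J \<phi> (\<lambda>p. a * S p + b * T p) = (\<lambda>r. a * lift I J \<phi> S r + b * lift I J \<phi> T r)"
    for a b S T
    by (simp add: lift_def sum_distrib_left sum.distrib algebra_simps)
qed

lemma lift_bvec:
  assumes "finite I" "finite J" "i \<in> I" "j \<in> J"
  shows "lift I J \<phi> (bvec (i, j)) = \<phi> (bvec i) (bvec j)"
proof
  fix r
  have "lift I J \<phi> (bvec (i, j)) r = (\<Sum>p\<in>I \<times> J. if p = (i, j) then \<phi> (bvec i) (bvec j) r else 0)"
    unfolding lift_def by (rule sum.cong) (auto simp: bvec_def)
  then show "lift I J \<phi> (bvec (i, j)) r = \<phi> (bvec i) (bvec j) r"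
    using assms by simp
qed

lemma lift_tens:
  assumes b: "bilinear_on I J K \<beta>" and fin: "finite I" "finite J"
    and x: "x \<in> fspace I" and y: "y \<in> fspace J"
  shows "lift I J \<beta> (tens x y) = \<beta> x y"
proof
  fix r
  have "lift I J \<beta> (tens x y) r = (\<Sum>i\<in>I. x i * (\<Sum>j\<in>J. y j * \<beta> (bvec i) (bvec j) r))"
    by (simp add: lift_double_sum tens_def sum_distrib_left mult_ac)
  also have "\<dots> = (\<Sum>i\<in>I. x i * \<beta> (bvec i) y r)"
    by (rule sum.cong) (simp_all add: linear_on_expand[OF bilinear_on_right[OF b] fin(2) y])
  also have "\<dots> = \<beta> x y r"
    by (rule linear_on_expand[OF bilinear_on_left[OF b y] fin(1) x])
  finally show "lift I J \<beta> (tens x y) r = \<beta> x y r" .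
qed

lemma linear_lift:
  assumes h: "linear_on K L h" and fin: "finite I" "finite J"
    and \<phi>: "\<And>i j. i \<in> I \<Longrightarrow> j \<in> J \<Longrightarrow> \<phi> (bvec i) (bvec j) \<in> fspace K"
  shows "h (lift I J \<phi> T) = lift I J (\<lambda>a b. h (\<phi> a b)) T"
  unfolding lift_def using fin \<phi> by (intro linear_on_sum[OF h]) auto

lemma tensor_map_lift: "tensor_map I J f g T = lift I J (\<lambda>a b. tens (f a) (g b)) T"
  by (simp add: tensor_map_def lift_double_sum)

lemma lift_tensor_map:
  assumes b: "bilinear_on I' J' K \<beta>" and fin: "finite I" "finite J" "finite I'" "finite J'"
    and f: "linear_on I I' f" and g: "linear_on J J' g"
  shows "lift I' J' \<beta> (tensor_map I J f g T) = lift I J (\<lambda>a b. \<beta> (f a) (g b)) T"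
proof -
  have "linear_on (I' \<times> J') K (lift I' J' \<beta>)"
    by (rule lift_linear) (auto intro: bilinear_on_in[OF b])
  then have "lift I' J' \<beta> (tensor_map I J f g T) =
      lift I J (\<lambda>a b. lift I' J' \<beta> (tens (f a) (g b))) T"
    unfolding tensor_map_lift
    by (rule linear_lift) (auto intro!: fin tens_in linear_on_in[OF f] linear_on_in[OF g])
  also have "\<dots> = lift I J (\<lambda>a b. \<beta> (f a) (g b)) T"
    by (rule lift_cong)
      (simp add: lift_tens[OF b] fin linear_on_in[OF f] linear_on_in[OF g])
  finally show ?thesis .
qed

lemma lift_flip: "lift I J \<phi> (\<lambda>(i, j). T (j, i)) = lift J I (\<lambda>a b. \<phi> b a) T"
  unfolding lift_double_sum by (subst sum.swap) simp

lemma lift_tens_id: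
  fixes T :: "'i \<times> 'j \<Rightarrow> 'k::field"
  assumes "finite I" "finite J" "T \<in> fspace (I \<times> J)"
  shows "lift I J tens T = T"
proof -
  have l: "linear_on (I \<times> J) (I \<times> J) (lift I J (tens :: _ \<Rightarrow> _ \<Rightarrow> _ \<Rightarrow> 'k))"
    by (rule lift_linear) (auto intro: tens_in)
  show ?thesis
    by (rule linear_on_eqI[OF l linear_on_id _ _ assms(3)])
      (use assms in \<open>auto simp: lift_bvec simp flip: bvec_pair\<close>)
qed

text \<open>A kernel vector with \<open>v i0 \<noteq> 0\<close> makes the column
  \<open>f (bvec i0)\<close> a combination of the other columns, so a surjective \<open>f\<close>
  would span \<open>fspace I\<close> by fewer than \<open>card I\<close> vectors. Bijectivity of an
  endomorphism can thus be checked as surjectivity.\<close>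

lemma linear_surj_imp_inj:
  fixes f :: "('i \<Rightarrow> 'k::field) \<Rightarrow> 'i \<Rightarrow> 'k"
  assumes f: "linear_on I I f" and I: "finite I" and surj: "fspace I \<subseteq> f ` fspace I"
  shows "inj_on f (fspace I)"
proof -
  interpret V: vector_space "\<lambda>(a::'k) (v::'i \<Rightarrow> 'k) i. a * v i"
    by standard (auto simp: fun_eq_iff algebra_simps)
  have sum_ev: "sum g S i = (\<Sum>s\<in>S. g s i)" for g :: "'z \<Rightarrow> 'i \<Rightarrow> 'k" and S i
    by (induction S rule: infinite_finite_induct) auto
  have ker: "v = (\<lambda>_. 0)" if v: "v \<in> fspace I" "f v = (\<lambda>_. 0)" for v
  proof (rule ccontr)
    assume "v \<noteq> (\<lambda>_. 0)"
    then obtain i0 where i0: "v i0 \<noteq> 0" by auto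
    with v(1) have i0I: "i0 \<in> I" by (auto simp: fspace_def)
    let ?c = "\<lambda>i. f (bvec i)"
    define W where "W = V.span (?c ` (I - {i0}))"
    have cW: "?c i \<in> W" if "i \<in> I" for i
    proof (cases "i = i0")
      case True
      have "0 = (\<Sum>i\<in>I. v i * ?c i j)" for j
        using linear_on_expand[OF f I v(1)] v(2) by simp
      then have "v i0 * ?c i0 j = - (\<Sum>i\<in>I - {i0}. v i * ?c i j)" for j
        using I i0I by (simp add: sum.remove eq_neg_iff_add_eq_0)
      then have "?c i0 j = - (\<Sum>i\<in>I - {i0}. v i * ?c i j) / v i0" for j
        using i0 by (metis nonzero_mult_div_cancel_left)
      then have "?c i0 j = (\<Sum>i\<in>I - {i0}. (- (v i / v i0)) * ?c i j)" for j
        by (simp add: sum_divide_distrib sum_negf)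
      then have "?c i0 = (\<Sum>i\<in>I - {i0}. (\<lambda>j. (- (v i / v i0)) * ?c i j))"
        by (simp add: fun_eq_iff sum_ev)
      also have "\<dots> \<in> W" unfolding W_def
        by (intro V.span_sum V.span_scale V.span_base) auto
      finally show ?thesis using True by simp
    next
      case False
      then show ?thesis using that by (auto simp: W_def intro!: V.span_base)
    qed
    have fsub: "fspace I \<subseteq> W"
    proof
      fix u :: "'i \<Rightarrow> 'k" assume "u \<in> fspace I"
      then obtain x where x: "x \<in> fspace I" "u = f x" using surj by auto
      have "u = (\<Sum>i\<in>I. (\<lambda>j. x i * ?c i j))"
        using linear_on_expand[OF f I x(1)] x(2) by (auto simp: fun_eq_iff sum_ev)
      also have "\<dots> \<in> W" using cW unfolding W_def by (intro V.span_sum V.span_scale) auto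
      finally show "u \<in> W" .
    qed
    have injb: "inj_on (bvec :: 'i \<Rightarrow> 'i \<Rightarrow> 'k) I"
      by (rule inj_onI) (metis bvec_def zero_neq_one)
    have ind: "V.independent (bvec ` I)"
    proof (rule V.independent_if_scalars_zero)
      show "finite (bvec ` I :: ('i \<Rightarrow> 'k) set)" using I by simp
      fix g :: "('i \<Rightarrow> 'k) \<Rightarrow> 'k" and b :: "'i \<Rightarrow> 'k"
      assume s: "(\<Sum>x\<in>bvec ` I. (\<lambda>i. g x * x i)) = 0" and b: "b \<in> bvec ` I"
      from b obtain j where j: "j \<in> I" "b = bvec j" by auto
      have "0 = (\<Sum>x\<in>bvec ` I. (\<lambda>i. g x * x i)) j" using s by simp
      also have "\<dots> = (\<Sum>i\<in>I. g (bvec i) * bvec i j)"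
        by (simp add: sum_ev sum.reindex[OF injb])
      also have "\<dots> = (\<Sum>i\<in>I. if i = j then g (bvec i) else 0)"
        by (rule sum.cong) (auto simp: bvec_def)
      also have "\<dots> = g b" using I j by simp
      finally show "g b = 0" by simp
    qed
    have "bvec ` I \<subseteq> V.span (?c ` (I - {i0}))"
      using fsub unfolding W_def by (auto intro: bvec_in_fspace)
    then have "card (bvec ` I :: ('i \<Rightarrow> 'k) set) \<le> card (?c ` (I - {i0}))"
      using V.independent_span_bound[OF _ ind, of "?c ` (I - {i0})"] I by simp
    also have "\<dots> \<le> card (I - {i0})" using I by (intro card_image_le) auto
    also have "\<dots> < card I" using I i0I by (intro psubset_card_mono) auto
    finally show False by (simp add: card_image[OF injb])
  qed
  show ?thesis
  proof (rule inj_onI)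
    fix x y assume xy: "x \<in> fspace I" "y \<in> fspace I" "f x = f y"
    have "(\<lambda>i. 1 * x i + (- 1) * y i) = (\<lambda>_. 0)"
      by (rule ker[OF fspace_comb[OF xy(1,2)]], subst linear_on_comb[OF f xy(1,2)]) (simp add: xy(3))
    then show "x = y" by (simp add: fun_eq_iff)
  qed
qed

section \<open>Convolution\<close>

lemma lift_swap:
  "lift I J (\<lambda>a b. lift K L (\<phi> a b) T) S = lift K L (\<lambda>c d. lift I J (\<lambda>a b. \<phi> a b c d) S) T"
  unfolding lift_def sum_distrib_left by (subst sum.swap) (simp add: mult_ac)

text \<open>Only the algebra structure of the target enters a convolution product. It is isolated
  here because the target is at times the tensor square of a Hopf algebra, for which just this
  structure is established.\<close>

locale fd_algebra =
  fixes K :: "'i set" and m :: "('i \<Rightarrow> 'k::field) \<Rightarrow> ('i \<Rightarrow> 'k) \<Rightarrow> 'i \<Rightarrow> 'k" and u :: "'i \<Rightarrow> 'k"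
  assumes fin: "finite K"
    and bil: "bilinear_on K K K m"
    and unit_in: "u \<in> fspace K"
    and assoc: "\<lbrakk>x \<in> fspace K; y \<in> fspace K; z \<in> fspace K\<rbrakk> \<Longrightarrow> m (m x y) z = m x (m y z)"
    and unit_left: "x \<in> fspace K \<Longrightarrow> m u x = x"
    and unit_right: "x \<in> fspace K \<Longrightarrow> m x u = x"
begin

lemma mult_in: "x \<in> fspace K \<Longrightarrow> y \<in> fspace K \<Longrightarrow> m x y \<in> fspace K"
  by (rule bilinear_on_in[OF bil])

end

locale hopf_alg =
  fixes A :: "('i, 'k::field) hopf"
  assumes hopf_axioms: "hopf_algebra A"
begin

abbreviation "I \<equiv> hbasis A"
abbreviation "\<Delta> \<equiv> hcomult A"
abbreviation "\<epsilon> \<equiv> hcounit A"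
abbreviation "S \<equiv> hantipode A"
abbreviation "\<eta> \<equiv> hunit A"

lemma fin: "finite I"
  and coassoc: "x \<in> hspace A \<Longrightarrow> tensor_map I I \<Delta> id (\<Delta> x) ((i, j), k) =
    tensor_map I I id \<Delta> (\<Delta> x) (i, (j, k))"
  and comult_linear: "linear_on I (I \<times> I) \<Delta>"
  and counit_linear: "linear_on I (UNIV :: unit set) (\<lambda>x _. \<epsilon> x)"
  and counit_left: "x \<in> hspace A \<Longrightarrow> (\<Sum>i\<in>I. \<epsilon> (bvec i) * \<Delta> x (i, j)) = x j"
  and counit_right: "x \<in> hspace A \<Longrightarrow> (\<Sum>i\<in>I. \<Delta> x (j, i) * \<epsilon> (bvec i)) = x j"
  and comult_mult: "x \<in> hspace A \<Longrightarrow> y \<in> hspace A \<Longrightarrow>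
    \<Delta> (hmult A x y) = hmult (hopf_tensor A A) (\<Delta> x) (\<Delta> y)"
  and comult_unit: "\<Delta> \<eta> = tens \<eta> \<eta>"
  and counit_mult: "x \<in> hspace A \<Longrightarrow> y \<in> hspace A \<Longrightarrow> \<epsilon> (hmult A x y) = \<epsilon> x * \<epsilon> y"
  and antipode_linear: "linear_on I I S"
  and antipode_left: "x \<in> hspace A \<Longrightarrow> (\<Sum>i\<in>I. \<Sum>j\<in>I.
           \<Delta> x (i, j) * hmult A (S (bvec i)) (bvec j) k) = \<epsilon> x * \<eta> k"
  and antipode_right: "x \<in> hspace A \<Longrightarrow> (\<Sum>i\<in>I. \<Sum>j\<in>I.
           \<Delta> x (i, j) * hmult A (bvec i) (S (bvec j)) k) = \<epsilon> x * \<eta> k"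
  using hopf_axioms unfolding hopf_algebra_def by blast+

sublocale alg: fd_algebra I "hmult A" \<eta>
  using hopf_axioms unfolding hopf_algebra_def by unfold_locales (auto intro!: bilinear_onI)

lemma comult_in: "x \<in> hspace A \<Longrightarrow> \<Delta> x \<in> fspace (I \<times> I)"
  by (rule linear_on_in[OF comult_linear])

lemma counit_expand: "x \<in> hspace A \<Longrightarrow> (\<Sum>i\<in>I. x i * \<epsilon> (bvec i)) = \<epsilon> x"
  using linear_on_expand[OF counit_linear fin] by simp

text \<open>\<open>lift\<close> samples on basis vectors only, so \<open>\<tau>\<close> may be
  arbitrary: both sides are the same sum weighted by the coefficients of the iterated
  comultiplication, which \<open>coassoc\<close> identifies.\<close>

lemma coassoc_lift:
  assumes x: "x \<in> hspace A"
  shows "lift I I (\<lambda>a b. lift I I (\<lambda>c d. \<tau> c d b) (\<Delta> a)) (\<Delta> x) =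
    lift I I (\<lambda>a b. lift I I (\<lambda>c d. \<tau> a c d) (\<Delta> b)) (\<Delta> x)"
proof
  fix r
  have D1: "(\<lambda>i. \<Delta> x (i, k)) \<in> hspace A" "(\<lambda>i. \<Delta> x (k, i)) \<in> hspace A" for k
    using comult_in[OF x] by (auto simp: fspace_def)
  have e: "\<Delta> (\<lambda>l. \<Delta> x (l, k)) (i, j) = \<Delta> (\<lambda>l. \<Delta> x (i, l)) (j, k)" for i j k
    using coassoc[OF x, of i j k]
    unfolding tensor_map_left[OF comult_linear fin fin comult_in[OF x]]
      tensor_map_right[OF comult_linear fin fin comult_in[OF x]] .
  have "lift I I (\<lambda>a b. lift I I (\<lambda>c d. \<tau> c d b) (\<Delta> a)) (\<Delta> x) r =
    (\<Sum>k\<in>I. \<Sum>l\<in>I. \<Sum>i\<in>I. \<Sum>j\<in>I. \<Delta> x (l, k) * \<Delta> (bvec l) (i, j) * \<tau> (bvec i) (bvec j) (bvec k) r)"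
    unfolding lift_double_sum sum_distrib_left by (subst sum.swap) (simp add: mult_ac)
  also have "\<dots> = (\<Sum>k\<in>I. \<Sum>i\<in>I. \<Sum>l\<in>I. \<Sum>j\<in>I.
      \<Delta> x (l, k) * \<Delta> (bvec l) (i, j) * \<tau> (bvec i) (bvec j) (bvec k) r)"
    by (rule sum.cong[OF refl], rule sum.swap)
  also have "\<dots> = (\<Sum>k\<in>I. \<Sum>i\<in>I. \<Sum>j\<in>I. \<Sum>l\<in>I.
      \<Delta> x (l, k) * \<Delta> (bvec l) (i, j) * \<tau> (bvec i) (bvec j) (bvec k) r)"
    by (rule sum.cong[OF refl], rule sum.cong[OF refl], rule sum.swap)
  also have "\<dots> = (\<Sum>k\<in>I. \<Sum>i\<in>I. \<Sum>j\<in>I. \<Delta> (\<lambda>l. \<Delta> x (l, k)) (i, j) * \<tau> (bvec i) (bvec j) (bvec k) r)"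
    by (simp only: sum_distrib_right[symmetric] linear_on_expand[OF comult_linear fin D1(1)])
  also have "\<dots> = (\<Sum>k\<in>I. \<Sum>i\<in>I. \<Sum>j\<in>I. \<Delta> (\<lambda>l. \<Delta> x (i, l)) (j, k) * \<tau> (bvec i) (bvec j) (bvec k) r)"
    by (simp only: e)
  also have "\<dots> = (\<Sum>i\<in>I. \<Sum>k\<in>I. \<Sum>j\<in>I. \<Delta> (\<lambda>l. \<Delta> x (i, l)) (j, k) * \<tau> (bvec i) (bvec j) (bvec k) r)"
    by (rule sum.swap)
  also have "\<dots> = (\<Sum>i\<in>I. \<Sum>j\<in>I. \<Sum>k\<in>I. \<Delta> (\<lambda>l. \<Delta> x (i, l)) (j, k) * \<tau> (bvec i) (bvec j) (bvec k) r)"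
    by (rule sum.cong[OF refl], rule sum.swap)
  also have "\<dots> = (\<Sum>i\<in>I. \<Sum>j\<in>I. \<Sum>k\<in>I. \<Sum>l\<in>I.
      \<Delta> x (i, l) * \<Delta> (bvec l) (j, k) * \<tau> (bvec i) (bvec j) (bvec k) r)"
    by (simp only: sum_distrib_right[symmetric] linear_on_expand[OF comult_linear fin D1(2)])
  also have "\<dots> = (\<Sum>i\<in>I. \<Sum>j\<in>I. \<Sum>l\<in>I. \<Sum>k\<in>I.
      \<Delta> x (i, l) * \<Delta> (bvec l) (j, k) * \<tau> (bvec i) (bvec j) (bvec k) r)"
    by (rule sum.cong[OF refl], rule sum.cong[OF refl], rule sum.swap)
  also have "\<dots> = (\<Sum>i\<in>I. \<Sum>l\<in>I. \<Sum>j\<in>I. \<Sum>k\<in>I.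
      \<Delta> x (i, l) * \<Delta> (bvec l) (j, k) * \<tau> (bvec i) (bvec j) (bvec k) r)"
    by (rule sum.cong[OF refl], rule sum.swap)
  also have "\<dots> = lift I I (\<lambda>a b. lift I I (\<lambda>c d. \<tau> a c d) (\<Delta> b)) (\<Delta> x) r"
    unfolding lift_double_sum sum_distrib_left by (simp add: mult_ac)
  finally show "lift I I (\<lambda>a b. lift I I (\<lambda>c d. \<tau> c d b) (\<Delta> a)) (\<Delta> x) r =
    lift I I (\<lambda>a b. lift I I (\<lambda>c d. \<tau> a c d) (\<Delta> b)) (\<Delta> x) r" .
qed

lemma tensor_mult_lift:
  "hmult (hopf_tensor A A) v w =
    lift I I (\<lambda>a b. lift I I (\<lambda>c d. tens (hmult A a c) (hmult A b d)) w) v"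
  unfolding lift_double_sum by (simp add: hopf_tensor_def sum_distrib_left mult.assoc)

lemma tensor_mult_bilinear: "bilinear_on (I \<times> I) (I \<times> I) (I \<times> I) (hmult (hopf_tensor A A))"
proof (rule bilinear_onI)
  show "linear_on (I \<times> I) (I \<times> I) (\<lambda>v. hmult (hopf_tensor A A) v w)" for w
    unfolding tensor_mult_lift by (intro lift_linear lift_in tens_in alg.mult_in bvec_in_fspace)
  show "linear_on (I \<times> I) (I \<times> I) (hmult (hopf_tensor A A) v)" for v
    unfolding tensor_mult_lift
    by (subst lift_swap) (intro lift_linear lift_in tens_in alg.mult_in bvec_in_fspace)
qed

lemma tensor_mult_tens:
  assumes a: "a \<in> hspace A" "b \<in> hspace A" "c \<in> hspace A" "d \<in> hspace A"
  shows "hmult (hopf_tensor A A) (tens a b) (tens c d) = tens (hmult A a c) (hmult A b d)"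
proof -
  have 1: "bilinear_on I I (I \<times> I) (\<lambda>c d. tens (hmult A a c) (hmult A b d))"
    if "a \<in> hspace A" "b \<in> hspace A" for a b
    by (rule bilinear_on_compose[OF bilinear_tens]) (intro bilinear_on_right[OF alg.bil] that)+
  have 2: "bilinear_on I I (I \<times> I) (\<lambda>a b. tens (hmult A a c) (hmult A b d))"
    by (rule bilinear_on_compose[OF bilinear_tens]) (intro bilinear_on_left[OF alg.bil] a)+
  have "hmult (hopf_tensor A A) (tens a b) (tens c d) =
      lift I I (\<lambda>a b. tens (hmult A a c) (hmult A b d)) (tens a b)"
    unfolding tensor_mult_lift by (rule lift_cong) (simp add: lift_tens[OF 1 fin fin a(3,4)])
  then show ?thesis by (simp add: lift_tens[OF 2 fin fin a(1,2)])
qed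

text \<open>The laws are clear on pure tensors. Associativity extends to general tensors one
  argument at a time (third, second, first), each time as an equality of two linear maps.\<close>

lemma fd_algebra_tensor: "fd_algebra (I \<times> I) (hmult (hopf_tensor A A)) (tens \<eta> \<eta>)"
proof -
  let ?M = "hmult (hopf_tensor A A)"
  have L: "linear_on (I \<times> I) (I \<times> I) (\<lambda>x. ?M x y)" if "y \<in> fspace (I \<times> I)" for y
    by (rule bilinear_on_left[OF tensor_mult_bilinear that])
  have R: "linear_on (I \<times> I) (I \<times> I) (?M x)" if "x \<in> fspace (I \<times> I)" for x
    by (rule bilinear_on_right[OF tensor_mult_bilinear that])
  have M: "?M x y \<in> fspace (I \<times> I)" if "x \<in> fspace (I \<times> I)" "y \<in> fspace (I \<times> I)" for x y
    by (rule bilinear_on_in[OF tensor_mult_bilinear that])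
  have fin2: "finite (I \<times> I)" using fin by simp
  have B: "bvec p \<in> fspace (I \<times> I)" if "p \<in> I \<times> I" for p using that by simp
  note simps = bvec_pair tensor_mult_tens alg.mult_in alg.assoc alg.unit_in alg.unit_left alg.unit_right
  have 1: "?M (?M (bvec p) (bvec q)) (bvec r) = ?M (bvec p) (?M (bvec q) (bvec r))"
    if "p \<in> I \<times> I" "q \<in> I \<times> I" "r \<in> I \<times> I" for p q r
    using that by (cases p; cases q; cases r) (simp add: simps)
  have 2: "?M (?M (bvec p) (bvec q)) z = ?M (bvec p) (?M (bvec q) z)"
    if "p \<in> I \<times> I" "q \<in> I \<times> I" "z \<in> fspace (I \<times> I)" for p q z
    by (rule linear_on_eqI[OF R[OF M] linear_on_compose[OF R R] fin2 1 that(3)])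
      (use that B in auto)
  have 3: "?M (?M (bvec p) y) z = ?M (bvec p) (?M y z)"
    if "p \<in> I \<times> I" "y \<in> fspace (I \<times> I)" "z \<in> fspace (I \<times> I)" for p y z
    by (rule linear_on_eqI[OF linear_on_compose[OF R L] linear_on_compose[OF L R] fin2 2 that(2)])
      (use that B in auto)
  have 4: "?M (?M x y) z = ?M x (?M y z)"
    if "x \<in> fspace (I \<times> I)" "y \<in> fspace (I \<times> I)" "z \<in> fspace (I \<times> I)" for x y z
    by (rule linear_on_eqI[OF linear_on_compose[OF L L] L[OF M] fin2 3 that(1)])
      (use that B in auto)
  have U: "tens \<eta> \<eta> \<in> fspace (I \<times> I)" by (simp add: tens_in alg.unit_in)
  have ul: "?M (tens \<eta> \<eta>) x = x" if "x \<in> fspace (I \<times> I)" for x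
    by (rule linear_on_eqI[OF R[OF U] linear_on_id fin2 _ that]) (auto simp: simps)
  have ur: "?M x (tens \<eta> \<eta>) = x" if "x \<in> fspace (I \<times> I)" for x
    by (rule linear_on_eqI[OF L[OF U] linear_on_id fin2 _ that]) (auto simp: simps)
  show ?thesis
    using fin2 tensor_mult_bilinear U 4 ul ur by unfold_locales auto
qed

definition conv :: "(('l \<Rightarrow> 'k) \<Rightarrow> ('l \<Rightarrow> 'k) \<Rightarrow> 'l \<Rightarrow> 'k) \<Rightarrow>
    (('i \<Rightarrow> 'k) \<Rightarrow> 'l \<Rightarrow> 'k) \<Rightarrow> (('i \<Rightarrow> 'k) \<Rightarrow> 'l \<Rightarrow> 'k) \<Rightarrow> ('i \<Rightarrow> 'k) \<Rightarrow> 'l \<Rightarrow> 'k" where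
  "conv m F G x = lift I I (\<lambda>a b. m (F a) (G b)) (\<Delta> x)"

lemma conv_cong:
  assumes "\<And>x. x \<in> hspace A \<Longrightarrow> F x = F' x" "\<And>x. x \<in> hspace A \<Longrightarrow> G x = G' x"
  shows "conv m F G x = conv m F' G' x"
  unfolding conv_def by (rule lift_cong) (simp add: assms)

lemma conv_comp_left:
  assumes h: "linear_on K L h" and m: "\<And>x y. x \<in> fspace K \<Longrightarrow> y \<in> fspace K \<Longrightarrow>
      m x y \<in> fspace K \<and> h (m x y) = m' (h x) (h y)"
    and F: "linear_on I K F" and G: "linear_on I K G"
  shows "h (conv m F G x) = conv m' (\<lambda>x. h (F x)) (\<lambda>x. h (G x)) x"
proof -
  have "h (conv m F G x) = lift I I (\<lambda>a b. h (m (F a) (G b))) (\<Delta> x)"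
    unfolding conv_def
    by (rule linear_lift[OF h fin fin]) (simp add: m linear_on_in[OF F] linear_on_in[OF G])
  also have "\<dots> = conv m' (\<lambda>x. h (F x)) (\<lambda>x. h (G x)) x"
    unfolding conv_def
    by (rule lift_cong) (simp add: m linear_on_in[OF F] linear_on_in[OF G])
  finally show ?thesis .
qed

context
  fixes K :: "'l set" and m :: "('l \<Rightarrow> 'k) \<Rightarrow> ('l \<Rightarrow> 'k) \<Rightarrow> 'l \<Rightarrow> 'k" and u :: "'l \<Rightarrow> 'k"
  assumes alg: "fd_algebra K m u"
begin

interpretation T: fd_algebra K m u by (rule alg)

lemma conv_bilinear:
  "linear_on I K F \<Longrightarrow> linear_on I K G \<Longrightarrow> bilinear_on I I K (\<lambda>a b. m (F a) (G b))"
  by (rule bilinear_on_compose[OF T.bil])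

lemma conv_linear:
  assumes F: "linear_on I K F" and G: "linear_on I K G"
  shows "linear_on I K (conv m F G)"
proof -
  have "linear_on (I \<times> I) K (lift I I (\<lambda>a b. m (F a) (G b)))"
    by (rule lift_linear) (intro bilinear_on_in[OF conv_bilinear[OF F G]] bvec_in_fspace)
  from linear_on_compose[OF comult_linear this] show ?thesis
    unfolding conv_def .
qed

lemma conv_assoc:
  assumes F: "linear_on I K F" and G: "linear_on I K G" and H: "linear_on I K H"
    and x: "x \<in> hspace A"
  shows "conv m (conv m F G) H x = conv m F (conv m G H) x"
proof -
  note inK = linear_on_in[OF F] linear_on_in[OF G] linear_on_in[OF H] T.mult_in
  have "conv m (conv m F G) H x =
      lift I I (\<lambda>a b. lift I I (\<lambda>c d. m (m (F c) (G d)) (H b)) (\<Delta> a)) (\<Delta> x)"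
    unfolding conv_def
    by (rule lift_cong, rule linear_lift[OF bilinear_on_left[OF T.bil] fin fin])
      (simp_all add: inK)
  also have "\<dots> = lift I I (\<lambda>a b. lift I I (\<lambda>c d. m (m (F a) (G c)) (H d)) (\<Delta> b)) (\<Delta> x)"
    by (rule coassoc_lift[OF x])
  also have "\<dots> = lift I I (\<lambda>a b. lift I I (\<lambda>c d. m (F a) (m (G c) (H d))) (\<Delta> b)) (\<Delta> x)"
    by (rule lift_cong, rule lift_cong) (simp add: inK T.assoc)
  also have "\<dots> = conv m F (conv m G H) x"
    unfolding conv_def
    by (rule lift_cong, rule linear_lift[OF bilinear_on_right[OF T.bil] fin fin, symmetric])
      (simp_all add: inK)
  finally show ?thesis .
qed

lemma conv_unit_right:
  assumes F: "linear_on I K F" and x: "x \<in> hspace A"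
  shows "conv m F (\<lambda>x r. \<epsilon> x * u r) x = F x"
proof
  fix r
  have D1: "(\<lambda>i. \<Delta> x (i, k)) \<in> hspace A" for k
    using comult_in[OF x] by (auto simp: fspace_def)
  have "m (F (bvec i)) (\<lambda>r. \<epsilon> (bvec j) * u r) = (\<lambda>r. \<epsilon> (bvec j) * F (bvec i) r)"
    if "i \<in> I" for i j
    using that linear_on_scale[OF bilinear_on_right[OF T.bil] T.unit_in, of "F (bvec i)"]
    by (simp add: T.unit_right linear_on_in[OF F])
  then have "conv m F (\<lambda>x r. \<epsilon> x * u r) x r =
      (\<Sum>i\<in>I. (\<Sum>j\<in>I. \<Delta> x (i, j) * \<epsilon> (bvec j)) * F (bvec i) r)"
    unfolding conv_def lift_double_sum sum_distrib_right by (simp add: mult_ac)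
  then show "conv m F (\<lambda>x r. \<epsilon> x * u r) x r = F x r"
    by (simp add: counit_right[OF x] linear_on_expand[OF F fin x])
qed

lemma conv_unit_left:
  assumes F: "linear_on I K F" and x: "x \<in> hspace A"
  shows "conv m (\<lambda>x r. \<epsilon> x * u r) F x = F x"
proof
  fix r
  have "m (\<lambda>r. \<epsilon> (bvec j) * u r) (F (bvec i)) = (\<lambda>r. \<epsilon> (bvec j) * F (bvec i) r)"
    if "i \<in> I" for i j
    using that linear_on_scale[OF bilinear_on_left[OF T.bil] T.unit_in, of "F (bvec i)"]
    by (simp add: T.unit_left linear_on_in[OF F])
  then have "conv m (\<lambda>x r. \<epsilon> x * u r) F x r =
      (\<Sum>i\<in>I. (\<Sum>j\<in>I. \<epsilon> (bvec j) * \<Delta> x (j, i)) * F (bvec i) r)"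
    unfolding conv_def lift_double_sum sum_distrib_right by (subst sum.swap) (simp add: mult_ac)
  then show "conv m (\<lambda>x r. \<epsilon> x * u r) F x r = F x r"
    by (simp add: counit_left[OF x] linear_on_expand[OF F fin x])
qed

end

lemma conv_antipode_right: "x \<in> hspace A \<Longrightarrow> conv (hmult A) (\<lambda>x. x) S x = (\<lambda>r. \<epsilon> x * \<eta> r)"
  by (simp add: conv_def lift_double_sum antipode_right)

lemma conv_antipode_left: "x \<in> hspace A \<Longrightarrow> conv (hmult A) S (\<lambda>x. x) x = (\<lambda>r. \<epsilon> x * \<eta> r)"
  by (simp add: conv_def lift_double_sum antipode_left)

end

section \<open>Bialgebra morphisms\<close>

text \<open>Extensionality is dropped so that plain compositions qualify, and the antipode condition
  because it is automatic by \<open>bialg_hom_antipode\<close>; \<open>hopf_hom_iff\<close> returns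
  to the official notion.\<close>

definition bialg_hom :: "('i, 'k::field) hopf \<Rightarrow> ('j, 'k) hopf \<Rightarrow> (('i \<Rightarrow> 'k) \<Rightarrow> 'j \<Rightarrow> 'k) \<Rightarrow> bool" where
  "bialg_hom A B f \<longleftrightarrow> linear_on (hbasis A) (hbasis B) f \<and>
     (\<forall>x\<in>hspace A. \<forall>y\<in>hspace A. f (hmult A x y) = hmult B (f x) (f y)) \<and>
     f (hunit A) = hunit B \<and>
     (\<forall>x\<in>hspace A. hcomult B (f x) = tensor_map (hbasis A) (hbasis A) f f (hcomult A x)) \<and>
     (\<forall>x\<in>hspace A. hcounit B (f x) = hcounit A x)"

lemma bialg_homD:
  assumes "bialg_hom A B f"
  shows bialg_hom_linear: "linear_on (hbasis A) (hbasis B) f"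
    and bialg_hom_in: "x \<in> hspace A \<Longrightarrow> f x \<in> hspace B"
    and bialg_hom_mult: "x \<in> hspace A \<Longrightarrow> y \<in> hspace A \<Longrightarrow> f (hmult A x y) = hmult B (f x) (f y)"
    and bialg_hom_unit: "f (hunit A) = hunit B"
    and bialg_hom_comult: "x \<in> hspace A \<Longrightarrow>
      hcomult B (f x) = tensor_map (hbasis A) (hbasis A) f f (hcomult A x)"
    and bialg_hom_counit: "x \<in> hspace A \<Longrightarrow> hcounit B (f x) = hcounit A x"
  using assms by (auto simp: bialg_hom_def linear_on_in)

lemma tensor_map_cong:
  assumes "\<And>x. x \<in> fspace I \<Longrightarrow> f x = f' x" "\<And>x. x \<in> fspace J \<Longrightarrow> g x = g' x"
  shows "tensor_map I J f g T = tensor_map I J f' g' T"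
  unfolding tensor_map_lift by (rule lift_cong) (simp add: assms)

lemma bialg_hom_cong:
  assumes A: "hopf_alg A" and f: "bialg_hom A B f" and e: "\<And>x. x \<in> hspace A \<Longrightarrow> f' x = f x"
  shows "bialg_hom A B f'"
proof -
  interpret hopf_alg A by fact
  have "tensor_map (hbasis A) (hbasis A) f' f' T = tensor_map (hbasis A) (hbasis A) f f T" for T
    by (rule tensor_map_cong) (simp_all add: e)
  then show ?thesis
    using f linear_on_cong[of "hbasis A" "hbasis B" f f'] alg.mult_in alg.unit_in
    by (auto simp: bialg_hom_def e)
qed

lemma bialg_hom_id: "hopf_alg A \<Longrightarrow> bialg_hom A A (\<lambda>x. x)"
proof -
  assume "hopf_alg A"
  then interpret hopf_alg A .
  show ?thesis
    by (auto simp: bialg_hom_def linear_on_id tensor_map_lift lift_tens_id[OF fin fin comult_in])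
qed

lemma tensor_map_compose:
  assumes fin: "finite I" "finite J" "finite I'" "finite J'"
    and f: "linear_on I I' f" and g: "linear_on J J' g"
    and f': "linear_on I' I'' f'" and g': "linear_on J' J'' g'"
  shows "tensor_map I' J' f' g' (tensor_map I J f g T) =
    tensor_map I J (\<lambda>x. f' (f x)) (\<lambda>x. g' (g x)) T"
  unfolding tensor_map_lift[of I' J']
  unfolding lift_tensor_map[OF bilinear_on_compose[OF bilinear_tens f' g'] fin f g]
  by (simp add: tensor_map_lift)

lemma bialg_hom_compose:
  assumes A: "hopf_alg A" and B: "hopf_alg B"
    and f: "bialg_hom A B f" and g: "bialg_hom B D g"
  shows "bialg_hom A D (\<lambda>x. g (f x))"
proof -
  interpret A: hopf_alg A by fact
  interpret B: hopf_alg B by fact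
  note F = bialg_homD[OF f] and G = bialg_homD[OF g]
  show ?thesis
    unfolding bialg_hom_def
    using linear_on_compose[OF F(1) G(1)] tensor_map_compose[OF A.fin A.fin B.fin B.fin F(1) F(1) G(1) G(1)]
    by (auto simp: F G)
qed

lemma bialg_hom_inverse:
  fixes A :: "('i, 'k::field) hopf" and B :: "('j, 'k) hopf"
  assumes A: "hopf_alg A" and B: "hopf_alg B" and f: "bialg_hom A B f"
    and g: "\<And>x. x \<in> hspace A \<Longrightarrow> g (f x) = x"
    and g': "\<And>y. y \<in> hspace B \<Longrightarrow> g y \<in> hspace A \<and> f (g y) = y"
  shows "bialg_hom B A g"
proof -
  interpret A: hopf_alg A by fact
  interpret B: hopf_alg B by fact
  note F = bialg_homD[OF f]
  have gl: "linear_on B.I A.I g"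
  proof (rule linear_onI)
    show "g y \<in> hspace A" if "y \<in> hspace B" for y using g'[OF that] by simp
    fix v w :: "'j \<Rightarrow> 'k" and a b assume vw: "v \<in> hspace B" "w \<in> hspace B"
    have "f (\<lambda>i. a * g v i + b * g w i) = (\<lambda>i. a * v i + b * w i)"
      using linear_on_comb[OF F(1), of "g v" "g w" a b] g' vw by simp
    then show "g (\<lambda>i. a * v i + b * w i) = (\<lambda>i. a * g v i + b * g w i)"
      using g[of "\<lambda>i. a * g v i + b * g w i"] fspace_comb[of "g v" A.I "g w"] g' vw by simp
  qed
  show ?thesis
    unfolding bialg_hom_def
  proof (intro conjI ballI gl)
    fix x y assume xy: "x \<in> hspace B" "y \<in> hspace B"
    have "f (hmult A (g x) (g y)) = hmult B x y"
      using xy g' F(3)[of "g x" "g y"] by simp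
    then show "g (hmult B x y) = hmult A (g x) (g y)"
      using g A.alg.mult_in g' xy by metis
  next
    show "g (hunit B) = hunit A" using g[OF A.alg.unit_in] F(4) by simp
  next
    fix x assume x: "x \<in> hspace B"
    have "tensor_map B.I B.I g g (hcomult B x) =
        tensor_map B.I B.I g g (tensor_map A.I A.I f f (hcomult A (g x)))"
      using F(5)[of "g x"] g'[OF x] by simp
    also have "\<dots> = tensor_map A.I A.I (\<lambda>x. x) (\<lambda>x. x) (hcomult A (g x))"
      unfolding tensor_map_compose[OF A.fin A.fin B.fin B.fin F(1) F(1) gl gl]
      by (rule tensor_map_cong) (simp_all add: g)
    also have "\<dots> = hcomult A (g x)"
      using g'[OF x] by (simp add: tensor_map_lift lift_tens_id[OF A.fin A.fin A.comult_in])
    finally show "hcomult A (g x) = tensor_map B.I B.I g g (hcomult B x)" by simp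
  next
    fix x assume x: "x \<in> hspace B"
    show "hcounit A (g x) = hcounit B x" using F(6)[of "g x"] g'[OF x] by simp
  qed
qed

text \<open>Comultiplicativity moves \<open>h\<close> from the argument of the convolution product
  to both legs. The dual \<open>conv_comp_hom\<close> uses multiplicativity of a morphism applied
  afterwards.\<close>

lemma conv_comp_right:
  assumes A: "hopf_alg A" and B: "hopf_alg B" and T: "fd_algebra K m u"
    and h: "bialg_hom A B h" and F: "linear_on (hbasis B) K F" and G: "linear_on (hbasis B) K G"
    and x: "x \<in> hspace A"
  shows "hopf_alg.conv B m F G (h x) = hopf_alg.conv A m (\<lambda>x. F (h x)) (\<lambda>x. G (h x)) x"
proof -
  interpret A: hopf_alg A by fact
  interpret B: hopf_alg B by fact
  note hl = bialg_hom_linear[OF h]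
  show ?thesis
    unfolding A.conv_def B.conv_def bialg_hom_comult[OF h x]
    by (rule lift_tensor_map[OF B.conv_bilinear[OF T F G] A.fin A.fin B.fin B.fin hl hl])
qed

lemma conv_comp_hom:
  assumes A: "hopf_alg A" and B: "hopf_alg B" and D: "hopf_alg D"
    and h: "bialg_hom B D h" and F: "linear_on (hbasis A) (hbasis B) F"
    and G: "linear_on (hbasis A) (hbasis B) G"
  shows "h (hopf_alg.conv A (hmult B) F G x) =
    hopf_alg.conv A (hmult D) (\<lambda>x. h (F x)) (\<lambda>x. h (G x)) x"
proof -
  interpret A: hopf_alg A by fact
  interpret B: hopf_alg B by fact
  show ?thesis
    by (rule A.conv_comp_left[OF bialg_hom_linear[OF h] _ F G])
      (simp add: B.alg.mult_in bialg_hom_mult[OF h])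
qed

text \<open>These are the antipode axioms pushed forward along \<open>h\<close>. They make
  \<open>h \<circ> S\<close> a two-sided convolution inverse of \<open>h\<close>, which later
  permits cancellation.\<close>

lemma conv_hom_antipode:
  assumes A: "hopf_alg A" and B: "hopf_alg B" and h: "bialg_hom A B h" and x: "x \<in> hspace A"
  shows "hopf_alg.conv A (hmult B) h (\<lambda>x. h (hantipode A x)) x = (\<lambda>r. hcounit A x * hunit B r)"
    and "hopf_alg.conv A (hmult B) (\<lambda>x. h (hantipode A x)) h x = (\<lambda>r. hcounit A x * hunit B r)"
proof -
  interpret A: hopf_alg A by fact
  interpret B: hopf_alg B by fact
  note hl = bialg_hom_linear[OF h]
  have e: "h (\<lambda>r. hcounit A x * hunit A r) = (\<lambda>r. hcounit A x * hunit B r)"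
    using linear_on_scale[OF hl A.alg.unit_in] bialg_hom_unit[OF h] by simp
  show "A.conv (hmult B) h (\<lambda>x. h (hantipode A x)) x = (\<lambda>r. hcounit A x * hunit B r)"
    using conv_comp_hom[OF A A B h linear_on_id A.antipode_linear, of x]
    by (simp add: A.conv_antipode_right[OF x] e)
  show "A.conv (hmult B) (\<lambda>x. h (hantipode A x)) h x = (\<lambda>r. hcounit A x * hunit B r)"
    using conv_comp_hom[OF A A B h A.antipode_linear linear_on_id, of x]
    by (simp add: A.conv_antipode_left[OF x] e)
qed

text \<open>Both \<open>S \<circ> h\<close> and \<open>h \<circ> S\<close> are convolution inverses of \<open>h\<close>.\<close>

lemma bialg_hom_antipode:
  assumes A: "hopf_alg A" and B: "hopf_alg B" and h: "bialg_hom A B h" and x: "x \<in> hspace A"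
  shows "h (hantipode A x) = hantipode B (h x)"
proof -
  interpret A: hopf_alg A by fact
  interpret B: hopf_alg B by fact
  let ?m = "hmult B" and ?e = "\<lambda>x r. hcounit A x * hunit B r"
  let ?P = "\<lambda>x. hantipode B (h x)" and ?Q = "\<lambda>x. h (hantipode A x)"
  note hl = bialg_hom_linear[OF h]
  note T = B.alg.fd_algebra_axioms
  have P: "linear_on A.I B.I ?P" by (rule linear_on_compose[OF hl B.antipode_linear])
  have Q: "linear_on A.I B.I ?Q" by (rule linear_on_compose[OF A.antipode_linear hl])
  have 1: "A.conv ?m ?P h y = ?e y" if y: "y \<in> hspace A" for y
    using conv_comp_right[OF A B T h B.antipode_linear linear_on_id y]
      B.conv_antipode_left[OF bialg_hom_in[OF h y]] bialg_hom_counit[OF h y] by simp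
  have "?P x = A.conv ?m ?P ?e x" by (rule A.conv_unit_right[OF T P x, symmetric])
  also have "\<dots> = A.conv ?m ?P (A.conv ?m h ?Q) x"
    by (rule A.conv_cong) (simp_all add: conv_hom_antipode(1)[OF A B h])
  also have "\<dots> = A.conv ?m (A.conv ?m ?P h) ?Q x"
    by (rule A.conv_assoc[OF T P hl Q x, symmetric])
  also have "\<dots> = A.conv ?m ?e ?Q x"
    by (rule A.conv_cong) (simp_all add: 1)
  also have "\<dots> = ?Q x" by (rule A.conv_unit_left[OF T Q x])
  finally show ?thesis by simp
qed

lemma hopf_hom_iff:
  assumes "hopf_alg A" "hopf_alg B"
  shows "f \<in> hopf_hom A B \<longleftrightarrow> f \<in> extensional (hspace A) \<and> bialg_hom A B f"
  using bialg_hom_antipode[OF assms] by (auto simp: hopf_hom_def bialg_hom_def)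

text \<open>The condition of \<open>Hom^c\<close> is the case \<open>G = id\<close>. Pairs are
  allowed because the two projections of a tensor product and the two entries in a column of a
  matrix have to be compared.\<close>

definition cocommuting ::
  "('i, 'k::field) hopf \<Rightarrow> (('i \<Rightarrow> 'k) \<Rightarrow> 'j \<Rightarrow> 'k) \<Rightarrow> (('i \<Rightarrow> 'k) \<Rightarrow> 'l \<Rightarrow> 'k) \<Rightarrow> bool" where
  "cocommuting A F G \<longleftrightarrow> (\<forall>x\<in>hspace A.
     lift (hbasis A) (hbasis A) (\<lambda>a b. tens (F a) (G b)) (hcomult A x) =
     lift (hbasis A) (hbasis A) (\<lambda>a b. tens (F b) (G a)) (hcomult A x))"

lemma cocommutingD:
  "cocommuting A F G \<Longrightarrow> x \<in> hspace A \<Longrightarrow>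
     lift (hbasis A) (hbasis A) (\<lambda>a b. tens (F a) (G b)) (hcomult A x) =
     lift (hbasis A) (hbasis A) (\<lambda>a b. tens (F b) (G a)) (hcomult A x)"
  by (simp add: cocommuting_def)

lemma cocommuting_cong:
  assumes "cocommuting A F G" "\<And>x. x \<in> hspace A \<Longrightarrow> F' x = F x" "\<And>x. x \<in> hspace A \<Longrightarrow> G' x = G x"
  shows "cocommuting A F' G'"
proof -
  have "lift (hbasis A) (hbasis A) (\<lambda>a b. tens (F' a) (G' b)) T =
      lift (hbasis A) (hbasis A) (\<lambda>a b. tens (F a) (G b)) T"
    "lift (hbasis A) (hbasis A) (\<lambda>a b. tens (F' b) (G' a)) T =
      lift (hbasis A) (hbasis A) (\<lambda>a b. tens (F b) (G a)) T" for T
    by (intro lift_cong; simp add: assms)+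
  then show ?thesis using assms(1) by (simp add: cocommuting_def)
qed

lemma cocommuting_sym:
  assumes "cocommuting A F G"
  shows "cocommuting A G F"
proof -
  let ?I = "hbasis A"
  have flip: "lift ?I ?I (\<lambda>a b. tens (\<phi> a b) (\<psi> a b)) T (i, j) =
      lift ?I ?I (\<lambda>a b. tens (\<psi> a b) (\<phi> a b)) T (j, i)" for \<phi> \<psi> T i j
    by (simp add: lift_def tens_def mult_ac)
  show ?thesis
    using assms unfolding cocommuting_def
    by (auto simp: fun_eq_iff flip[of "\<lambda>a b. G a"] flip[of "\<lambda>a b. G b"])
qed

lemma cocommuting_compose_left:
  assumes A: "hopf_alg A" and c: "cocommuting A F G" and fin: "finite J" "finite K"
    and F: "linear_on (hbasis A) J F" and G: "linear_on (hbasis A) K G"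
    and F': "linear_on J J' F'" and G': "linear_on K K' G'"
  shows "cocommuting A (\<lambda>x. F' (F x)) (\<lambda>x. G' (G x))"
  unfolding cocommuting_def
proof
  interpret A: hopf_alg A by fact
  fix x assume x: "x \<in> hspace A"
  note b = bilinear_on_compose[OF bilinear_tens F' G']
  let ?h = "lift J K (\<lambda>a b. tens (F' a) (G' b))"
  have h: "linear_on (J \<times> K) (J' \<times> K') ?h"
    by (rule lift_linear) (intro bilinear_on_in[OF b] bvec_in_fspace)
  note simps = lift_tens[OF b fin] linear_on_in[OF F] linear_on_in[OF G] tens_in
  have "lift A.I A.I (\<lambda>a b. tens (F' (F a)) (G' (G b))) (A.\<Delta> x) =
      ?h (lift A.I A.I (\<lambda>a b. tens (F a) (G b)) (A.\<Delta> x))"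
    by (subst linear_lift[OF h A.fin A.fin]) (simp_all add: simps cong: lift_cong)
  also have "\<dots> = ?h (lift A.I A.I (\<lambda>a b. tens (F b) (G a)) (A.\<Delta> x))"
    by (simp only: cocommutingD[OF c x])
  also have "\<dots> = lift A.I A.I (\<lambda>a b. tens (F' (F b)) (G' (G a))) (A.\<Delta> x)"
    by (subst linear_lift[OF h A.fin A.fin]) (simp_all add: simps cong: lift_cong)
  finally show "lift A.I A.I (\<lambda>a b. tens (F' (F a)) (G' (G b))) (A.\<Delta> x) =
    lift A.I A.I (\<lambda>a b. tens (F' (F b)) (G' (G a))) (A.\<Delta> x)" .
qed

lemma cocommuting_compose_right:
  assumes A: "hopf_alg A" and B: "hopf_alg B" and c: "cocommuting B F G"
    and F: "linear_on (hbasis B) J F" and G: "linear_on (hbasis B) K G" and h: "bialg_hom A B h"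
  shows "cocommuting A (\<lambda>x. F (h x)) (\<lambda>x. G (h x))"
  unfolding cocommuting_def
proof
  interpret A: hopf_alg A by fact
  interpret B: hopf_alg B by fact
  fix x assume x: "x \<in> hspace A"
  note b = bilinear_on_compose[OF bilinear_tens F G]
  note b' = bilinear_on_flip[OF bilinear_on_compose[OF bilinear_tens F G]]
  note hl = bialg_hom_linear[OF h]
  note l = lift_tensor_map[OF _ A.fin A.fin B.fin B.fin hl hl]
  show "lift A.I A.I (\<lambda>a b. tens (F (h a)) (G (h b))) (A.\<Delta> x) =
    lift A.I A.I (\<lambda>a b. tens (F (h b)) (G (h a))) (A.\<Delta> x)"
    using cocommutingD[OF c bialg_hom_in[OF h x]]
    by (simp add: bialg_hom_comult[OF h x] l[OF b] l[OF b'])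
qed

text \<open>As \<open>F x \<otimes> 1\<close> and \<open>1 \<otimes> G y\<close> commute, the order
  of the convolution factors only decides which leg of the comultiplication each map receives.
  Cocommutation thereby becomes commutation in \<open>Hom(A, B \<otimes> B)\<close>.\<close>

lemma bialg_hom_comult_conv:
  assumes A: "hopf_alg A" and B: "hopf_alg B" and F: "linear_on (hbasis A) (hbasis B) F"
    and G: "linear_on (hbasis A) (hbasis B) G"
  shows "hopf_alg.conv A (hmult (hopf_tensor B B)) (\<lambda>x. tens (F x) (hunit B))
      (\<lambda>x. tens (hunit B) (G x)) x = tensor_map (hbasis A) (hbasis A) F G (hcomult A x)"
    "hopf_alg.conv A (hmult (hopf_tensor B B)) (\<lambda>x. tens (hunit B) (G x))
      (\<lambda>x. tens (F x) (hunit B)) x =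
      lift (hbasis A) (hbasis A) (\<lambda>a b. tens (F b) (G a)) (hcomult A x)"
proof -
  interpret A: hopf_alg A by fact
  interpret B: hopf_alg B by fact
  note s = B.tensor_mult_tens B.alg.unit_in B.alg.unit_left B.alg.unit_right
    linear_on_in[OF F] linear_on_in[OF G]
  show "A.conv (hmult (hopf_tensor B B)) (\<lambda>x. tens (F x) (hunit B))
      (\<lambda>x. tens (hunit B) (G x)) x = tensor_map A.I A.I F G (A.\<Delta> x)"
    unfolding A.conv_def tensor_map_lift by (rule lift_cong) (simp add: s)
  show "A.conv (hmult (hopf_tensor B B)) (\<lambda>x. tens (hunit B) (G x))
      (\<lambda>x. tens (F x) (hunit B)) x = lift A.I A.I (\<lambda>a b. tens (F b) (G a)) (A.\<Delta> x)"
    unfolding A.conv_def by (rule lift_cong) (simp add: s)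
qed

text \<open>Multiplicativity uses that the images commute. For comultiplicativity, write \<open>\<Delta> \<circ> F\<close> as the
  convolution of \<open>F \<otimes> 1\<close> and \<open>1 \<otimes> F\<close> in \<open>Hom(A, B \<otimes> B)\<close>; the cocommutation of \<open>F\<close> and \<open>G\<close> says that
  \<open>1 \<otimes> F\<close> and \<open>G \<otimes> 1\<close> commute there.\<close>

lemma bialg_hom_conv:
  assumes A: "hopf_alg A" and B: "hopf_alg B" and F: "bialg_hom A B F" and G: "bialg_hom A B G"
    and comm: "\<And>x y. x \<in> hspace A \<Longrightarrow> y \<in> hspace A \<Longrightarrow> hmult B (F x) (G y) = hmult B (G y) (F x)"
    and cocomm: "cocommuting A F G"
  shows "bialg_hom A B (hopf_alg.conv A (hmult B) F G)"
proof -
  interpret A: hopf_alg A by fact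
  interpret B: hopf_alg B by fact
  let ?m = "hmult B"
  let ?f = "A.conv ?m F G"
  note Fl = bialg_hom_linear[OF F] and Gl = bialg_hom_linear[OF G]
  note T = B.alg.fd_algebra_axioms
  note inB = linear_on_in[OF Fl] linear_on_in[OF Gl] B.alg.mult_in
  note b = A.conv_bilinear[OF T Fl Gl]
  have fl: "linear_on A.I B.I ?f" by (rule A.conv_linear[OF T Fl Gl])
  have mult: "?f (hmult A x y) = ?m (?f x) (?f y)" if xy: "x \<in> hspace A" "y \<in> hspace A" for x y
  proof -
    let ?\<beta> = "\<lambda>a b. ?m (F a) (G b)"
    have 1: "linear_on (A.I \<times> A.I) B.I (lift A.I A.I ?\<beta>)"
      by (rule lift_linear) (intro bilinear_on_in[OF b] bvec_in_fspace)
    \<comment> \<open>Middle interchange; this is where the commuting images of \<open>F\<close> and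
      \<open>G\<close> enter.\<close>
    have sw: "?\<beta> (hmult A a c) (hmult A p d) = ?m (?\<beta> a p) (?\<beta> c d)"
      if h: "a \<in> hspace A" "c \<in> hspace A" "p \<in> hspace A" "d \<in> hspace A" for a p c d
    proof -
      have "?\<beta> (hmult A a c) (hmult A p d) = ?m (F a) (?m (?m (F c) (G p)) (G d))"
        using h by (simp add: bialg_hom_mult[OF F] bialg_hom_mult[OF G] B.alg.assoc inB)
      also have "\<dots> = ?m (F a) (?m (?m (G p) (F c)) (G d))" using h by (simp add: comm)
      also have "\<dots> = ?m (?\<beta> a p) (?\<beta> c d)" using h by (simp add: B.alg.assoc inB)
      finally show ?thesis .
    qed
    have "?f (hmult A x y) = lift A.I A.I ?\<beta> (lift A.I A.I (\<lambda>a b.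
        lift A.I A.I (\<lambda>c d. tens (hmult A a c) (hmult A b d)) (A.\<Delta> y)) (A.\<Delta> x))"
      by (simp add: A.conv_def A.comult_mult[OF xy] A.tensor_mult_lift)
    also have "\<dots> = lift A.I A.I (\<lambda>a b. lift A.I A.I ?\<beta>
        (lift A.I A.I (\<lambda>c d. tens (hmult A a c) (hmult A b d)) (A.\<Delta> y))) (A.\<Delta> x)"
      by (rule linear_lift[OF 1 A.fin A.fin]) (intro lift_in tens_in A.alg.mult_in bvec_in_fspace)
    also have "\<dots> = lift A.I A.I (\<lambda>a b.
        lift A.I A.I (\<lambda>c d. lift A.I A.I ?\<beta> (tens (hmult A a c) (hmult A b d))) (A.\<Delta> y)) (A.\<Delta> x)"
      by (rule lift_cong, rule linear_lift[OF 1 A.fin A.fin])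
        (intro tens_in A.alg.mult_in bvec_in_fspace)
    also have "\<dots> = lift A.I A.I (\<lambda>a b.
        lift A.I A.I (\<lambda>c d. ?m (?\<beta> a b) (?\<beta> c d)) (A.\<Delta> y)) (A.\<Delta> x)"
      by (rule lift_cong, rule lift_cong)
        (simp add: lift_tens[OF b A.fin A.fin] A.alg.mult_in sw)
    also have "\<dots> = lift A.I A.I (\<lambda>a b. ?m (?\<beta> a b) (?f y)) (A.\<Delta> x)"
      unfolding A.conv_def
      by (rule lift_cong, rule linear_lift[OF bilinear_on_right[OF B.alg.bil] A.fin A.fin, symmetric])
        (simp_all add: inB)
    also have "\<dots> = ?m (?f x) (?f y)"
      unfolding A.conv_def[of _ _ _ x]
      by (rule linear_lift[OF bilinear_on_left[OF B.alg.bil] A.fin A.fin, symmetric])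
        (simp_all add: inB linear_on_in[OF fl] xy)
    finally show ?thesis .
  qed
  have unit: "?f (hunit A) = hunit B"
    by (simp add: A.conv_def A.comult_unit lift_tens[OF b A.fin A.fin] A.alg.unit_in
        bialg_hom_unit[OF F] bialg_hom_unit[OF G] B.alg.unit_left B.alg.unit_in)
  have counit: "hcounit B (?f x) = hcounit A x" if x: "x \<in> hspace A" for x
  proof -
    have "(\<lambda>_::unit. hcounit B (?f x)) =
        lift A.I A.I (\<lambda>a b _. hcounit B (?m (F a) (G b))) (A.\<Delta> x)"
      unfolding A.conv_def
      by (rule linear_lift[OF B.counit_linear A.fin A.fin]) (simp add: inB)
    also have "\<dots> = lift A.I A.I (\<lambda>a b _. hcounit A a * hcounit A b) (A.\<Delta> x)"
      by (rule lift_cong)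
        (simp add: B.counit_mult inB bialg_hom_counit[OF F] bialg_hom_counit[OF G])
    also have "\<dots> = (\<lambda>_. \<Sum>i\<in>A.I. (\<Sum>j\<in>A.I. A.\<Delta> x (i, j) * hcounit A (bvec j)) * hcounit A (bvec i))"
      by (simp add: lift_double_sum sum_distrib_right) (simp add: mult_ac)
    also have "\<dots> = (\<lambda>_. hcounit A x)"
      by (simp add: A.counit_right[OF x] A.counit_expand[OF x])
    finally show ?thesis by (simp add: fun_eq_iff)
  qed
  have comult: "hcomult B (?f x) = tensor_map A.I A.I ?f ?f (A.\<Delta> x)" if x: "x \<in> hspace A" for x
  proof -
    let ?M = "hmult (hopf_tensor B B)" and ?u = "hunit B"
    note T2 = B.fd_algebra_tensor
    have l1: "linear_on B.I (B.I \<times> B.I) (\<lambda>a. tens a ?u)"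
      by (rule bilinear_on_left[OF bilinear_tens B.alg.unit_in])
    have l2: "linear_on B.I (B.I \<times> B.I) (tens ?u)"
      by (rule bilinear_on_right[OF bilinear_tens B.alg.unit_in])
    note F1 = linear_on_compose[OF Fl l1] and F2 = linear_on_compose[OF Fl l2]
    note G1 = linear_on_compose[OF Gl l1] and G2 = linear_on_compose[OF Gl l2]
    define F1 F2 G1 G2 where "F1 = (\<lambda>x. tens (F x) ?u)" and "F2 = (\<lambda>x. tens ?u (F x))"
      and "G1 = (\<lambda>x. tens (G x) ?u)" and "G2 = (\<lambda>x. tens ?u (G x))"
    have l: "linear_on A.I (B.I \<times> B.I) F1" "linear_on A.I (B.I \<times> B.I) F2"
      "linear_on A.I (B.I \<times> B.I) G1" "linear_on A.I (B.I \<times> B.I) G2"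
      using F1 F2 G1 G2 by (simp_all add: F1_def F2_def G1_def G2_def)
    note cl = A.conv_linear[OF T2] and ca = A.conv_assoc[OF T2]
    have dF: "hcomult B (F y) = A.conv ?M F1 F2 y" if "y \<in> hspace A" for y
      unfolding bialg_hom_comult[OF F that] F1_def F2_def
      by (rule bialg_hom_comult_conv(1)[OF A B Fl Fl, symmetric])
    have dG: "hcomult B (G y) = A.conv ?M G1 G2 y" if "y \<in> hspace A" for y
      unfolding bialg_hom_comult[OF G that] G1_def G2_def
      by (rule bialg_hom_comult_conv(1)[OF A B Gl Gl, symmetric])
    have swap: "A.conv ?M F2 G1 y = A.conv ?M G1 F2 y" if "y \<in> hspace A" for y
      using bialg_hom_comult_conv[OF A B Gl Fl, of y] cocommutingD[OF cocommuting_sym[OF cocomm] that]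
      by (simp add: F2_def G1_def tensor_map_lift)
    have f1: "tens (?f y) ?u = A.conv ?M F1 G1 y" for y
      unfolding F1_def G1_def
      by (rule A.conv_comp_left[OF l1 _ Fl Gl])
        (simp add: B.alg.mult_in B.tensor_mult_tens B.alg.unit_in B.alg.unit_left)
    have f2: "tens ?u (?f y) = A.conv ?M F2 G2 y" for y
      unfolding F2_def G2_def
      by (rule A.conv_comp_left[OF l2 _ Fl Gl])
        (simp add: B.alg.mult_in B.tensor_mult_tens B.alg.unit_in B.alg.unit_left)
    have "hcomult B (?f x) = A.conv ?M (\<lambda>x. hcomult B (F x)) (\<lambda>x. hcomult B (G x)) x"
      by (rule A.conv_comp_left[OF B.comult_linear _ Fl Gl]) (simp add: B.alg.mult_in B.comult_mult)
    also have "\<dots> = A.conv ?M (A.conv ?M F1 F2) (A.conv ?M G1 G2) x"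
      by (rule A.conv_cong) (simp_all add: dF dG)
    \<comment> \<open>Rebracketing exposes the inner pair \<open>F2\<close>, \<open>G1\<close>,
      which cocommutation lets change places.\<close>
    also have "\<dots> = A.conv ?M F1 (A.conv ?M F2 (A.conv ?M G1 G2)) x"
      by (rule ca[OF l(1,2) cl[OF l(3,4)] x])
    also have "\<dots> = A.conv ?M F1 (A.conv ?M (A.conv ?M F2 G1) G2) x"
      by (rule A.conv_cong) (simp_all add: ca[OF l(2,3,4)])
    also have "\<dots> = A.conv ?M F1 (A.conv ?M (A.conv ?M G1 F2) G2) x"
      by (rule A.conv_cong, simp, rule A.conv_cong) (simp_all add: swap)
    also have "\<dots> = A.conv ?M F1 (A.conv ?M G1 (A.conv ?M F2 G2)) x"
      by (rule A.conv_cong) (simp_all add: ca[OF l(3,2,4)])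
    also have "\<dots> = A.conv ?M (A.conv ?M F1 G1) (A.conv ?M F2 G2) x"
      by (rule ca[OF l(1,3) cl[OF l(2,4)] x, symmetric])
    also have "\<dots> = A.conv ?M (\<lambda>x. tens (?f x) ?u) (\<lambda>x. tens ?u (?f x)) x"
      by (simp add: f1 f2)
    also have "\<dots> = tensor_map A.I A.I ?f ?f (A.\<Delta> x)"
      by (rule bialg_hom_comult_conv(1)[OF A B fl fl])
    finally show ?thesis .
  qed
  show ?thesis
    unfolding bialg_hom_def using fl mult unit comult counit by blast
qed

section \<open>Subalgebras and the values of convolution products\<close>

definition subalg :: "('i, 'k::field) hopf \<Rightarrow> ('i \<Rightarrow> 'k) set \<Rightarrow> bool" where
  "subalg A M \<longleftrightarrow> hunit A \<in> M \<and>
     (\<forall>x\<in>M. \<forall>y\<in>M. hmult A x y \<in> M \<and> (\<forall>a b. (\<lambda>i. a * x i + b * y i) \<in> M))"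

lemma subalg_image:
  assumes "hopf_alg A" and f: "bialg_hom A B f"
  shows "subalg B (f ` hspace A)"
proof -
  interpret hopf_alg A by fact
  show ?thesis
    unfolding subalg_def
    using bialg_hom_mult[OF f, symmetric] bialg_hom_unit[OF f, symmetric] alg.unit_in alg.mult_in
      linear_on_comb[OF bialg_hom_linear[OF f], symmetric] fspace_comb
    by (auto intro!: imageI)
qed

lemma subalg_comb:
  "subalg A M \<Longrightarrow> x \<in> M \<Longrightarrow> y \<in> M \<Longrightarrow> (\<lambda>i. a * x i + b * y i) \<in> M"
  unfolding subalg_def by blast

lemma subalg_scale: "subalg A M \<Longrightarrow> x \<in> M \<Longrightarrow> (\<lambda>i. a * x i) \<in> M"
  using subalg_comb[of A M x x a 0] by simp

lemma subalg_sum: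
  assumes M: "subalg A M" and "finite S" and "\<And>s. s \<in> S \<Longrightarrow> v s \<in> M"
  shows "(\<lambda>i. \<Sum>s\<in>S. c s * v s i) \<in> M"
  using assms(2,3)
proof (induction S rule: finite_induct)
  case empty
  then show ?case using subalg_scale[OF M, of "hunit A" 0] M by (simp add: subalg_def)
next
  case (insert s S)
  have "(\<lambda>i. c s * v s i + 1 * (\<Sum>s\<in>S. c s * v s i)) \<in> M"
    by (rule subalg_comb[OF M]) (use insert in simp_all)
  then show ?case using insert by simp
qed

text \<open>A value of \<open>F * G\<close> is a linear combination of products of values of
  \<open>F\<close> and \<open>G\<close>. All surjectivity and commutation arguments below reduce to
  this pointwise membership.\<close>

lemma conv_in_subalg:
  assumes A: "hopf_alg A" and M: "subalg B M"
    and F: "\<And>x. x \<in> hspace A \<Longrightarrow> F x \<in> M" and G: "\<And>x. x \<in> hspace A \<Longrightarrow> G x \<in> M"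
  shows "hopf_alg.conv A (hmult B) F G x \<in> M"
proof -
  interpret hopf_alg A by fact
  have "hmult B (F (bvec i)) (G (bvec j)) \<in> M" if "i \<in> I" "j \<in> I" for i j
    using M F G that by (simp add: subalg_def)
  then show ?thesis
    unfolding conv_def lift_def by (intro subalg_sum[OF M]) (use fin in auto)
qed

section \<open>Central endomorphisms of purely non-abelian groups\<close>

text \<open>A finite set has finitely many self-maps, so two powers agree on all of \<open>W\<close>
  at once and a single exponent serves every point.\<close>

lemma finite_self_map_idem_power:
  assumes W: "finite W" and f: "f ` W \<subseteq> W"
  shows "\<exists>N\<ge>1. \<forall>x\<in>W. (f ^^ N) ((f ^^ N) x) = (f ^^ N) x"
proof -
  have p: "(f ^^ n) x \<in> W" if "x \<in> W" for n x
    using that f by (induction n) auto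
  let ?g = "\<lambda>n. restrict (f ^^ n) W"
  have "finite (range ?g)"
    by (rule finite_subset[OF _ finite_PiE[OF W, of "\<lambda>_. W"]]) (use W p in auto)
  then have "\<not> inj ?g" using finite_imageD infinite_UNIV_nat by blast
  then obtain i j where ij: "i < j" "?g i = ?g j"
    unfolding inj_def by (metis linorder_neqE_nat)
  define d where "d = j - i"
  have per: "(f ^^ (m + d)) x = (f ^^ m) x" if "m \<ge> i" "x \<in> W" for m x
  proof -
    have "(f ^^ j) x = (f ^^ i) x" using fun_cong[OF ij(2), of x] that by simp
    moreover have "m + d = (m - i) + j" "m = (m - i) + i" using that ij by (auto simp: d_def)
    ultimately show ?thesis by (metis funpow_add comp_apply)
  qed
  have per': "(f ^^ (m + k * d)) x = (f ^^ m) x" if "m \<ge> i" "x \<in> W" for m k x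
  proof (induction k)
    case (Suc k)
    have "(f ^^ (m + Suc k * d)) x = (f ^^ ((m + k * d) + d)) x" by (simp add: add_ac)
    also have "\<dots> = (f ^^ m) x" using per[of "m + k * d" x] that Suc by simp
    finally show ?case .
  qed simp
  \<comment> \<open>A multiple of the period \<open>d\<close> inside the periodic range:
    \<open>Suc i * d \<ge> i\<close> since \<open>d \<ge> 1\<close>, and \<open>Suc\<close> keeps
    \<open>N\<close> positive when \<open>i = 0\<close>.\<close>
  define N where "N = Suc i * d"
  have "d \<ge> 1" using ij by (simp add: d_def)
  then have "Suc i * 1 \<le> N" unfolding N_def by (rule mult_le_mono2)
  then have N: "N \<ge> i" "N \<ge> 1" by simp_all
  have "(f ^^ N) ((f ^^ N) x) = (f ^^ N) x" if "x \<in> W" for x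
    using per'[OF N(1) that, of "Suc i"] by (simp add: N_def funpow_add)
  then show ?thesis using N by blast
qed

lemma (in group) hom_funpow: "v \<in> hom G G \<Longrightarrow> v ^^ n \<in> hom G G"
proof (induction n)
  case 0 then show ?case by (simp add: hom_def)
next
  case (Suc n) then show ?case by (auto simp: hom_def Pi_iff)
qed

text \<open>Fitting's lemma: the stable image of \<open>v\<close> is a direct factor, and it is abelian.\<close>

lemma (in group) central_endo_nilpotent:
  assumes fin: "finite (carrier G)" and pna: "purely_nonabelian G" and v: "v \<in> hom G G"
    and central: "\<And>g h. g \<in> carrier G \<Longrightarrow> h \<in> carrier G \<Longrightarrow> v g \<otimes> h = h \<otimes> v g"
  shows "\<exists>n. \<forall>g\<in>carrier G. (v ^^ n) g = \<one>"
proof -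
  obtain N where N: "N \<ge> 1" "\<forall>x\<in>carrier G. (v ^^ N) ((v ^^ N) x) = (v ^^ N) x"
    using finite_self_map_idem_power[OF fin, of v] v by (auto simp: hom_def)
  define e where "e = v ^^ N"
  have e: "e \<in> hom G G" unfolding e_def by (rule hom_funpow[OF v])
  interpret e: group_hom G G e by unfold_locales (rule e)
  \<comment> \<open>\<open>N \<ge> 1\<close> leaves an outermost \<open>v\<close>, so every value of
    \<open>e\<close> is a value of \<open>v\<close>.\<close>
  have ec: "e g \<otimes> h = h \<otimes> e g" if "g \<in> carrier G" "h \<in> carrier G" for g h
  proof -
    obtain M where "N = Suc M" using N(1) by (cases N) auto
    then have "e g = v ((v ^^ M) g)" by (simp add: e_def)
    moreover have "(v ^^ M) g \<in> carrier G" using hom_funpow[OF v, of M] that by (auto simp: hom_def)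
    ultimately show ?thesis using central that by simp
  qed
  define K where "K = e ` carrier G"
  define L where "L = kernel G G e"
  have K: "subgroup K G" unfolding K_def by (rule e.img_is_subgroup)
  have Kn: "K \<lhd> G"
  proof (rule normal_invI[OF K])
    fix x h assume x: "x \<in> carrier G" and "h \<in> K"
    then obtain g where g: "g \<in> carrier G" "h = e g" by (auto simp: K_def)
    then have "x \<otimes> h \<otimes> inv x = h" using x ec[OF g(1) x, symmetric] by (simp add: m_assoc)
    then show "x \<otimes> h \<otimes> inv x \<in> K" using \<open>h \<in> K\<close> by simp
  qed
  have Ln: "L \<lhd> G" unfolding L_def by (rule e.normal_kernel)
  have idem: "e (e x) = e x" if "x \<in> carrier G" for x using N(2) that by (simp add: e_def)
  have "K \<inter> L = {\<one>}"
    using idem e.one_closed e.hom_one by (force simp: K_def L_def kernel_def)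
  moreover have "K <#> L = carrier G"
  proof
    show "K <#> L \<subseteq> carrier G" by (auto simp: set_mult_def K_def L_def kernel_def)
    show "carrier G \<subseteq> K <#> L"
    proof
      fix g assume g: "g \<in> carrier G"
      then have "inv (e g) \<otimes> g \<in> L" by (simp add: L_def kernel_def idem)
      moreover have "g = e g \<otimes> (inv (e g) \<otimes> g)" using g by simp
      ultimately show "g \<in> K <#> L" using g by (force simp: set_mult_def K_def)
    qed
  qed
  ultimately have "direct_factor K G"
    unfolding direct_factor_def using Kn Ln by (intro conjI exI[of _ L]) simp_all
  moreover have "comm_group (G\<lparr>carrier := K\<rparr>)"
  proof (rule group.group_comm_groupI[OF subgroup_imp_group[OF K]])
    fix x y assume "x \<in> carrier (G\<lparr>carrier := K\<rparr>)" "y \<in> carrier (G\<lparr>carrier := K\<rparr>)"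
    then obtain g where "g \<in> carrier G" "x = e g" "y \<in> carrier G" by (auto simp: K_def)
    then show "x \<otimes>\<^bsub>G\<lparr>carrier := K\<rparr>\<^esub> y = y \<otimes>\<^bsub>G\<lparr>carrier := K\<rparr>\<^esub> x" using ec by simp
  qed
  ultimately have "K = {\<one>}" using pna by (auto simp: purely_nonabelian_def)
  then show ?thesis by (intro exI[of _ N]) (auto simp: K_def e_def)
qed

section \<open>Central endomorphisms of the double\<close>

locale finite_double = group G for G :: "('a, 'm) monoid_scheme" (structure) +
  fixes A :: "('a \<times> 'a, 'k::field) hopf"
  assumes finG: "finite (carrier G)" and A_eq: "A = double G"
begin

sublocale D: hopf_alg A
  by unfold_locales (simp add: A_eq hopf_algebra_double[OF finG])

lemmas sel = double_sel[where ?'k = 'k, folded A_eq]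

lemma smash: 
  assumes "g \<in> carrier G" "h \<in> carrier G" "a \<in> fspace (carrier G)"
  shows "hmult A (tens a (bvec g)) (tens b (bvec h)) =
    tens (\<lambda>x. a x * conj_act G g b x) (bvec (g \<otimes> h))"
  unfolding A_eq by (rule double_mult_smash[OF finG assms])

text \<open>The unit of the algebra \<open>k^G\<close>, which is also the trivial character of the
  group.\<close>

definition ind :: "'a \<Rightarrow> 'k" where
  "ind = (\<lambda>x. if x \<in> carrier G then 1 else 0)"

text \<open>\<open>gl g\<close> and \<open>fn x\<close> are the elements \<open>1 # g\<close> and \<open>e\<^sub>x # 1\<close>; \<open>pr y\<close> evaluates the \<open>k\<^sup>G\<close>-part at
  \<open>y\<close> and sums over the group part.\<close>

definition gl :: "'a \<Rightarrow> 'a \<times> 'a \<Rightarrow> 'k" where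
  "gl g = tens ind (bvec g)"

definition fn :: "'a \<Rightarrow> 'a \<times> 'a \<Rightarrow> 'k" where
  "fn x = tens (bvec x) (bvec \<one>)"

definition pr :: "'a \<Rightarrow> ('a \<times> 'a \<Rightarrow> 'k) \<Rightarrow> 'k" where
  "pr y t = (\<Sum>h\<in>carrier G. t (y, h))"

lemma smash_in: "a \<in> fspace (carrier G) \<Longrightarrow> g \<in> carrier G \<Longrightarrow> tens a (bvec g) \<in> hspace A"
  by (simp add: sel(1) tens_in)

lemma ind_in: "ind \<in> fspace (carrier G)"
  by (simp add: ind_def fspace_def)

lemma gl_in: "g \<in> carrier G \<Longrightarrow> gl g \<in> hspace A"
  by (simp add: gl_def smash_in ind_in)

lemma fn_in: "x \<in> carrier G \<Longrightarrow> fn x \<in> hspace A"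
  by (simp add: fn_def smash_in)

lemma gl_one: "gl \<one> = hunit A"
proof (rule ext, clarify)
  fix x h show "gl \<one> (x, h) = hunit A (x, h)"
    by (auto simp: gl_def tens_def ind_def bvec_def sel)
qed

lemma conj_ind: "g \<in> carrier G \<Longrightarrow> x \<in> carrier G \<Longrightarrow> conj_act G g ind x = 1"
  by (simp add: conj_act_def ind_def)

lemma smash_gl:
  assumes "a \<in> fspace (carrier G)" "g \<in> carrier G" "h \<in> carrier G"
  shows "hmult A (tens a (bvec g)) (gl h) = tens a (bvec (g \<otimes> h))"
proof -
  have "(\<lambda>x. a x * conj_act G g ind x) = a"
  proof
    fix x show "a x * conj_act G g ind x = a x"
      using assms(1) conj_ind[OF assms(2)] by (cases "x \<in> carrier G") (simp_all add: fspace_def)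
  qed
  then show ?thesis using assms by (simp add: gl_def smash)
qed

lemma gl_mult: "g \<in> carrier G \<Longrightarrow> h \<in> carrier G \<Longrightarrow> hmult A (gl g) (gl h) = gl (g \<otimes> h)"
  using smash_gl[OF ind_in] by (simp add: gl_def)

lemma bvec_split: "x \<in> carrier G \<Longrightarrow> g \<in> carrier G \<Longrightarrow> bvec (x, g) = hmult A (fn x) (gl g)"
  by (simp add: fn_def smash_gl bvec_pair)

lemma fn_mult:
  assumes "x \<in> carrier G" "y \<in> carrier G"
  shows "hmult A (fn x) (fn y) = (if x = y then fn x else (\<lambda>_. 0))"
  using assms by (auto simp: fn_def smash) (auto simp: tens_def fun_eq_iff conj_act_def bvec_def)

text \<open>Group elements permute the idempotents \<open>fn x\<close> by conjugation. In
  \<open>central_hom_fn\<close> this forces the values of \<open>w\<close> into the centre.\<close>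

lemma gl_fn:
  assumes g: "g \<in> carrier G" and x: "x \<in> carrier G"
  shows "hmult A (gl g) (fn x) = hmult A (fn (g \<otimes> x \<otimes> inv g)) (gl g)"
proof -
  have e: "inv g \<otimes> z \<otimes> g = x \<longleftrightarrow> z = g \<otimes> x \<otimes> inv g" if "z \<in> carrier G" for z
    using that g x by (auto simp: m_assoc)
  have "(\<lambda>z. ind z * conj_act G g (bvec x) z) = bvec (g \<otimes> x \<otimes> inv g)"
    using g x by (auto simp: fun_eq_iff ind_def conj_act_def bvec_def e)
  then show ?thesis
    using g x smash_gl[of "bvec (g \<otimes> x \<otimes> inv g)" \<one> g]
    by (simp add: gl_def fn_def smash[of g \<one> ind] ind_in)
qed

lemma pr_linear: "linear_on D.I (UNIV :: unit set) (\<lambda>t _. pr y t)"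
  by (rule linear_onI) (auto simp: fspace_def pr_def sum_distrib_left sum.distrib)

lemma pr_one: "y = \<one> \<Longrightarrow> pr y t = hcounit A t"
  by (simp add: pr_def sel)

lemma pr_smash: "g \<in> carrier G \<Longrightarrow> pr y (tens a (bvec g)) = a y"
  using finG by (simp add: pr_def tens_def bvec_def if_distrib[of "\<lambda>z. _ * z"] cong: if_cong)

text \<open>Compare the coefficient at \<open>(x, g)\<close> in the two products of \<open>t\<close>
  with the idempotent \<open>fn x\<close>: one is \<open>t (x, g)\<close>, the other survives only
  if \<open>g\<close> fixes \<open>x\<close> under conjugation.\<close>

lemma central_support:
  assumes t: "t \<in> hspace A" and c: "\<And>s. s \<in> hspace A \<Longrightarrow> hmult A t s = hmult A s t"
    and nz: "t (x, g) \<noteq> 0"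
  shows "x \<in> carrier G" "g \<in> carrier G" "inv g \<otimes> x \<otimes> g = x"
proof -
  show x: "x \<in> carrier G" and g: "g \<in> carrier G"
    using t nz by (auto simp: fspace_def sel(1))
  have e: "inv h \<otimes> g = \<one> \<longleftrightarrow> h = g" if "h \<in> carrier G" for h
    using that g by (metis inv_equality inv_inv inv_closed l_inv)
  have "hmult A t (fn x) (x, g) = (\<Sum>h\<in>carrier G. if h = g then t (x, g) * bvec x (inv g \<otimes> x \<otimes> g) else 0)"
    unfolding sel using x g e by (auto simp: fn_def tens_def bvec_def intro!: sum.cong)
  moreover have "hmult A (fn x) t (x, g) = (\<Sum>h\<in>carrier G. if h = \<one> then t (x, g) else 0)"
    unfolding sel using x g by (auto simp: fn_def tens_def bvec_def intro!: sum.cong)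
  ultimately show "inv g \<otimes> x \<otimes> g = x"
    using c[OF fn_in[OF x]] finG g nz by (auto simp: bvec_def split: if_splits)
qed

text \<open>In general \<open>pr y\<close> need not be multiplicative, because the product
  conjugates \<open>y\<close> by the group part of the left factor. On the support of a central
  \<open>t\<close> this twist is trivial.\<close>

lemma pr_mult:
  assumes t: "t \<in> hspace A" and c: "\<And>s. s \<in> hspace A \<Longrightarrow> hmult A t s = hmult A s t"
    and y: "y \<in> carrier G"
  shows "pr y (hmult A t s) = pr y t * pr y s"
proof -
  have "pr y (hmult A t s) =
      (\<Sum>g\<in>carrier G. \<Sum>k\<in>carrier G. t (y, g) * s (inv g \<otimes> y \<otimes> g, inv g \<otimes> k))"
    unfolding pr_def by (subst sum.swap) (simp add: sel y)
  also have "\<dots> = (\<Sum>g\<in>carrier G. \<Sum>k\<in>carrier G. t (y, g) * s (y, inv g \<otimes> k))"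
    by (intro sum.cong refl) (metis central_support(3)[OF t c] mult_zero_left)
  also have "\<dots> = (\<Sum>g\<in>carrier G. \<Sum>k\<in>carrier G. t (y, g) * s (y, k))"
    by (rule sum.cong[OF refl], subst sum_translate) auto
  finally show ?thesis by (simp add: pr_def sum_product)
qed

section \<open>Group-like elements and their characters\<close>

definition grouplike :: "('a \<times> 'a \<Rightarrow> 'k) \<Rightarrow> bool" where
  "grouplike t \<longleftrightarrow> t \<in> hspace A \<and> hcomult A t = tens t t \<and> hcounit A t = 1"

lemma grouplike_gl: "g \<in> carrier G \<Longrightarrow> grouplike (gl g)"
proof -
  assume g: "g \<in> carrier G"
  have "hcomult A (gl g) = tens (gl g) (gl g)"
  proof (rule ext, clarify)
    fix x k y l
    show "hcomult A (gl g) ((x, k), (y, l)) = tens (gl g) (gl g) ((x, k), (y, l))"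
      by (auto simp: sel gl_def tens_def ind_def bvec_def g)
  qed
  moreover have "hcounit A (gl g) = 1"
    using pr_smash[OF g, of \<one> ind] by (simp add: pr_one gl_def ind_def)
  ultimately show ?thesis using g by (simp add: grouplike_def gl_in)
qed

text \<open>The comultiplication is supported where both group parts agree, so coefficients of
  \<open>t\<close> over different group elements multiply to 0. The counit provides a nonzero
  coefficient over some \<open>h\<close>, and everything must then sit over
  \<open>h\<close>.\<close>

lemma grouplike_form:
  assumes "grouplike t"
  shows "\<exists>h\<in>carrier G. \<exists>\<chi>\<in>fspace (carrier G). t = tens \<chi> (bvec h) \<and> \<chi> \<one> = 1 \<and>
    (\<forall>x\<in>carrier G. \<forall>y\<in>carrier G. \<chi> (y \<otimes> x) = \<chi> x * \<chi> y)"
proof -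
  from assms have t: "t \<in> hspace A" and d: "hcomult A t = tens t t" and c: "hcounit A t = 1"
    by (auto simp: grouplike_def)
  have m: "t (x, g) * t (y, h) = (if g = h then t (y \<otimes> x, g) else 0)"
    if "x \<in> carrier G" "y \<in> carrier G" "g \<in> carrier G" "h \<in> carrier G" for x y g h
    using fun_cong[OF d, of "((x, g), (y, h))"] that by (simp add: sel tens_def)
  obtain h where h: "h \<in> carrier G" "t (\<one>, h) \<noteq> 0"
    using c unfolding sel by (metis sum.neutral zero_neq_one)
  have z: "t (x, g) = 0" if "g \<noteq> h" for x g
  proof (cases "x \<in> carrier G \<and> g \<in> carrier G")
    case True
    then show ?thesis using m[of x \<one> g h] h that by simp
  next
    case False
    then show ?thesis using t by (auto simp: fspace_def sel(1))
  qed
  define \<chi> where "\<chi> = (\<lambda>x. t (x, h))"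
  have "\<chi> \<in> fspace (carrier G)" using t by (auto simp: \<chi>_def fspace_def sel(1))
  moreover have "t = tens \<chi> (bvec h)"
    by (auto simp: fun_eq_iff tens_def bvec_def \<chi>_def z)
  moreover have "\<chi> \<one> = 1" using m[of \<one> \<one> h h] h by (simp add: \<chi>_def)
  moreover have "\<chi> (y \<otimes> x) = \<chi> x * \<chi> y" if "x \<in> carrier G" "y \<in> carrier G" for x y
    using m[of x y h h] h that by (simp add: \<chi>_def)
  ultimately show ?thesis using h by blast
qed

text \<open>The field may be infinite, but characters take values among the roots of
  \<open>X^n - 1\<close> with \<open>n\<close> the group order, and a nonzero polynomial has
  finitely many roots.\<close>

lemma finite_grouplike: "finite {t. grouplike t}"
proof -
  define n where "n = Coset.order G"
  have n: "n > 0" using finG by (simp add: n_def order_gt_0_iff_finite)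
  define R where "R = {z::'k. z ^ n = 1}"
  have "R = {z. poly (monom 1 n - 1) z = 0}" by (simp add: R_def poly_monom)
  moreover have "monom 1 n - 1 \<noteq> (0 :: 'k poly)"
  proof
    assume "monom 1 n - 1 = (0 :: 'k poly)"
    then have "monom 1 n = (monom 1 0 :: 'k poly)" by (simp add: one_poly_eq_simps monom_0)
    then show False using n by (metis degree_monom_eq one_neq_zero less_irrefl)
  qed
  ultimately have R: "finite R" using poly_roots_finite by metis
  let ?W = "{\<chi>. \<forall>x. (x \<in> carrier G \<longrightarrow> \<chi> x \<in> R) \<and> (x \<notin> carrier G \<longrightarrow> \<chi> x = (0::'k))}"
  have "finite ?W" by (rule finite_set_of_finite_funs[OF finG R])
  then have "finite ((\<lambda>(\<chi>, h). tens \<chi> (bvec h :: 'a \<Rightarrow> 'k)) ` (?W \<times> carrier G))" using finG by simp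
  moreover have "{t. grouplike t} \<subseteq> (\<lambda>(\<chi>, h). tens \<chi> (bvec h)) ` (?W \<times> carrier G)"
  proof clarify
    fix t assume "grouplike t"
    then obtain h \<chi> where h: "h \<in> carrier G" "\<chi> \<in> fspace (carrier G)" "t = tens \<chi> (bvec h)"
      "\<chi> \<one> = 1" "\<forall>x\<in>carrier G. \<forall>y\<in>carrier G. \<chi> (y \<otimes> x) = \<chi> x * \<chi> y"
      using grouplike_form by blast
    have "\<chi> (x [^] k) = \<chi> x ^ k" if "x \<in> carrier G" for x and k :: nat
      using that h(4,5) by (induction k) (simp_all add: nat_pow_Suc)
    then have "\<chi> x ^ n = 1" if "x \<in> carrier G" for x
      using that h(4) pow_order_eq_1[OF that] unfolding n_def by metis
    then have "\<chi> \<in> ?W" using h(2) by (auto simp: R_def fspace_def)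
    then show "t \<in> (\<lambda>(\<chi>, h). tens \<chi> (bvec h)) ` (?W \<times> carrier G)" using h by auto
  qed
  ultimately show ?thesis by (rule finite_subset[rotated])
qed

lemma bialg_hom_grouplike:
  assumes e: "bialg_hom A A e" and t: "grouplike t"
  shows "grouplike (e t)"
proof -
  have th: "t \<in> hspace A" using t by (simp add: grouplike_def)
  note l = bialg_hom_linear[OF e]
  have "hcomult A (e t) = tens (e t) (e t)"
    using t bialg_hom_comult[OF e th]
      lift_tens[OF bilinear_on_compose[OF bilinear_tens l l] D.fin D.fin th th]
    by (simp add: grouplike_def tensor_map_lift)
  then show ?thesis
    using t bialg_hom_in[OF e th] bialg_hom_counit[OF e th] by (simp add: grouplike_def)
qed

section \<open>Group part and function part of a central endomorphism\<close>

definition central_hom :: "(('a \<times> 'a \<Rightarrow> 'k) \<Rightarrow> 'a \<times> 'a \<Rightarrow> 'k) \<Rightarrow> bool" where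
  "central_hom e \<longleftrightarrow> bialg_hom A A e \<and>
     (\<forall>x\<in>hspace A. \<forall>y\<in>hspace A. hmult A (e x) y = hmult A y (e x))"

lemma bialg_hom_funpow: "bialg_hom A A e \<Longrightarrow> bialg_hom A A (e ^^ n)"
proof (induction n)
  case 0
  then show ?case using bialg_hom_id[OF D.hopf_alg_axioms] by (simp add: id_def)
next
  case (Suc n)
  then show ?case
    using bialg_hom_compose[OF D.hopf_alg_axioms D.hopf_alg_axioms Suc.IH[OF Suc.prems] Suc.prems]
    by (simp add: comp_def)
qed

text \<open>\<open>Suc n\<close> excludes the zeroth power, the identity, whose image is central
  only in the commutative case.\<close>

lemma central_hom_funpow: 
  assumes "central_hom e" shows "central_hom (e ^^ Suc n)"
proof -
  have b: "bialg_hom A A e" using assms by (simp add: central_hom_def)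
  have "(e ^^ n) x \<in> hspace A" if "x \<in> hspace A" for x
    using bialg_hom_in[OF bialg_hom_funpow[OF b] that] .
  then show ?thesis
    using assms bialg_hom_funpow[OF b, of "Suc n"] by (simp add: central_hom_def)
qed

text \<open>Morphisms preserve group-like elements, whose form is known from
  \<open>grouplike_form\<close>; centrality and multiplicativity of \<open>v\<close> are then read
  off from coefficients.\<close>

lemma central_hom_gl:
  assumes e: "central_hom e"
  obtains v r where "v \<in> hom G G"
    "\<And>g h. g \<in> carrier G \<Longrightarrow> h \<in> carrier G \<Longrightarrow> v g \<otimes> h = h \<otimes> v g"
    "\<And>g. g \<in> carrier G \<Longrightarrow> e (gl g) = tens (r g) (bvec (v g))"
    "\<And>g. g \<in> carrier G \<Longrightarrow> r g \<in> fspace (carrier G)"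
    "\<And>g x y. g \<in> carrier G \<Longrightarrow> x \<in> carrier G \<Longrightarrow> y \<in> carrier G \<Longrightarrow> r g (y \<otimes> x) = r g x * r g y"
    "\<And>g. g \<in> carrier G \<Longrightarrow> r g \<one> = 1"
proof -
  have b: "bialg_hom A A e" using e by (simp add: central_hom_def)
  define P where "P = (\<lambda>g h \<chi>. h \<in> carrier G \<and> \<chi> \<in> fspace (carrier G) \<and> e (gl g) = tens \<chi> (bvec h) \<and>
      \<chi> \<one> = 1 \<and> (\<forall>x\<in>carrier G. \<forall>y\<in>carrier G. \<chi> (y \<otimes> x) = \<chi> x * \<chi> y))"
  have "\<forall>g\<in>carrier G. \<exists>p. P g (fst p) (snd p)"
  proof
    fix g assume g: "g \<in> carrier G"
    obtain h \<chi> where "P g h \<chi>"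
      using grouplike_form[OF bialg_hom_grouplike[OF b grouplike_gl[OF g]]] unfolding P_def by blast
    then show "\<exists>p. P g (fst p) (snd p)" by (intro exI[of _ "(h, \<chi>)"]) simp
  qed
  then obtain q where q: "\<forall>g\<in>carrier G. P g (fst (q g)) (snd (q g))" by (rule bchoice[THEN exE])
  define v r where "v = (\<lambda>g. fst (q g))" and "r = (\<lambda>g. snd (q g))"
  have vr: "v g \<in> carrier G" "r g \<in> fspace (carrier G)" "e (gl g) = tens (r g) (bvec (v g))"
    "r g \<one> = 1" "\<And>x y. x \<in> carrier G \<Longrightarrow> y \<in> carrier G \<Longrightarrow> r g (y \<otimes> x) = r g x * r g y"
    if "g \<in> carrier G" for g
    using q that by (auto simp: v_def r_def P_def)
  have c: "v g \<otimes> h = h \<otimes> v g" if g: "g \<in> carrier G" and h: "h \<in> carrier G" for g h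
  proof -
    have h': "inv (v g) \<otimes> h \<otimes> v g = h"
    proof (rule central_support(3)[of "e (gl g)"])
      show "e (gl g) \<in> hspace A" by (rule bialg_hom_in[OF b gl_in[OF g]])
      show "hmult A (e (gl g)) s = hmult A s (e (gl g))" if "s \<in> hspace A" for s
        using e that gl_in[OF g] by (simp add: central_hom_def)
      \<comment> \<open>A character vanishes nowhere, so every \<open>(h, v g)\<close> lies in the
        support of the central element \<open>e (gl g)\<close>.\<close>
      have "r g (h \<otimes> inv h) = r g (inv h) * r g h" by (rule vr(5)[OF g]) (simp_all add: h)
      then have "r g h \<noteq> 0" using h vr(4)[OF g] by auto
      then show "e (gl g) (h, v g) \<noteq> 0" using vr(3)[OF g] by (simp add: tens_def bvec_def)
    qed
    have "v g \<otimes> (inv (v g) \<otimes> h \<otimes> v g) = h \<otimes> v g" using vr(1)[OF g] h by (simp add: m_assoc)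
    then show ?thesis using h' by simp
  qed
  have "v (g \<otimes> h) = v g \<otimes> v h" if g: "g \<in> carrier G" and h: "h \<in> carrier G" for g h
  proof -
    have "tens (r (g \<otimes> h)) (bvec (v (g \<otimes> h))) = hmult A (e (gl g)) (e (gl h))"
      using bialg_hom_mult[OF b gl_in[OF g] gl_in[OF h]] g h by (simp add: gl_mult vr(3))
    also have "\<dots> = tens (\<lambda>x. r g x * conj_act G (v g) (r h) x) (bvec (v g \<otimes> v h))"
      using g h by (simp add: vr smash)
    \<comment> \<open>At function part \<open>\<one>\<close> all characters equal 1, so only the
      group parts remain to be compared.\<close>
    finally have "tens (r (g \<otimes> h)) (bvec (v (g \<otimes> h))) (\<one>, v (g \<otimes> h)) =
       tens (\<lambda>x. r g x * conj_act G (v g) (r h) x) (bvec (v g \<otimes> v h)) (\<one>, v (g \<otimes> h))" by simp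
    then show ?thesis using vr(4)[of "g \<otimes> h"] g h by (auto simp: tens_def bvec_def split: if_splits)
  qed
  then have "v \<in> hom G G" using vr(1) by (auto simp: hom_def)
  from that[OF this c vr(3,2,5,4)] show thesis .
qed

text \<open>Summing out the group parts leaves the comultiplication of the function part; the order
  \<open>y \<otimes> x\<close> is that of the co-opposite. This makes the evaluation points in
  \<open>central_hom_fn\<close> multiply.\<close>

lemma pr_tensor:
  assumes x: "x \<in> carrier G" and y: "y \<in> carrier G"
  shows "(\<Sum>g\<in>carrier G. \<Sum>h\<in>carrier G. hcomult A t ((x, g), (y, h))) = pr (y \<otimes> x) t"
proof -
  have "(\<Sum>h\<in>carrier G. hcomult A t ((x, g), (y, h))) = t (y \<otimes> x, g)" if "g \<in> carrier G" for g
    using that x y finG by (simp add: sel)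
  then show ?thesis by (simp add: pr_def)
qed

text \<open>An algebra morphism from \<open>k\<^sup>G\<close> to \<open>k\<close> is the evaluation at a point, because the images of the
  \<open>e\<^sub>x\<close> are orthogonal idempotents of a field adding up to 1.\<close>

lemma central_hom_fn:
  assumes e: "central_hom e"
  obtains w where "w \<in> hom G G"
    "\<And>y h. y \<in> carrier G \<Longrightarrow> h \<in> carrier G \<Longrightarrow> w y \<otimes> h = h \<otimes> w y"
    "\<And>y x. y \<in> carrier G \<Longrightarrow> x \<in> carrier G \<Longrightarrow> pr y (e (fn x)) = (if x = w y then 1 else 0)"
proof -
  have b: "bialg_hom A A e" using e by (simp add: central_hom_def)
  note el = bialg_hom_linear[OF b]
  let ?L = "\<lambda>y t. pr y (e t)"
  have l: "linear_on D.I (UNIV :: unit set) (\<lambda>t _. ?L y t)" for y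
    by (rule linear_on_compose[OF el pr_linear])
  have m: "?L y (hmult A t s) = ?L y t * ?L y s"
    if "y \<in> carrier G" "t \<in> hspace A" "s \<in> hspace A" for y t s
    unfolding bialg_hom_mult[OF b that(2,3)]
    by (rule pr_mult) (use e that bialg_hom_in[OF b] in \<open>auto simp: central_hom_def\<close>)
  have one: "?L y (gl \<one>) = 1" if "y \<in> carrier G" for y
    using bialg_hom_unit[OF b] pr_smash[of \<one> y ind] that by (simp add: gl_one[symmetric]) (simp add: gl_def ind_def)
  have ex: "\<exists>z\<in>carrier G. \<forall>x\<in>carrier G. ?L y (fn x) = (if x = z then 1 else 0)"
    if y: "y \<in> carrier G" for y
  proof -
    have "gl \<one> = (\<lambda>p. \<Sum>x\<in>carrier G. 1 * fn x p)"
    proof (rule ext, clarify)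
      fix x h
      have "(\<Sum>z\<in>carrier G. fn z (x, h)) = (\<Sum>z\<in>carrier G. if z = x then bvec \<one> h else 0)"
        by (rule sum.cong) (auto simp: fn_def tens_def bvec_def)
      then show "gl \<one> (x, h) = (\<Sum>x'\<in>carrier G. 1 * fn x' (x, h))"
        using finG by (simp add: gl_def tens_def ind_def)
    qed
    then have "(\<lambda>_::unit. ?L y (gl \<one>)) = (\<lambda>_. \<Sum>x\<in>carrier G. 1 * ?L y (fn x))"
      using linear_on_sum[OF l finG, where v = fn and c = "\<lambda>_. 1"] fn_in by simp
    then have s: "(\<Sum>x\<in>carrier G. ?L y (fn x)) = 1" using one[OF y] by (simp add: fun_eq_iff)
    then have "\<not> (\<forall>x\<in>carrier G. ?L y (fn x) = 0)" using sum.neutral by fastforce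
    then obtain z where z: "z \<in> carrier G" "?L y (fn z) \<noteq> 0" by blast
    have "?L y (fn z) = ?L y (fn z) * ?L y (fn z)"
      using m[OF y fn_in[OF z(1)] fn_in[OF z(1)]] z(1) by (simp add: fn_mult)
    then have "?L y (fn z) = 1" using z(2) by simp
    moreover have "?L y (fn x) = 0" if x: "x \<in> carrier G" "x \<noteq> z" for x
    proof -
      have "e (\<lambda>_. 0) = (\<lambda>_. 0)" by (rule linear_on_0[OF el])
      then have "?L y (hmult A (fn x) (fn z)) = 0"
        using x z(1) by (simp add: fn_mult pr_def)
      then show ?thesis using m[OF y fn_in[OF x(1)] fn_in[OF z(1)]] z(2) by simp
    qed
    ultimately show ?thesis using z(1) by auto
  qed
  then have "\<forall>y\<in>carrier G. \<exists>z. z \<in> carrier G \<and> (\<forall>x\<in>carrier G. ?L y (fn x) = (if x = z then 1 else 0))"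
    by blast
  then obtain w where w: "\<forall>y\<in>carrier G. w y \<in> carrier G \<and>
      (\<forall>x\<in>carrier G. ?L y (fn x) = (if x = w y then 1 else 0))"
    by (rule bchoice[THEN exE])
  have wc: "w y \<in> carrier G" if "y \<in> carrier G" for y using w that by blast
  have wf: "?L y (fn x) = (if x = w y then 1 else 0)" if "y \<in> carrier G" "x \<in> carrier G" for x y
    using w that by blast
  have central: "w y \<otimes> h = h \<otimes> w y" if y: "y \<in> carrier G" and h: "h \<in> carrier G" for y h
  proof -
    \<comment> \<open>\<open>gl h\<close> is invertible, so its value under a multiplicative
      functional is nonzero and can be cancelled from the relation \<open>gl_fn\<close>.\<close>
    have "?L y (gl h) * ?L y (gl (inv h)) = 1"
      using m[OF y gl_in[OF h] gl_in[OF inv_closed[OF h]]] h one[OF y] by (simp add: gl_mult)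
    then have nz: "?L y (gl h) \<noteq> 0" by auto
    let ?z = "h \<otimes> w y \<otimes> inv h"
    have z: "?z \<in> carrier G" using h wc[OF y] by simp
    have "?L y (gl h) * ?L y (fn (w y)) = ?L y (fn ?z) * ?L y (gl h)"
      using m[OF y gl_in[OF h] fn_in[OF wc[OF y]]] m[OF y fn_in[OF z] gl_in[OF h]]
        gl_fn[OF h wc[OF y]] by metis
    then have "?L y (fn ?z) \<noteq> 0" using nz wf[OF y wc[OF y]] by auto
    then have "?z = w y" using wf[OF y z] by (auto split: if_splits)
    then have "?z \<otimes> h = w y \<otimes> h" by simp
    then show ?thesis using h wc[OF y] by (simp add: m_assoc)
  qed
  have hom: "w (y \<otimes> x) = w y \<otimes> w x" if y: "y \<in> carrier G" and x: "x \<in> carrier G" for x y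
  proof -
    \<comment> \<open>The comultiplication of \<open>fn ?z\<close> is the sum of the
      \<open>fn p \<otimes> fn q\<close> with \<open>q \<otimes> p = ?z\<close>. For this
      \<open>?z\<close> exactly the term \<open>p = w x\<close>, \<open>q = w y\<close> survives
      evaluation, and the value 1 identifies \<open>w (y \<otimes> x)\<close>.\<close>
    let ?z = "w y \<otimes> w x"
    have z: "?z \<in> carrier G" using wc x y by simp
    have "?L (y \<otimes> x) (fn ?z) = (\<Sum>g\<in>carrier G. \<Sum>h\<in>carrier G. hcomult A (e (fn ?z)) ((x, g), (y, h)))"
      by (rule pr_tensor[OF x y, symmetric])
    also have "\<dots> = (\<Sum>g\<in>carrier G. \<Sum>h\<in>carrier G. \<Sum>i\<in>D.I. \<Sum>j\<in>D.I.
        hcomult A (fn ?z) (i, j) * (e (bvec i) (x, g) * e (bvec j) (y, h)))"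
      unfolding bialg_hom_comult[OF b fn_in[OF z]] tensor_map_def by (simp add: tens_def)
    also have "\<dots> = (\<Sum>g\<in>carrier G. \<Sum>i\<in>D.I. \<Sum>h\<in>carrier G. \<Sum>j\<in>D.I.
        hcomult A (fn ?z) (i, j) * (e (bvec i) (x, g) * e (bvec j) (y, h)))"
      by (rule sum.cong[OF refl], rule sum.swap)
    also have "\<dots> = (\<Sum>i\<in>D.I. \<Sum>g\<in>carrier G. \<Sum>j\<in>D.I. \<Sum>h\<in>carrier G.
        hcomult A (fn ?z) (i, j) * (e (bvec i) (x, g) * e (bvec j) (y, h)))"
      by (subst sum.swap, rule sum.cong[OF refl], rule sum.cong[OF refl], rule sum.swap)
    also have "\<dots> = (\<Sum>i\<in>D.I. \<Sum>j\<in>D.I. \<Sum>g\<in>carrier G. \<Sum>h\<in>carrier G.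
        hcomult A (fn ?z) (i, j) * (e (bvec i) (x, g) * e (bvec j) (y, h)))"
      by (rule sum.cong[OF refl], rule sum.swap)
    also have "\<dots> = (\<Sum>i\<in>D.I. \<Sum>j\<in>D.I. hcomult A (fn ?z) (i, j) * (?L x (bvec i) * ?L y (bvec j)))"
      by (simp only: pr_def sum_product) (simp only: sum_distrib_left)
    also have "\<dots> = (\<Sum>i\<in>D.I. \<Sum>j\<in>D.I. if i = (w x, \<one>) then if j = (w y, \<one>) then 1 else 0 else 0)"
    proof (intro sum.cong refl)
      fix i j assume ij: "i \<in> D.I" "j \<in> D.I"
      obtain p g q h where pq: "i = (p, g)" "j = (q, h)" by (cases i; cases j) auto
      have c: "p \<in> carrier G" "g \<in> carrier G" "q \<in> carrier G" "h \<in> carrier G"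
        using ij pq by (auto simp: sel)
      have D: "hcomult A (fn ?z) ((p, g), (q, h)) = (if g = \<one> \<and> h = \<one> \<and> q \<otimes> p = ?z then 1 else 0)"
        using c by (auto simp: sel fn_def tens_def bvec_def)
      have "bvec (k, \<one>) = fn k" for k by (simp add: fn_def bvec_pair)
      then show "hcomult A (fn ?z) (i, j) * (?L x (bvec i) * ?L y (bvec j)) =
          (if i = (w x, \<one>) then if j = (w y, \<one>) then 1 else 0 else 0)"
        using c wf x y unfolding pq D by (cases "g = \<one>"; cases "h = \<one>") auto
    qed
    also have "\<dots> = (\<Sum>i\<in>D.I. if i = (w x, \<one>) then \<Sum>j\<in>D.I. if j = (w y, \<one>) then 1 else 0 else 0)"
      by (rule sum.cong) auto
    also have "\<dots> = 1"
      using wc[OF x] wc[OF y] D.fin by (simp add: sel)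
    finally show ?thesis using wf[of "y \<otimes> x" ?z] x y z by (auto split: if_splits)
  qed
  have "w \<in> hom G G" using hom wc by (auto simp: hom_def)
  then show thesis using that central wf by blast
qed

theorem central_hom_nilpotent:
  assumes pna: "purely_nonabelian G" and \<theta>: "central_hom \<theta>"
  shows "\<exists>n. \<forall>t\<in>hspace A. (\<theta> ^^ n) t = (\<lambda>p. hcounit A t * hunit A p)"
proof -
  have b\<theta>: "bialg_hom A A \<theta>" using \<theta> by (simp add: central_hom_def)
  obtain N where N: "N \<ge> 1" "\<forall>t\<in>{t. grouplike t}. (\<theta> ^^ N) ((\<theta> ^^ N) t) = (\<theta> ^^ N) t"
    using finite_self_map_idem_power[OF finite_grouplike, of \<theta>] bialg_hom_grouplike[OF b\<theta>] by auto
  define e where "e = \<theta> ^^ N"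
  have ce: "central_hom e"
    unfolding e_def using central_hom_funpow[OF \<theta>, of "N - 1"] N(1) by simp
  then have b: "bialg_hom A A e" by (simp add: central_hom_def)
  note el = bialg_hom_linear[OF b]
  have idem: "e (e (gl g)) = e (gl g)" if "g \<in> carrier G" for g
    using N(2) grouplike_gl[OF that] by (simp add: e_def)
  obtain v r where v: "v \<in> hom G G"
    and vc: "\<And>g h. g \<in> carrier G \<Longrightarrow> h \<in> carrier G \<Longrightarrow> v g \<otimes> h = h \<otimes> v g"
    and egl: "\<And>g. g \<in> carrier G \<Longrightarrow> e (gl g) = tens (r g) (bvec (v g))"
    and rin: "\<And>g. g \<in> carrier G \<Longrightarrow> r g \<in> fspace (carrier G)"
    and rmult: "\<And>g x y. g \<in> carrier G \<Longrightarrow> x \<in> carrier G \<Longrightarrow> y \<in> carrier G \<Longrightarrow> r g (y \<otimes> x) = r g x * r g y"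
    and rone: "\<And>g. g \<in> carrier G \<Longrightarrow> r g \<one> = 1"
    using central_hom_gl[OF ce] by blast
  obtain w where w: "w \<in> hom G G"
    and wc: "\<And>y h. y \<in> carrier G \<Longrightarrow> h \<in> carrier G \<Longrightarrow> w y \<otimes> h = h \<otimes> w y"
    and efn: "\<And>y x. y \<in> carrier G \<Longrightarrow> x \<in> carrier G \<Longrightarrow> pr y (e (fn x)) = (if x = w y then 1 else 0)"
    using central_hom_fn[OF ce] by blast
  obtain n1 where n1: "\<forall>g\<in>carrier G. (v ^^ n1) g = \<one>"
    using central_endo_nilpotent[OF finG pna v vc] by blast
  obtain n2 where n2: "\<forall>g\<in>carrier G. (w ^^ n2) g = \<one>"
    using central_endo_nilpotent[OF finG pna w wc] by blast
  have vin [simp]: "v g \<in> carrier G" and win [simp]: "w g \<in> carrier G" if "g \<in> carrier G" for g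
    using v w that by (auto simp: hom_def)
  have vpow [simp]: "(v ^^ k) g \<in> carrier G" and wpow [simp]: "(w ^^ k) g \<in> carrier G"
    if "g \<in> carrier G" for g k
    using hom_funpow[OF v, of k] hom_funpow[OF w, of k] that by (auto simp: hom_def)
  have prm: "pr y (e (hmult A t s)) = pr y (e t) * pr y (e s)"
    if "y \<in> carrier G" "t \<in> hspace A" "s \<in> hspace A" for y t s
    unfolding bialg_hom_mult[OF b that(2,3)]
    by (rule pr_mult) (use ce that bialg_hom_in[OF b] in \<open>auto simp: central_hom_def\<close>)
  have prgl: "pr y (e (gl g)) = r g y" if "y \<in> carrier G" "g \<in> carrier G" for y g
    using that by (simp add: egl pr_smash)
  have prbvec: "pr y (e (bvec (x, g))) = (if x = w y then r g y else 0)"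
    if "y \<in> carrier G" "x \<in> carrier G" "g \<in> carrier G" for y x g
    using that by (simp add: bvec_split prm fn_in gl_in efn prgl)
  have prlin: "linear_on D.I (UNIV :: unit set) (\<lambda>t _. pr y (e t))" for y
    by (rule linear_on_compose[OF el pr_linear])
  \<comment> \<open>Apply \<open>e\<close> to \<open>e (gl g)\<close>, which \<open>idem\<close>
    leaves unchanged, and evaluate at \<open>y\<close>. In the basis expansion only the term
    \<open>x = w y\<close>, \<open>h = v g\<close> remains.\<close>
  have req: "r g y = r g (w y) * r (v g) y" if g: "g \<in> carrier G" and y: "y \<in> carrier G" for g y
  proof -
    have s: "tens (r g) (bvec (v g)) \<in> hspace A" using smash_in rin g by simp
    have "r g y = pr y (e (tens (r g) (bvec (v g))))"
      using prgl[OF y g] idem[OF g] egl[OF g] by simp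
    also have "\<dots> = (\<Sum>p\<in>D.I. tens (r g) (bvec (v g)) p * pr y (e (bvec p)))"
      using linear_on_expand[OF prlin D.fin s] by simp
    also have "\<dots> = (\<Sum>x\<in>carrier G. \<Sum>h\<in>carrier G. if h = v g then if x = w y then r g x * r h y else 0 else 0)"
      unfolding sel(1) sum.cartesian_product
      by (intro sum.cong refl) (auto simp: prbvec[OF y] tens_def bvec_apply)
    also have "\<dots> = r g (w y) * r (v g) y" using finG g y by simp
    finally show ?thesis .
  qed
  \<comment> \<open>The identity divided by \<open>w\<close>: after cancelling
    \<open>r g (w y)\<close>, the relation \<open>req\<close> trades \<open>q\<close> in the second
    argument of \<open>r\<close> for \<open>v\<close> in the first.\<close>
  define q where "q = (\<lambda>y. y \<otimes> inv (w y))"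
  have qin [simp]: "q y \<in> carrier G" if "y \<in> carrier G" for y using that by (simp add: q_def)
  have rq: "r g (q y) = r (v g) y" if g: "g \<in> carrier G" and y: "y \<in> carrier G" for g y
  proof -
    have "r g (w y \<otimes> inv (w y)) = r g (inv (w y)) * r g (w y)"
      by (rule rmult) (use g y in simp_all)
    then have nz: "r g (w y) \<noteq> 0" using rone[OF g] y by auto
    have "r g y = r g (q y \<otimes> w y)" using y by (simp add: q_def m_assoc)
    also have "\<dots> = r g (w y) * r g (q y)" by (rule rmult) (use g y in simp_all)
    finally show ?thesis using req[OF g y] nz by simp
  qed
  have "inj_on q (carrier G)"
  proof (rule inj_onI)
    fix x y assume x: "x \<in> carrier G" and y: "y \<in> carrier G" and "q x = q y"
    then have "inv y \<otimes> (x \<otimes> inv (w x)) \<otimes> w x = inv y \<otimes> (y \<otimes> inv (w y)) \<otimes> w x" by (simp add: q_def)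
    then have "inv y \<otimes> x = inv (w y) \<otimes> w x" using x y by (simp add: m_assoc)
    also have "\<dots> = w (inv y \<otimes> x)"
    proof -
      interpret group_hom G G w by unfold_locales (rule w)
      show ?thesis using x y by simp
    qed
    finally have fix1: "w (inv y \<otimes> x) = inv y \<otimes> x" by simp
    have "(w ^^ k) (inv y \<otimes> x) = inv y \<otimes> x" for k by (induction k) (simp_all add: fix1)
    then have "inv y \<otimes> x = \<one>" using n2 x y by (metis inv_closed m_closed)
    then show "x = y" using x y by (metis inv_closed inv_inv inv_equality)
  qed
  then have qs: "q ` carrier G = carrier G"
    using finG by (intro endo_inj_surj) auto
  have qpow: "\<exists>z\<in>carrier G. (q ^^ k) z = y" if "y \<in> carrier G" for k y
    using that
  proof (induction k arbitrary: y)
    case (Suc k)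
    then obtain y' where "y' \<in> carrier G" "q y' = y" using qs by (metis imageE)
    then show ?case using Suc.IH by fastforce
  qed simp
  have qpin [simp]: "(q ^^ k) y \<in> carrier G" if "y \<in> carrier G" for k y
    using that by (induction k) auto
  have rpow: "r g ((q ^^ k) y) = r ((v ^^ k) g) y" if "g \<in> carrier G" "y \<in> carrier G" for g y k
    using that
  proof (induction k arbitrary: y)
    case (Suc k)
    have "r g ((q ^^ Suc k) y) = r g ((q ^^ k) (q y))" by (simp add: funpow_swap1)
    also have "\<dots> = r ((v ^^ k) g) (q y)" using Suc by simp
    also have "\<dots> = r ((v ^^ Suc k) g) y" using Suc.prems rq[of "(v ^^ k) g" y] by simp
    finally show ?case .
  qed simp
  have r1: "r \<one> y = 1" if "y \<in> carrier G" for y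
  proof -
    have "e (gl \<one>) = gl \<one>" using bialg_hom_unit[OF b] by (simp add: gl_one)
    then show ?thesis using prgl[OF that, of \<one>] pr_smash[of \<one> y ind] that by (simp add: gl_def ind_def)
  qed
  have rtriv: "r g y = 1" if g: "g \<in> carrier G" and y: "y \<in> carrier G" for g y
  proof -
    \<comment> \<open>Moving \<open>q ^^ n1\<close> across turns the first argument into
      \<open>(v ^^ n1) g = \<one>\<close>; surjectivity of \<open>q\<close> brings every
      \<open>y\<close> into this form.\<close>
    obtain z where "z \<in> carrier G" "(q ^^ n1) z = y" using qpow[OF y] by blast
    then show ?thesis using rpow[OF g, of z n1] n1 g r1 by simp
  qed
  have egl1: "e (gl g) = hunit A" if g: "g \<in> carrier G" for g
  proof -
    have rind: "r h = ind" if "h \<in> carrier G" for h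
      using rin[OF that] rtriv[OF that] by (auto simp: fun_eq_iff ind_def fspace_def)
    have eg: "e (gl h) = gl (v h)" if "h \<in> carrier G" for h
      using egl[OF that] rind[OF that] by (simp add: gl_def)
    \<comment> \<open>With \<open>r\<close> trivial, idempotence of \<open>e\<close> on
      \<open>gl g\<close> becomes idempotence of \<open>v\<close>, and a fixed point of a nilpotent
      map is \<open>\<one>\<close>.\<close>
    have "gl (v (v g)) = gl (v g)" using idem[OF g] eg g by simp
    then have "gl (v (v g)) (\<one>, v g) = gl (v g) (\<one>, v g)" by simp
    then have fix1: "v (v g) = v g" by (auto simp: gl_def tens_def ind_def bvec_def split: if_splits)
    have "(v ^^ k) (v g) = v g" for k by (induction k) (simp_all add: fix1)
    then have "v g = \<one>" using n1 g by (metis vin)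
    then show ?thesis using eg[OF g] by (simp add: gl_one)
  qed
  \<comment> \<open>With \<open>r\<close> trivial the group part of \<open>t\<close> is merely
    summed out, so \<open>e\<close> acts on evaluations through \<open>w\<close> alone.\<close>
  have pre: "pr y (e t) = pr (w y) t" if y: "y \<in> carrier G" and t: "t \<in> hspace A" for y t
  proof -
    have "pr y (e (bvec p)) = pr (w y) (bvec p)" if "p \<in> D.I" for p
    proof -
      obtain x g where "p = (x, g)" "x \<in> carrier G" "g \<in> carrier G"
        using \<open>p \<in> D.I\<close> by (auto simp: sel)
      then show ?thesis
        using y rtriv pr_smash[of g "w y" "bvec x"] by (simp add: prbvec bvec_apply flip: bvec_pair)
    qed
    then have "(\<lambda>_::unit. pr y (e t)) = (\<lambda>_. pr (w y) t)"
      by (intro linear_on_eqI[OF prlin pr_linear D.fin _ t]) simp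
    then show ?thesis by (simp add: fun_eq_iff)
  qed
  have epin: "(e ^^ k) t \<in> hspace A" if "t \<in> hspace A" for k t
    using bialg_hom_in[OF bialg_hom_funpow[OF b] that] .
  have prek: "pr y ((e ^^ k) t) = pr ((w ^^ k) y) t" if "y \<in> carrier G" "t \<in> hspace A" for y t k
    using that by (induction k arbitrary: y) (simp_all add: pre epin funpow_swap1[of w])
  \<comment> \<open>\<open>n2\<close> steps kill \<open>w\<close>; the extra one ensures that
    \<open>e\<close> acts at least once on \<open>gl h\<close>, as \<open>egl1\<close> requires,
    even if \<open>n2 = 0\<close>.\<close>
  define E where "E = e ^^ Suc n2"
  have bE: "bialg_hom A A E" unfolding E_def by (rule bialg_hom_funpow[OF b])
  note El = bialg_hom_linear[OF bE]
  have prE: "pr y (E t) = hcounit A t" if "y \<in> carrier G" "t \<in> hspace A" for y t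
  proof -
    have "pr y (E t) = pr ((w ^^ n2) (w y)) t"
      using prek[OF that, of "Suc n2"] by (simp add: E_def funpow_swap1)
    then show ?thesis using n2 that by (simp add: pr_one)
  qed
  \<comment> \<open>Split off a leg evaluated at \<open>x\<close>: by \<open>prE\<close> it
    contributes only the counit, which the counit law absorbs, so \<open>x\<close> may be replaced
    by \<open>\<one>\<close>.\<close>
  have Econst: "E t (x, h) = E t (\<one>, h)" if x: "x \<in> carrier G" and h: "h \<in> carrier G" and t: "t \<in> hspace A" for x h t
  proof -
    have "E t (x, h) = (\<Sum>g\<in>carrier G. hcomult A (E t) ((x, g), (\<one>, h)))"
      using x h finG by (simp add: sel if_distrib cong: if_cong)
    also have "\<dots> = (\<Sum>g\<in>carrier G. \<Sum>i\<in>D.I. \<Sum>j\<in>D.I. hcomult A t (i, j) * (E (bvec i) (x, g) * E (bvec j) (\<one>, h)))"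
      by (simp add: bialg_hom_comult[OF bE t] tensor_map_def tens_def)
    also have "\<dots> = (\<Sum>i\<in>D.I. \<Sum>j\<in>D.I. \<Sum>g\<in>carrier G. hcomult A t (i, j) * (E (bvec i) (x, g) * E (bvec j) (\<one>, h)))"
      by (subst sum.swap, rule sum.cong[OF refl], rule sum.swap)
    also have "\<dots> = (\<Sum>i\<in>D.I. \<Sum>j\<in>D.I. hcomult A t (i, j) * (pr x (E (bvec i)) * E (bvec j) (\<one>, h)))"
      by (simp add: pr_def sum_distrib_left sum_distrib_right)
    also have "\<dots> = (\<Sum>j\<in>D.I. (\<Sum>i\<in>D.I. hcounit A (bvec i) * hcomult A t (i, j)) * E (bvec j) (\<one>, h))"
      unfolding sum_distrib_right by (subst sum.swap) (simp add: prE[OF x] mult_ac)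
    also have "\<dots> = E t (\<one>, h)"
      by (simp add: D.counit_left[OF t] linear_on_expand[OF El D.fin t])
    finally show ?thesis .
  qed
  have Egl: "E (gl h) = hunit A" if h: "h \<in> carrier G" for h
  proof -
    have "(e ^^ k) (hunit A) = hunit A" for k
      using bialg_hom_unit[OF bialg_hom_funpow[OF b]] .
    then show ?thesis by (simp add: E_def funpow_swap1 egl1[OF h])
  qed
  \<comment> \<open>By \<open>Econst\<close> the element \<open>E t\<close> is a combination of the
    \<open>gl h\<close>, and the second \<open>E\<close> collapses each of them to the unit.\<close>
  have EE: "E (E t) = (\<lambda>p. hcounit A t * hunit A p)" if t: "t \<in> hspace A" for t
  proof -
    have Et: "E t \<in> hspace A" by (rule bialg_hom_in[OF bE t])
    have "E t = (\<lambda>p. \<Sum>h\<in>carrier G. E t (\<one>, h) * gl h p)"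
    proof (rule ext, clarify)
      fix x g
      have "(\<Sum>h\<in>carrier G. E t (\<one>, h) * gl h (x, g)) = (\<Sum>h\<in>carrier G. if h = g then E t (\<one>, g) * ind x else 0)"
        by (rule sum.cong) (auto simp: gl_def tens_def bvec_def)
      also have "\<dots> = E t (x, g)"
        using Et Econst[OF _ _ t, of x g] finG
        by (cases "x \<in> carrier G \<and> g \<in> carrier G") (auto simp: ind_def fspace_def sel(1))
      finally show "E t (x, g) = (\<Sum>h\<in>carrier G. E t (\<one>, h) * gl h (x, g))" by simp
    qed
    then have "E (E t) = E (\<lambda>p. \<Sum>h\<in>carrier G. E t (\<one>, h) * gl h p)" by simp
    also have "\<dots> = (\<lambda>p. \<Sum>h\<in>carrier G. E t (\<one>, h) * E (gl h) p)"
      by (rule linear_on_sum[OF El finG gl_in])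
    also have "\<dots> = (\<lambda>p. pr \<one> (E t) * hunit A p)"
      by (simp add: Egl pr_def sum_distrib_right)
    finally show ?thesis by (simp add: prE[OF one_closed t])
  qed
  have "E t = (\<theta> ^^ (N * Suc n2)) t" for t by (simp only: E_def e_def funpow_mult[symmetric])
  then have "(\<theta> ^^ (N * Suc n2 + N * Suc n2)) t = E (E t)" for t by (simp only: funpow_add comp_apply)
  then show ?thesis using EE by metis
qed

end

section \<open>Functoriality of the double\<close>

text \<open>The map \<open>a # g \<mapsto> (a \<circ> p) # \<iota>(g)\<close>.\<close>

definition double_map ::
  "('g, 'm) monoid_scheme \<Rightarrow> ('l, 'n) monoid_scheme \<Rightarrow> ('l \<Rightarrow> 'g) \<Rightarrow> ('g \<Rightarrow> 'l) \<Rightarrow>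
    ('g \<times> 'g \<Rightarrow> 'k::field) \<Rightarrow> 'l \<times> 'l \<Rightarrow> 'k" where
  "double_map G L p \<iota> u = (\<lambda>(x, k). if x \<in> carrier L
     then \<Sum>g\<in>carrier G. if \<iota> g = k then u (p x, g) else 0 else 0)"

lemma tensor_map_apply:
  assumes f: "linear_on I I' f" and g: "linear_on J J' g" and fin: "finite I" "finite J"
    and T: "T \<in> fspace (I \<times> J)"
  shows "tensor_map I J f g T (r, s) = f (\<lambda>i. g (\<lambda>j. T (i, j)) s) r"
proof -
  have T2: "(\<lambda>j. T (i, j)) \<in> fspace J" for i using T by (auto simp: fspace_def)
  have "tensor_map I J f g T (r, s) = (\<Sum>i\<in>I. (\<Sum>j\<in>J. T (i, j) * g (bvec j) s) * f (bvec i) r)"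
    unfolding sum_distrib_right by (simp add: tensor_map_def tens_def mult_ac)
  also have "\<dots> = (\<Sum>i\<in>I. g (\<lambda>j. T (i, j)) s * f (bvec i) r)"
    by (simp only: linear_on_expand[OF g fin(2) T2])
  also have "\<dots> = f (\<lambda>i. g (\<lambda>j. T (i, j)) s) r"
  proof (rule linear_on_expand[OF f fin(1)])
    have "g (\<lambda>j. T (i, j)) s = 0" if "i \<notin> I" for i
    proof -
      have "(\<lambda>j. T (i, j)) = (\<lambda>_. 0)" using T that by (auto simp: fspace_def)
      then show ?thesis using linear_on_0[OF g] by simp
    qed
    then show "(\<lambda>i. g (\<lambda>j. T (i, j)) s) \<in> fspace I" by (simp add: fspace_def)
  qed
  finally show ?thesis .
qed

text \<open>\<open>equiv\<close> says that \<open>p\<close> intertwines conjugation by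
  \<open>\<iota> g\<close> with conjugation by \<open>g\<close>, which is what the twisted product
  demands. Both inclusions and both projections of a direct product are instances.\<close>

lemma bialg_hom_double_map:
  fixes G :: "('g, 'm) monoid_scheme" and L :: "('l, 'n) monoid_scheme"
  assumes G: "group G" "finite (carrier G)" and L: "group L" "finite (carrier L)"
    and p: "p \<in> hom L G" and \<iota>: "\<iota> \<in> hom G L"
    and equiv: "\<And>g x. g \<in> carrier G \<Longrightarrow> x \<in> carrier L \<Longrightarrow>
      inv\<^bsub>G\<^esub> g \<otimes>\<^bsub>G\<^esub> p x \<otimes>\<^bsub>G\<^esub> g = p (inv\<^bsub>L\<^esub> \<iota> g \<otimes>\<^bsub>L\<^esub> x \<otimes>\<^bsub>L\<^esub> \<iota> g)"
  shows "bialg_hom (double G) (double L) (double_map G L p \<iota> :: _ \<Rightarrow> _ \<Rightarrow> 'k::field)"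
proof -
  interpret G: finite_double G "double G :: ('g \<times> 'g, 'k) hopf"
    using G by (intro finite_double.intro finite_double_axioms.intro) auto
  interpret L: finite_double L "double L :: ('l \<times> 'l, 'k) hopf"
    using L by (intro finite_double.intro finite_double_axioms.intro) auto
  interpret p: group_hom L G p by unfold_locales (rule p)
  interpret i: group_hom G L \<iota> by unfold_locales (rule \<iota>)
  let ?f = "double_map G L p \<iota> :: _ \<Rightarrow> _ \<Rightarrow> 'k"
  have out: "?f u (x, k) = 0" if "\<not> (x \<in> carrier L \<and> k \<in> carrier L)" for u x k
    using that by (auto simp: double_map_def intro!: sum.neutral)
  have lin: "linear_on G.D.I L.D.I ?f"
  proof (rule linear_onI)
    show "?f v \<in> fspace L.D.I" for v
      using out by (auto simp: fspace_def L.sel(1))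
    show "?f (\<lambda>i. a * v i + b * w i) = (\<lambda>j. a * ?f v j + b * ?f w j)" for a b v w
      by (auto simp: double_map_def fun_eq_iff sum_distrib_left simp flip: sum.distrib intro!: sum.cong)
  qed
  have mult: "?f (hmult (double G) u v) = hmult (double L) (?f u) (?f v)" for u v
  proof (rule ext, clarify)
    fix x k
    show "?f (hmult (double G) u v) (x, k) = hmult (double L) (?f u) (?f v) (x, k)"
    proof (cases "x \<in> carrier L \<and> k \<in> carrier L")
      case True
      then have x: "x \<in> carrier L" and k: "k \<in> carrier L" by auto
      let ?U = "\<lambda>a. u (p x, a)"
      let ?V = "\<lambda>l b. v (p (inv\<^bsub>L\<^esub> l \<otimes>\<^bsub>L\<^esub> x \<otimes>\<^bsub>L\<^esub> l), b)"
      have e: "\<iota> (a \<otimes>\<^bsub>G\<^esub> b) = k \<longleftrightarrow> \<iota> b = inv\<^bsub>L\<^esub> (\<iota> a) \<otimes>\<^bsub>L\<^esub> k"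
        if "a \<in> carrier G" "b \<in> carrier G" for a b
        using that k by auto
      have "?f (hmult (double G) u v) (x, k) = (\<Sum>g\<in>carrier G. \<Sum>a\<in>carrier G.
          if \<iota> g = k then ?U a * v (inv\<^bsub>G\<^esub> a \<otimes>\<^bsub>G\<^esub> p x \<otimes>\<^bsub>G\<^esub> a, inv\<^bsub>G\<^esub> a \<otimes>\<^bsub>G\<^esub> g) else 0)"
        using x by (auto simp: double_map_def G.sel intro!: sum.cong)
      also have "\<dots> = (\<Sum>a\<in>carrier G. \<Sum>g\<in>carrier G.
          if \<iota> g = k then ?U a * v (inv\<^bsub>G\<^esub> a \<otimes>\<^bsub>G\<^esub> p x \<otimes>\<^bsub>G\<^esub> a, inv\<^bsub>G\<^esub> a \<otimes>\<^bsub>G\<^esub> g) else 0)"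
        by (rule sum.swap)
      also have "\<dots> = (\<Sum>a\<in>carrier G. \<Sum>b\<in>carrier G.
          if \<iota> (a \<otimes>\<^bsub>G\<^esub> b) = k then ?U a * v (inv\<^bsub>G\<^esub> a \<otimes>\<^bsub>G\<^esub> p x \<otimes>\<^bsub>G\<^esub> a, inv\<^bsub>G\<^esub> a \<otimes>\<^bsub>G\<^esub> (a \<otimes>\<^bsub>G\<^esub> b)) else 0)"
        by (rule sum.cong[OF refl], rule G.sum_translate)
      also have "\<dots> = (\<Sum>a\<in>carrier G. \<Sum>b\<in>carrier G.
          if \<iota> b = inv\<^bsub>L\<^esub> (\<iota> a) \<otimes>\<^bsub>L\<^esub> k then ?U a * ?V (\<iota> a) b else 0)"
        by (intro sum.cong refl) (simp add: e equiv x del: i.hom_mult)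
      \<comment> \<open>Grouping the \<open>a\<close> by their image \<open>l\<close> recovers the
        sum over \<open>carrier L\<close> in the product of the target.\<close>
      also have "\<dots> = (\<Sum>a\<in>carrier G. \<Sum>l\<in>carrier L. if \<iota> a = l then
          \<Sum>b\<in>carrier G. if \<iota> b = inv\<^bsub>L\<^esub> l \<otimes>\<^bsub>L\<^esub> k then ?U a * ?V l b else 0 else 0)"
        using L(2) by (intro sum.cong refl) simp
      also have "\<dots> = (\<Sum>l\<in>carrier L. \<Sum>a\<in>carrier G. if \<iota> a = l then
          \<Sum>b\<in>carrier G. if \<iota> b = inv\<^bsub>L\<^esub> l \<otimes>\<^bsub>L\<^esub> k then ?U a * ?V l b else 0 else 0)"
        by (rule sum.swap)
      also have "\<dots> = hmult (double L) (?f u) (?f v) (x, k)"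
        using x k unfolding L.sel
        by (auto simp: double_map_def sum_product intro!: sum.cong)
      finally show ?thesis .
    next
      case False
      then show ?thesis using out by (auto simp: L.sel)
    qed
  qed
  have unit: "?f (hunit (double G)) = hunit (double L)"
  proof (rule ext, clarify)
    fix x k
    have "?f (hunit (double G)) (x, k) = (if x \<in> carrier L then
        \<Sum>g\<in>carrier G. if g = \<one>\<^bsub>G\<^esub> then if k = \<one>\<^bsub>L\<^esub> then 1 else 0 else 0 else 0)"
      unfolding double_map_def split_conv
      by (rule if_cong[OF refl _ refl], rule sum.cong[OF refl]) (auto simp: G.sel)
    then show "?f (hunit (double G)) (x, k) = hunit (double L) (x, k)"
      using G(2) by (auto simp: L.sel)
  qed
  have comult: "hcomult (double L) (?f u) = tensor_map G.D.I G.D.I ?f ?f (hcomult (double G) u)"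
    if u: "u \<in> hspace (double G)" for u
  proof (rule ext, clarify)
    fix x k y l
    have "tensor_map G.D.I G.D.I ?f ?f (hcomult (double G) u) ((x, k), (y, l)) =
      (if x \<in> carrier L \<and> y \<in> carrier L then \<Sum>g\<in>carrier G. if \<iota> g = k then
        \<Sum>h\<in>carrier G. if \<iota> h = l then hcomult (double G) u ((p x, g), (p y, h)) else 0 else 0 else 0)"
      unfolding tensor_map_apply[OF lin lin G.D.fin G.D.fin G.D.comult_in[OF u]]
      by (auto simp: double_map_def intro!: sum.cong sum.neutral)
    also have "\<dots> = (if x \<in> carrier L \<and> y \<in> carrier L then \<Sum>g\<in>carrier G. if \<iota> g = k then
        \<Sum>h\<in>carrier G. if h = g then if \<iota> g = l then u (p y \<otimes>\<^bsub>G\<^esub> p x, g) else 0 else 0 else 0 else 0)"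
      by (rule if_cong[OF refl _ refl], rule sum.cong[OF refl], rule if_cong[OF refl _ refl],
          rule sum.cong[OF refl]) (auto simp: G.sel)
    also have "\<dots> = (if x \<in> carrier L \<and> y \<in> carrier L then \<Sum>g\<in>carrier G. if \<iota> g = k then
        if \<iota> g = l then u (p y \<otimes>\<^bsub>G\<^esub> p x, g) else 0 else 0 else 0)"
      using G(2) by (intro if_cong refl sum.cong) auto
    also have "\<dots> = hcomult (double L) (?f u) ((x, k), (y, l))"
      by (auto simp: L.sel double_map_def intro!: sum.cong sum.neutral)
    finally show "hcomult (double L) (?f u) ((x, k), (y, l)) =
      tensor_map G.D.I G.D.I ?f ?f (hcomult (double G) u) ((x, k), (y, l))" by simp
  qed
  have counit: "hcounit (double L) (?f u) = hcounit (double G) u" for u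
  proof -
    have "hcounit (double L) (?f u) = (\<Sum>g\<in>carrier G. \<Sum>k\<in>carrier L. if \<iota> g = k then u (\<one>\<^bsub>G\<^esub>, g) else 0)"
      unfolding L.sel by (subst sum.swap) (simp add: double_map_def cong: if_cong)
    also have "\<dots> = hcounit (double G) u" unfolding G.sel using L(2) by (intro sum.cong refl) simp
    finally show ?thesis .
  qed
  show ?thesis
    unfolding bialg_hom_def using lin mult unit comult counit by blast
qed

section \<open>The double of a direct product\<close>

locale double_prod =
  fixes C :: "('c, 'm) monoid_scheme" and H :: "('h, 'n) monoid_scheme"
    and A :: "('c \<times> 'c, 'k::field) hopf" and B :: "('h \<times> 'h, 'k) hopf"
    and D :: "(('c \<times> 'h) \<times> ('c \<times> 'h), 'k) hopf"
  assumes grpC: "group C" and finC: "finite (carrier C)"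
    and grpH: "group H" and finH: "finite (carrier H)"
    and A_def: "A = double C" and B_def: "B = double H" and D_def: "D = double (C \<times>\<times> H)"
begin

sublocale PA: finite_double C A
  using grpC finC A_def by (intro finite_double.intro finite_double_axioms.intro)

sublocale PB: finite_double H B
  using grpH finH B_def by (intro finite_double.intro finite_double_axioms.intro)

lemma grpD: "group (C \<times>\<times> H)"
  using grpC grpH by (rule DirProd_group)

lemma finD: "finite (carrier (C \<times>\<times> H))"
  using finC finH by simp

sublocale PD: finite_double "C \<times>\<times> H" D
  using grpD finD D_def by (intro finite_double.intro finite_double_axioms.intro)

lemmas hA = PA.D.hopf_alg_axioms and hB = PB.D.hopf_alg_axioms and hD = PD.D.hopf_alg_axioms

text \<open>Under the identification with \<open>A \<otimes> B\<close>, \<open>iA\<close> and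
  \<open>iB\<close> are \<open>a \<mapsto> a \<otimes> 1\<close> and
  \<open>b \<mapsto> 1 \<otimes> b\<close>, while \<open>pA\<close> and \<open>pB\<close> apply the
  counit to the other factor.\<close>

definition iA :: "('c \<times> 'c \<Rightarrow> 'k) \<Rightarrow> ('c \<times> 'h) \<times> ('c \<times> 'h) \<Rightarrow> 'k" where
  "iA = double_map C (C \<times>\<times> H) fst (\<lambda>c. (c, \<one>\<^bsub>H\<^esub>))"

definition iB :: "('h \<times> 'h \<Rightarrow> 'k) \<Rightarrow> ('c \<times> 'h) \<times> ('c \<times> 'h) \<Rightarrow> 'k" where
  "iB = double_map H (C \<times>\<times> H) snd (\<lambda>h. (\<one>\<^bsub>C\<^esub>, h))"

definition pA :: "(('c \<times> 'h) \<times> ('c \<times> 'h) \<Rightarrow> 'k) \<Rightarrow> 'c \<times> 'c \<Rightarrow> 'k" where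
  "pA = double_map (C \<times>\<times> H) C (\<lambda>c. (c, \<one>\<^bsub>H\<^esub>)) fst"

definition pB :: "(('c \<times> 'h) \<times> ('c \<times> 'h) \<Rightarrow> 'k) \<Rightarrow> 'h \<times> 'h \<Rightarrow> 'k" where
  "pB = double_map (C \<times>\<times> H) H (\<lambda>h. (\<one>\<^bsub>C\<^esub>, h)) snd"

lemma prod_homs:
  "fst \<in> hom (C \<times>\<times> H) C" "snd \<in> hom (C \<times>\<times> H) H"
  "(\<lambda>c. (c, \<one>\<^bsub>H\<^esub>)) \<in> hom C (C \<times>\<times> H)" "(\<lambda>h. (\<one>\<^bsub>C\<^esub>, h)) \<in> hom H (C \<times>\<times> H)"
  by (auto simp: hom_def)

lemma inv_prod: "c \<in> carrier C \<Longrightarrow> h \<in> carrier H \<Longrightarrow>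
    inv\<^bsub>C \<times>\<times> H\<^esub> (c, h) = (inv\<^bsub>C\<^esub> c, inv\<^bsub>H\<^esub> h)"
  by (rule inv_DirProd[OF grpC grpH])

lemma bialg_hom_iA: "bialg_hom A D iA"
  unfolding A_def D_def iA_def
  by (rule bialg_hom_double_map[OF grpC finC grpD finD prod_homs(1,3)]) (auto simp: inv_prod)

lemma bialg_hom_iB: "bialg_hom B D iB"
  unfolding B_def D_def iB_def
  by (rule bialg_hom_double_map[OF grpH finH grpD finD prod_homs(2,4)]) (auto simp: inv_prod)

lemma bialg_hom_pA: "bialg_hom D A pA"
  unfolding A_def D_def pA_def
  by (rule bialg_hom_double_map[OF grpD finD grpC finC prod_homs(3,1)]) (auto simp: inv_prod)

lemma bialg_hom_pB: "bialg_hom D B pB"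
  unfolding B_def D_def pB_def
  by (rule bialg_hom_double_map[OF grpD finD grpH finH prod_homs(4,2)]) (auto simp: inv_prod)

lemma iA_apply: "iA u ((x, y), (c, h)) =
    (if x \<in> carrier C \<and> y \<in> carrier H \<and> c \<in> carrier C \<and> h = \<one>\<^bsub>H\<^esub> then u (x, c) else 0)"
proof -
  have "(\<Sum>g\<in>carrier C. if (g, \<one>\<^bsub>H\<^esub>) = (c, h) then u (x, g) else 0) =
    (\<Sum>g\<in>carrier C. if g = c then if h = \<one>\<^bsub>H\<^esub> then u (x, c) else 0 else 0)"
    by (rule sum.cong) auto
  then show ?thesis using finC by (auto simp: iA_def double_map_def cong: if_cong)
qed

lemma iB_apply: "iB u ((x, y), (c, h)) =
    (if x \<in> carrier C \<and> y \<in> carrier H \<and> h \<in> carrier H \<and> c = \<one>\<^bsub>C\<^esub> then u (y, h) else 0)"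
proof -
  have "(\<Sum>g\<in>carrier H. if (\<one>\<^bsub>C\<^esub>, g) = (c, h) then u (y, g) else 0) =
    (\<Sum>g\<in>carrier H. if g = h then if c = \<one>\<^bsub>C\<^esub> then u (y, h) else 0 else 0)"
    by (rule sum.cong) auto
  then show ?thesis using finH by (auto simp: iB_def double_map_def cong: if_cong)
qed

lemma pA_apply: "pA t (x, c) = (if x \<in> carrier C \<and> c \<in> carrier C
    then \<Sum>h\<in>carrier H. t ((x, \<one>\<^bsub>H\<^esub>), (c, h)) else 0)"
proof -
  have "(\<Sum>g\<in>carrier (C \<times>\<times> H). if fst g = c then t ((x, \<one>\<^bsub>H\<^esub>), g) else 0) =
    (\<Sum>a\<in>carrier C. \<Sum>h\<in>carrier H. if a = c then t ((x, \<one>\<^bsub>H\<^esub>), (c, h)) else 0)"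
    by (auto simp: sum.cartesian_product intro!: sum.cong)
  also have "\<dots> = (\<Sum>h\<in>carrier H. \<Sum>a\<in>carrier C. if a = c then t ((x, \<one>\<^bsub>H\<^esub>), (c, h)) else 0)"
    by (rule sum.swap)
  finally show ?thesis using finC by (auto simp: pA_def double_map_def)
qed

lemma pB_apply: "pB t (y, h) = (if y \<in> carrier H \<and> h \<in> carrier H
    then \<Sum>c\<in>carrier C. t ((\<one>\<^bsub>C\<^esub>, y), (c, h)) else 0)"
proof -
  have "(\<Sum>g\<in>carrier (C \<times>\<times> H). if snd g = h then t ((\<one>\<^bsub>C\<^esub>, y), g) else 0) =
    (\<Sum>c\<in>carrier C. \<Sum>b\<in>carrier H. if b = h then t ((\<one>\<^bsub>C\<^esub>, y), (c, h)) else 0)"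
    by (auto simp: sum.cartesian_product intro!: sum.cong)
  then show ?thesis using finH by (auto simp: pB_def double_map_def)
qed

lemma hspaceA_out: "u \<in> hspace A \<Longrightarrow> \<not> (x \<in> carrier C \<and> c \<in> carrier C) \<Longrightarrow> u (x, c) = 0"
  by (auto simp: fspace_def PA.sel(1))

lemma hspaceB_out: "u \<in> hspace B \<Longrightarrow> \<not> (x \<in> carrier H \<and> c \<in> carrier H) \<Longrightarrow> u (x, c) = 0"
  by (auto simp: fspace_def PB.sel(1))

lemma pA_iA: "u \<in> hspace A \<Longrightarrow> pA (iA u) = u"
  by (rule ext, clarify) (auto simp: pA_apply iA_apply finH hspaceA_out)

lemma pB_iB: "u \<in> hspace B \<Longrightarrow> pB (iB u) = u"
  by (rule ext, clarify) (auto simp: pB_apply iB_apply finC hspaceB_out)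

lemma pB_iA: "pB (iA u) = (\<lambda>r. hcounit A u * hunit B r)"
  by (rule ext, clarify) (auto simp: pB_apply iA_apply PA.sel PB.sel)

lemma pA_iB: "pA (iB u) = (\<lambda>r. hcounit B u * hunit A r)"
  by (rule ext, clarify) (auto simp: pA_apply iB_apply PA.sel PB.sel)

text \<open>The pure tensor \<open>tens a b\<close> carried back along \<open>double_ident\<close>
  to the basis of \<open>D\<close>.\<close>

definition jn :: "('c \<times> 'c \<Rightarrow> 'k) \<Rightarrow> ('h \<times> 'h \<Rightarrow> 'k) \<Rightarrow> ('c \<times> 'h) \<times> ('c \<times> 'h) \<Rightarrow> 'k" where
  "jn a b = (\<lambda>((x, y), (c, h)). a (x, c) * b (y, h))"

lemma iA_iB:
  assumes a: "a \<in> hspace A" and b: "b \<in> hspace B"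
  shows "hmult D (iA a) (iB b) = jn a b"
proof (rule ext, clarify)
  fix x y c h
  show "hmult D (iA a) (iB b) ((x, y), (c, h)) = jn a b ((x, y), (c, h))"
  proof (cases "x \<in> carrier C \<and> y \<in> carrier H \<and> c \<in> carrier C \<and> h \<in> carrier H")
    case True
    then have xy: "x \<in> carrier C" "y \<in> carrier H" "c \<in> carrier C" "h \<in> carrier H" by auto
    have e: "inv\<^bsub>C\<^esub> c' \<otimes>\<^bsub>C\<^esub> c = \<one>\<^bsub>C\<^esub> \<longleftrightarrow> c' = c" if "c' \<in> carrier C" for c'
      using that xy(3) by (metis PA.inv_equality PA.inv_inv PA.inv_closed PA.l_inv)
    have "hmult D (iA a) (iB b) ((x, y), (c, h)) = (\<Sum>c'\<in>carrier C. \<Sum>h'\<in>carrier H.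
        iA a ((x, y), (c', h')) * iB b ((inv\<^bsub>C\<^esub> c' \<otimes>\<^bsub>C\<^esub> x \<otimes>\<^bsub>C\<^esub> c', inv\<^bsub>H\<^esub> h' \<otimes>\<^bsub>H\<^esub> y \<otimes>\<^bsub>H\<^esub> h'),
          (inv\<^bsub>C\<^esub> c' \<otimes>\<^bsub>C\<^esub> c, inv\<^bsub>H\<^esub> h' \<otimes>\<^bsub>H\<^esub> h)))"
      using xy unfolding PD.sel sum.cartesian_product by (auto simp: inv_prod intro!: sum.cong)
    also have "\<dots> = (\<Sum>c'\<in>carrier C. \<Sum>h'\<in>carrier H. if h' = \<one>\<^bsub>H\<^esub> then
        if c' = c then a (x, c) * b (y, h) else 0 else 0)"
      using xy by (intro sum.cong refl) (auto simp: iA_apply iB_apply e)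
    also have "\<dots> = a (x, c) * b (y, h)" using xy finC finH by simp
    finally show ?thesis by (simp add: jn_def)
  next
    case False
    then show ?thesis using hspaceA_out[OF a, of x c] hspaceB_out[OF b, of y h]
      by (auto simp: jn_def PD.sel)
  qed
qed

lemma iB_iA:
  assumes a: "a \<in> hspace A" and b: "b \<in> hspace B"
  shows "hmult D (iB b) (iA a) = jn a b"
proof (rule ext, clarify)
  fix x y c h
  show "hmult D (iB b) (iA a) ((x, y), (c, h)) = jn a b ((x, y), (c, h))"
  proof (cases "x \<in> carrier C \<and> y \<in> carrier H \<and> c \<in> carrier C \<and> h \<in> carrier H")
    case True
    then have xy: "x \<in> carrier C" "y \<in> carrier H" "c \<in> carrier C" "h \<in> carrier H" by auto
    have e: "inv\<^bsub>H\<^esub> h' \<otimes>\<^bsub>H\<^esub> h = \<one>\<^bsub>H\<^esub> \<longleftrightarrow> h' = h" if "h' \<in> carrier H" for h'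
      using that xy(4) by (metis PB.inv_equality PB.inv_inv PB.inv_closed PB.l_inv)
    have "hmult D (iB b) (iA a) ((x, y), (c, h)) = (\<Sum>c'\<in>carrier C. \<Sum>h'\<in>carrier H.
        iB b ((x, y), (c', h')) * iA a ((inv\<^bsub>C\<^esub> c' \<otimes>\<^bsub>C\<^esub> x \<otimes>\<^bsub>C\<^esub> c', inv\<^bsub>H\<^esub> h' \<otimes>\<^bsub>H\<^esub> y \<otimes>\<^bsub>H\<^esub> h'),
          (inv\<^bsub>C\<^esub> c' \<otimes>\<^bsub>C\<^esub> c, inv\<^bsub>H\<^esub> h' \<otimes>\<^bsub>H\<^esub> h)))"
      using xy unfolding PD.sel sum.cartesian_product by (auto simp: inv_prod intro!: sum.cong)
    also have "\<dots> = (\<Sum>c'\<in>carrier C. \<Sum>h'\<in>carrier H. if h' = h then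
        if c' = \<one>\<^bsub>C\<^esub> then a (x, c) * b (y, h) else 0 else 0)"
      using xy by (intro sum.cong refl) (auto simp: iA_apply iB_apply e)
    also have "\<dots> = a (x, c) * b (y, h)" using xy finC finH by simp
    finally show ?thesis by (simp add: jn_def)
  next
    case False
    then show ?thesis using hspaceA_out[OF a, of x c] hspaceB_out[OF b, of y h]
      by (auto simp: jn_def PD.sel)
  qed
qed

lemma iA_iB_commute: "a \<in> hspace A \<Longrightarrow> b \<in> hspace B \<Longrightarrow> hmult D (iA a) (iB b) = hmult D (iB b) (iA a)"
  by (simp add: iA_iB iB_iA)

text \<open>The legs are evaluated at \<open>(x, 1)\<close> and \<open>(1, y)\<close>, whose product
  is \<open>(x, y)\<close> in either order, and both legs carry the same group element, so a single
  term survives. The two orders together give cocommutation.\<close>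

lemma pA_pB_comult:
  assumes t: "t \<in> hspace D" 
  shows "tensor_map PD.D.I PD.D.I pA pB (hcomult D t) ((x, c), (y, h)) = t ((x, y), (c, h))"
    and "tensor_map PD.D.I PD.D.I pA pB (\<lambda>(i, j). hcomult D t (j, i)) ((x, c), (y, h)) = t ((x, y), (c, h))"
proof -
  note pl = bialg_hom_linear[OF bialg_hom_pA] bialg_hom_linear[OF bialg_hom_pB]
  have t0: "t ((x, y), (c, h)) = 0"
    if "\<not> (x \<in> carrier C \<and> y \<in> carrier H \<and> c \<in> carrier C \<and> h \<in> carrier H)"
    using t that by (auto simp: fspace_def PD.sel(1))
  have T: "hcomult D t \<in> fspace (PD.D.I \<times> PD.D.I)" by (rule PD.D.comult_in[OF t])
  then have T': "(\<lambda>(i, j). hcomult D t (j, i)) \<in> fspace (PD.D.I \<times> PD.D.I)" by (auto simp: fspace_def)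
  have "tensor_map PD.D.I PD.D.I pA pB (hcomult D t) ((x, c), (y, h)) =
    (if x \<in> carrier C \<and> y \<in> carrier H \<and> c \<in> carrier C \<and> h \<in> carrier H then
      \<Sum>h'\<in>carrier H. \<Sum>c'\<in>carrier C. hcomult D t (((x, \<one>\<^bsub>H\<^esub>), (c, h')), ((\<one>\<^bsub>C\<^esub>, y), (c', h))) else 0)"
    unfolding tensor_map_apply[OF pl PD.D.fin PD.D.fin T] by (auto simp: pA_apply pB_apply)
  also have "\<dots> = (if x \<in> carrier C \<and> y \<in> carrier H \<and> c \<in> carrier C \<and> h \<in> carrier H then
      \<Sum>h'\<in>carrier H. \<Sum>c'\<in>carrier C. if c' = c then if h' = h then t ((x, y), (c, h)) else 0 else 0 else 0)"
    by (intro if_cong refl sum.cong) (auto simp: PD.sel)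
  also have "\<dots> = t ((x, y), (c, h))" using finC finH t0 by auto
  finally show "tensor_map PD.D.I PD.D.I pA pB (hcomult D t) ((x, c), (y, h)) = t ((x, y), (c, h))" .
  have "tensor_map PD.D.I PD.D.I pA pB (\<lambda>(i, j). hcomult D t (j, i)) ((x, c), (y, h)) =
    (if x \<in> carrier C \<and> y \<in> carrier H \<and> c \<in> carrier C \<and> h \<in> carrier H then
      \<Sum>h'\<in>carrier H. \<Sum>c'\<in>carrier C. hcomult D t (((\<one>\<^bsub>C\<^esub>, y), (c', h)), ((x, \<one>\<^bsub>H\<^esub>), (c, h'))) else 0)"
    unfolding tensor_map_apply[OF pl PD.D.fin PD.D.fin T'] by (auto simp: pA_apply pB_apply)
  also have "\<dots> = (if x \<in> carrier C \<and> y \<in> carrier H \<and> c \<in> carrier C \<and> h \<in> carrier H then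
      \<Sum>h'\<in>carrier H. \<Sum>c'\<in>carrier C. if c' = c then if h' = h then t ((x, y), (c, h)) else 0 else 0 else 0)"
    by (intro if_cong refl sum.cong) (auto simp: PD.sel)
  also have "\<dots> = t ((x, y), (c, h))" using finC finH t0 by auto
  finally show "tensor_map PD.D.I PD.D.I pA pB (\<lambda>(i, j). hcomult D t (j, i)) ((x, c), (y, h)) = t ((x, y), (c, h))" .
qed

lemma pA_pB_cocommuting: "cocommuting D pA pB"
  unfolding cocommuting_def
proof
  fix t assume t: "t \<in> hspace D"
  show "lift PD.D.I PD.D.I (\<lambda>a b. tens (pA a) (pB b)) (hcomult D t) =
      lift PD.D.I PD.D.I (\<lambda>a b. tens (pA b) (pB a)) (hcomult D t)"
    unfolding tensor_map_lift[of _ _ "pA" "pB", symmetric]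
      lift_flip[of _ _ "\<lambda>a b. tens (pA a) (pB b)", symmetric]
    by (rule ext, clarify) (simp only: pA_pB_comult[OF t])
qed

lemma conv_id:
  assumes t: "t \<in> hspace D"
  shows "PD.D.conv (hmult D) (\<lambda>t. iA (pA t)) (\<lambda>t. iB (pB t)) t = t"
proof (rule ext, clarify)
  fix x y c h
  have "PD.D.conv (hmult D) (\<lambda>t. iA (pA t)) (\<lambda>t. iB (pB t)) t ((x, y), (c, h)) =
      lift PD.D.I PD.D.I (\<lambda>a b. jn (pA a) (pB b)) (hcomult D t) ((x, y), (c, h))"
    unfolding PD.D.conv_def
    by (rule fun_cong[OF lift_cong]) (simp add: iA_iB bialg_hom_in[OF bialg_hom_pA] bialg_hom_in[OF bialg_hom_pB])
  also have "\<dots> = tensor_map PD.D.I PD.D.I pA pB (hcomult D t) ((x, c), (y, h))"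
    by (simp add: tensor_map_lift lift_def jn_def tens_def)
  finally show "PD.D.conv (hmult D) (\<lambda>t. iA (pA t)) (\<lambda>t. iB (pB t)) t ((x, y), (c, h)) = t ((x, y), (c, h))"
    by (simp only: pA_pB_comult[OF t])
qed

end

section \<open>Automorphisms\<close>

text \<open>Phrasing commutation with \<open>z\<close> as membership in a subalgebra lets
  \<open>conv_in_subalg\<close> pass it on to convolution products.\<close>

lemma (in hopf_alg) subalg_commutant:
  assumes z: "z \<in> hspace A"
  shows "subalg A {w \<in> hspace A. hmult A z w = hmult A w z}"
  unfolding subalg_def
proof (intro conjI ballI allI)
  show "hunit A \<in> {w \<in> hspace A. hmult A z w = hmult A w z}"
    using z by (simp add: alg.unit_in alg.unit_left alg.unit_right)
  fix x y assume "x \<in> {w \<in> hspace A. hmult A z w = hmult A w z}" "y \<in> {w \<in> hspace A. hmult A z w = hmult A w z}"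
  then have x: "x \<in> hspace A" "hmult A z x = hmult A x z" and y: "y \<in> hspace A" "hmult A z y = hmult A y z"
    by auto
  have "hmult A z (hmult A x y) = hmult A (hmult A x z) y" using x y z by (simp add: alg.assoc[symmetric])
  also have "\<dots> = hmult A (hmult A x y) z" using x y z by (simp add: alg.assoc)
  finally show "hmult A x y \<in> {w \<in> hspace A. hmult A z w = hmult A w z}"
    using x y by (simp add: alg.mult_in)
  show "(\<lambda>i. a * x i + b * y i) \<in> {w \<in> hspace A. hmult A z w = hmult A w z}" for a b
    using x y linear_on_comb[OF bilinear_on_right[OF alg.bil z] x(1) y(1)]
      linear_on_comb[OF bilinear_on_left[OF alg.bil z] x(1) y(1)]
    by (simp add: fspace_comb)
qed

text \<open>Precomposing \<open>\<phi> * \<psi> = id\<close> with \<open>\<phi> ^^ m\<close> gives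
  \<open>\<phi> ^^ m = (\<phi> ^^ Suc m) * (\<psi> \<circ> \<phi> ^^ m)\<close>. Membership in
  \<open>M\<close> therefore descends from the trivial power \<open>n\<close> to the identity at
  0.\<close>

lemma (in hopf_alg) nilpotent_complement:
  assumes M: "subalg A M" and \<phi>: "bialg_hom A A \<phi>" and \<psi>: "linear_on I I \<psi>"
    and \<psi>M: "\<And>x. x \<in> hspace A \<Longrightarrow> \<psi> x \<in> M"
    and id: "\<And>x. x \<in> hspace A \<Longrightarrow> conv (hmult A) \<phi> \<psi> x = x"
    and nil: "\<And>x. x \<in> hspace A \<Longrightarrow> (\<phi> ^^ n) x = (\<lambda>r. \<epsilon> x * hunit A r)"
  shows "hspace A \<subseteq> M"
proof -
  have hA: "hopf_alg A" by unfold_locales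
  have p: "bialg_hom A A (\<phi> ^^ m)" for m
  proof (induction m)
    case 0
    show ?case using bialg_hom_id[OF hA] by (simp add: id_def)
  next
    case (Suc m)
    then show ?case using bialg_hom_compose[OF hA hA _ \<phi>] by (simp add: comp_def)
  qed
  have "(\<forall>x\<in>hspace A. (\<phi> ^^ m) x \<in> M) \<Longrightarrow> hspace A \<subseteq> M" for m
  proof (induction m)
    case (Suc m)
    have "(\<phi> ^^ m) x \<in> M" if x: "x \<in> hspace A" for x
    proof -
      have "(\<phi> ^^ m) x = conv (hmult A) (\<lambda>x. \<phi> ((\<phi> ^^ m) x)) (\<lambda>x. \<psi> ((\<phi> ^^ m) x)) x"
        using conv_comp_right[OF hA hA alg.fd_algebra_axioms p bialg_hom_linear[OF \<phi>] \<psi> x]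
          id[OF bialg_hom_in[OF p x]] by simp
      also have "\<dots> \<in> M"
        by (rule conv_in_subalg[OF hA M]) (use Suc.prems \<psi>M bialg_hom_in[OF p] in auto)
      finally show ?thesis .
    qed
    then show ?case using Suc.IH by blast
  qed auto
  moreover have "(\<phi> ^^ n) x \<in> M" if "x \<in> hspace A" for x
    unfolding nil[OF that] by (rule subalg_scale[OF M]) (use M in \<open>simp add: subalg_def\<close>)
  ultimately show ?thesis by blast
qed

text \<open>\<open>Q \<circ> S\<close> is the convolution inverse of \<open>Q\<close>. Knowing that
  \<open>P * Q\<close> and \<open>Q\<close> take values in a subalgebra thus yields the same for
  \<open>P\<close>.\<close>

lemma conv_cancel_right:
  assumes A: "hopf_alg A" and B: "hopf_alg B" and P: "linear_on (hbasis A) (hbasis B) P"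
    and Q: "bialg_hom A B Q" and x: "x \<in> hspace A"
  shows "P x = hopf_alg.conv A (hmult B) (hopf_alg.conv A (hmult B) P Q) (\<lambda>x. Q (hantipode A x)) x"
proof -
  interpret A: hopf_alg A by fact
  interpret B: hopf_alg B by fact
  note T = B.alg.fd_algebra_axioms
  note Ql = bialg_hom_linear[OF Q]
  have "A.conv (hmult B) (A.conv (hmult B) P Q) (\<lambda>x. Q (hantipode A x)) x =
      A.conv (hmult B) P (A.conv (hmult B) Q (\<lambda>x. Q (hantipode A x))) x"
    by (rule A.conv_assoc[OF T P Ql linear_on_compose[OF A.antipode_linear Ql] x])
  also have "\<dots> = A.conv (hmult B) P (\<lambda>x r. hcounit A x * hunit B r) x"
    by (rule A.conv_cong) (simp_all add: conv_hom_antipode[OF A B Q])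
  also have "\<dots> = P x" by (rule A.conv_unit_right[OF T P x])
  finally show ?thesis by simp
qed

lemma conv_cancel_left:
  assumes A: "hopf_alg A" and B: "hopf_alg B" and P: "linear_on (hbasis A) (hbasis B) P"
    and Q: "bialg_hom A B Q" and x: "x \<in> hspace A"
  shows "P x = hopf_alg.conv A (hmult B) (\<lambda>x. Q (hantipode A x)) (hopf_alg.conv A (hmult B) Q P) x"
proof -
  interpret A: hopf_alg A by fact
  interpret B: hopf_alg B by fact
  note T = B.alg.fd_algebra_axioms
  note Ql = bialg_hom_linear[OF Q]
  have "A.conv (hmult B) (\<lambda>x. Q (hantipode A x)) (A.conv (hmult B) Q P) x =
      A.conv (hmult B) (A.conv (hmult B) (\<lambda>x. Q (hantipode A x)) Q) P x"
    by (rule A.conv_assoc[OF T linear_on_compose[OF A.antipode_linear Ql] Ql P x, symmetric])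
  also have "\<dots> = A.conv (hmult B) (\<lambda>x r. hcounit A x * hunit B r) P x"
    by (rule A.conv_cong) (simp_all add: conv_hom_antipode[OF A B Q])
  also have "\<dots> = P x" by (rule A.conv_unit_left[OF T P x])
  finally show ?thesis by simp
qed

lemma bialg_hom_bij_inverse:
  assumes A: "hopf_alg A" and B: "hopf_alg B" and f: "bialg_hom A B f"
    and bij: "bij_betw f (hspace A) (hspace B)"
  obtains g where "bialg_hom B A g" "\<And>x. x \<in> hspace A \<Longrightarrow> g (f x) = x"
    "\<And>y. y \<in> hspace B \<Longrightarrow> f (g y) = y"
proof -
  let ?g = "the_inv_into (hspace A) f"
  have gf: "?g (f x) = x" if "x \<in> hspace A" for x
    using bij that by (simp add: bij_betw_def the_inv_into_f_f)
  have fg: "?g y \<in> hspace A \<and> f (?g y) = y" if "y \<in> hspace B" for y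
    using bij that by (auto simp: bij_betw_def f_the_inv_into_f intro: the_inv_into_into)
  from that[OF bialg_hom_inverse[OF A B f gf fg] gf] fg show thesis by blast
qed

lemma (in hopf_alg) surj_imp_bij:
  assumes f: "bialg_hom A A f" and surj: "hspace A \<subseteq> f ` hspace A"
  shows "bij_betw f (hspace A) (hspace A)"
  unfolding bij_betw_def
  using linear_surj_imp_inj[OF bialg_hom_linear[OF f] fin surj] surj bialg_hom_in[OF f] by auto

context double_prod
begin

text \<open>Precompose the identity \<open>id = \<iota>\<^sub>A \<pi>\<^sub>A * \<iota>\<^sub>B \<pi>\<^sub>B\<close> with \<open>f\<close>.\<close>

lemma comp_A:
  assumes f: "bialg_hom A D f" and x: "x \<in> hspace A"
  shows "f x = PA.D.conv (hmult D) (\<lambda>x. iA (pA (f x))) (\<lambda>x. iB (pB (f x))) x"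
  using conv_comp_right[OF hA hD PD.D.alg.fd_algebra_axioms f _ _ x,
      of "\<lambda>t. iA (pA t)" "\<lambda>t. iB (pB t)"] conv_id[OF bialg_hom_in[OF f x]]
    linear_on_compose[OF bialg_hom_linear[OF bialg_hom_pA] bialg_hom_linear[OF bialg_hom_iA]]
    linear_on_compose[OF bialg_hom_linear[OF bialg_hom_pB] bialg_hom_linear[OF bialg_hom_iB]] by simp

lemma comp_B:
  assumes f: "bialg_hom B D f" and x: "x \<in> hspace B"
  shows "f x = PB.D.conv (hmult D) (\<lambda>x. iA (pA (f x))) (\<lambda>x. iB (pB (f x))) x"
  using conv_comp_right[OF hB hD PD.D.alg.fd_algebra_axioms f _ _ x,
      of "\<lambda>t. iA (pA t)" "\<lambda>t. iB (pB t)"] conv_id[OF bialg_hom_in[OF f x]]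
    linear_on_compose[OF bialg_hom_linear[OF bialg_hom_pA] bialg_hom_linear[OF bialg_hom_iA]]
    linear_on_compose[OF bialg_hom_linear[OF bialg_hom_pB] bialg_hom_linear[OF bialg_hom_iB]] by simp

text \<open>Both sides are linear and a basis tensor is a product \<open>iA a\<close> times
  \<open>iB b\<close>, so multiplicativity of \<open>f\<close> reduces everything to the two
  columns. Their product takes matrix form once the inner factors, from the commuting copies of
  \<open>B\<close> and \<open>A\<close>, have been exchanged (\<open>jm\<close>).\<close>

lemma double_transport_eq_hopf_matrix:
  assumes f: "bialg_hom D D f"
    and \<alpha>: "linear_on (hbasis A) (hbasis A) \<alpha>" and \<beta>: "linear_on (hbasis B) (hbasis A) \<beta>"
    and \<gamma>: "linear_on (hbasis A) (hbasis B) \<gamma>" and \<delta>: "linear_on (hbasis B) (hbasis B) \<delta>"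
    and fA: "\<And>x. x \<in> hspace A \<Longrightarrow> f (iA x) = PA.D.conv (hmult D) (\<lambda>x. iA (\<alpha> x)) (\<lambda>x. iB (\<gamma> x)) x"
    and fB: "\<And>x. x \<in> hspace B \<Longrightarrow> f (iB x) = PB.D.conv (hmult D) (\<lambda>x. iA (\<beta> x)) (\<lambda>x. iB (\<delta> x)) x"
  shows "double_transport C H f = hopf_matrix A B \<alpha> \<beta> \<gamma> \<delta>"
proof -
  let ?I = "hbasis A" and ?J = "hbasis B" and ?K = "hbasis D"
  let ?un = "\<lambda>t ((x, y), (c, h)). t ((x, c), (y, h)) :: 'k"
  let ?L = "\<lambda>t. double_ident (f (?un t))"
  have E: "hbasis (hopf_tensor A B) = ?I \<times> ?J" by (simp add: hopf_tensor_def)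
  have unl: "linear_on (?I \<times> ?J) ?K ?un"
    by (rule linear_onI) (auto simp: fspace_def PA.sel(1) PB.sel(1) PD.sel(1) fun_eq_iff)
  have idl: "linear_on ?K (?I \<times> ?J) (double_ident :: _ \<Rightarrow> _ \<Rightarrow> 'k)"
    by (rule linear_onI) (auto simp: fspace_def PA.sel(1) PB.sel(1) PD.sel(1) fun_eq_iff double_ident_def)
  have Ll: "linear_on (?I \<times> ?J) (?I \<times> ?J) ?L"
    using linear_on_compose[OF linear_on_compose[OF unl bialg_hom_linear[OF f]] idl] .
  note inA = linear_on_in[OF \<alpha>] linear_on_in[OF \<beta>] and inB = linear_on_in[OF \<gamma>] linear_on_in[OF \<delta>]
  note inD = bialg_hom_in[OF bialg_hom_iA] bialg_hom_in[OF bialg_hom_iB] PD.D.alg.mult_in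
  let ?\<Phi> = "\<lambda>i j. lift ?I ?I (\<lambda>a b. lift ?J ?J (\<lambda>c d.
      tens (hmult A (\<alpha> a) (\<beta> c)) (hmult B (\<gamma> b) (\<delta> d))) (hcomult B j)) (hcomult A i)"
  have id_jn: "double_ident (jn a b) = tens a b" for a b
    by (auto simp: fun_eq_iff double_ident_def jn_def tens_def)
  have L: "?L (bvec (i, j)) = ?\<Phi> (bvec i) (bvec j)" if i: "i \<in> ?I" and j: "j \<in> ?J" for i j
  proof -
    have "?un (bvec (i, j)) = jn (bvec i) (bvec j)"
      by (auto simp: fun_eq_iff jn_def bvec_pair tens_def)
    then have "f (?un (bvec (i, j))) = hmult D (f (iA (bvec i))) (f (iB (bvec j)))"
      using i j by (simp add: iA_iB[symmetric] bialg_hom_mult[OF f] inD)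
    also have "\<dots> = hmult D (lift ?I ?I (\<lambda>a b. jn (\<alpha> a) (\<gamma> b)) (hcomult A (bvec i)))
        (lift ?J ?J (\<lambda>c d. jn (\<beta> c) (\<delta> d)) (hcomult B (bvec j)))"
      using i j by (simp add: fA fB PA.D.conv_def PB.D.conv_def iA_iB inA inB cong: lift_cong)
    finally have 1: "f (?un (bvec (i, j))) = \<dots>" .
    have jin: "jn a b \<in> hspace D" if "a \<in> hspace A" "b \<in> hspace B" for a b
      using that inD by (simp add: iA_iB[symmetric])
    have jm: "hmult D (jn a b) (jn c d) = jn (hmult A a c) (hmult B b d)"
      if h: "a \<in> hspace A" "c \<in> hspace A" "b \<in> hspace B" "d \<in> hspace B" for a b c d
    proof -
      have "hmult D (jn a b) (jn c d) = hmult D (iA a) (hmult D (hmult D (iB b) (iA c)) (iB d))"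
        using h by (simp add: iA_iB[symmetric] PD.D.alg.assoc inD)
      also have "\<dots> = hmult D (iA a) (hmult D (hmult D (iA c) (iB b)) (iB d))"
        using h by (simp add: iA_iB iB_iA)
      also have "\<dots> = hmult D (iA (hmult A a c)) (iB (hmult B b d))"
        using h by (simp add: PD.D.alg.assoc inD bialg_hom_mult[OF bialg_hom_iA] bialg_hom_mult[OF bialg_hom_iB])
      finally show ?thesis using h by (simp add: iA_iB PA.D.alg.mult_in PB.D.alg.mult_in)
    qed
    have lj: "lift ?J ?J (\<lambda>c d. jn (\<beta> c) (\<delta> d)) T \<in> hspace D" for T
      by (rule lift_in) (simp add: jin inA inB)
    have "f (?un (bvec (i, j))) = lift ?I ?I (\<lambda>a b. hmult D (jn (\<alpha> a) (\<gamma> b))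
        (lift ?J ?J (\<lambda>c d. jn (\<beta> c) (\<delta> d)) (hcomult B (bvec j)))) (hcomult A (bvec i))"
      unfolding 1
      by (rule linear_lift[OF bilinear_on_left[OF PD.D.alg.bil lj] PA.D.fin PA.D.fin])
        (simp add: jin inA inB)
    also have "\<dots> = lift ?I ?I (\<lambda>a b. lift ?J ?J (\<lambda>c d. hmult D (jn (\<alpha> a) (\<gamma> b)) (jn (\<beta> c) (\<delta> d)))
        (hcomult B (bvec j))) (hcomult A (bvec i))"
      by (rule lift_cong, rule linear_lift[OF bilinear_on_right[OF PD.D.alg.bil] PB.D.fin PB.D.fin])
        (simp_all add: jin inA inB)
    also have "\<dots> = lift ?I ?I (\<lambda>a b. lift ?J ?J (\<lambda>c d. jn (hmult A (\<alpha> a) (\<beta> c)) (hmult B (\<gamma> b) (\<delta> d)))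
        (hcomult B (bvec j))) (hcomult A (bvec i))"
      by (rule lift_cong, rule lift_cong) (simp add: jm inA inB)
    finally have "?L (bvec (i, j)) = double_ident \<dots>" by simp
    also have "\<dots> = ?\<Phi> (bvec i) (bvec j)"
      by (simp add: lift_def double_ident_def jn_def tens_def fun_eq_iff)
    finally show ?thesis .
  qed
  show ?thesis
    unfolding double_transport_def hopf_matrix_def A_def[symmetric] B_def[symmetric]
  proof (rule restrict_ext)
    fix t :: "('c \<times> 'c) \<times> ('h \<times> 'h) \<Rightarrow> 'k" assume "t \<in> hspace (hopf_tensor A B)"
    then have t: "t \<in> fspace (?I \<times> ?J)" by (simp add: E)
    show "?L t = (\<lambda>r. \<Sum>i\<in>?I. \<Sum>j\<in>?J. t (i, j) * (\<Sum>p\<in>?I. \<Sum>p'\<in>?I. \<Sum>q\<in>?J. \<Sum>q'\<in>?J.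
        hcomult A (bvec i) (p, p') * hcomult B (bvec j) (q, q') *
        tens (hmult A (\<alpha> (bvec p)) (\<beta> (bvec q))) (hmult B (\<gamma> (bvec p')) (\<delta> (bvec q'))) r))"
    proof
      fix r
      have "?L t r = (\<Sum>p\<in>?I \<times> ?J. t p * ?L (bvec p) r)"
        using linear_on_expand[OF Ll _ t] PA.D.fin PB.D.fin by simp
      also have "\<dots> = (\<Sum>i\<in>?I. \<Sum>j\<in>?J. t (i, j) * ?\<Phi> (bvec i) (bvec j) r)"
        unfolding sum.cartesian_product using L by (intro sum.cong) auto
      finally show "?L t r = (\<Sum>i\<in>?I. \<Sum>j\<in>?J. t (i, j) * (\<Sum>p\<in>?I. \<Sum>p'\<in>?I. \<Sum>q\<in>?J. \<Sum>q'\<in>?J.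
        hcomult A (bvec i) (p, p') * hcomult B (bvec j) (q, q') *
        tens (hmult A (\<alpha> (bvec p)) (\<beta> (bvec q))) (hmult B (\<gamma> (bvec p')) (\<delta> (bvec q'))) r))"
        by (simp add: lift_double_sum sum_distrib_left mult.assoc)
    qed
  qed
qed

end

section \<open>Abelian first factor: the entries of an automorphism\<close>

locale double_prod_abelian = double_prod C H A B D
  for C :: "('c, 'm) monoid_scheme" and H :: "('h, 'n) monoid_scheme"
    and A :: "('c \<times> 'c, 'k::field) hopf" and B :: "('h \<times> 'h, 'k) hopf"
    and D :: "(('c \<times> 'h) \<times> ('c \<times> 'h), 'k) hopf" +
  assumes abC: "comm_group C" and pnaH: "purely_nonabelian H"
begin

text \<open>For abelian \<open>C\<close> conjugation is trivial, and the substitution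
  \<open>g \<mapsto> g^-1 k\<close> exchanges the two factors in the sum.\<close>

lemma A_commutative:
  assumes "u \<in> hspace A" "v \<in> hspace A"
  shows "hmult A u v = hmult A v u"
proof (rule ext, clarify)
  interpret C: comm_group C by (rule abC)
  fix x k
  show "hmult A u v (x, k) = hmult A v u (x, k)"
  proof (cases "x \<in> carrier C \<and> k \<in> carrier C")
    case True
    then have x: "x \<in> carrier C" and k: "k \<in> carrier C" by auto
    have e: "inv\<^bsub>C\<^esub> g \<otimes>\<^bsub>C\<^esub> x \<otimes>\<^bsub>C\<^esub> g = x" if "g \<in> carrier C" for g
      using that x by (simp add: C.m_comm[of "inv\<^bsub>C\<^esub> g" x] PA.m_assoc)
    have i: "inv\<^bsub>C\<^esub> (inv\<^bsub>C\<^esub> g \<otimes>\<^bsub>C\<^esub> k) \<otimes>\<^bsub>C\<^esub> k = g" if "g \<in> carrier C" for g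
      using that k by (simp add: PA.inv_mult_group PA.m_assoc C.m_comm[of _ g])
    have "(\<Sum>g\<in>carrier C. u (x, g) * v (x, inv\<^bsub>C\<^esub> g \<otimes>\<^bsub>C\<^esub> k)) =
        (\<Sum>g\<in>carrier C. v (x, g) * u (x, inv\<^bsub>C\<^esub> g \<otimes>\<^bsub>C\<^esub> k))"
      by (rule sum.reindex_bij_witness[where i = "\<lambda>g. inv\<^bsub>C\<^esub> g \<otimes>\<^bsub>C\<^esub> k" and j = "\<lambda>g. inv\<^bsub>C\<^esub> g \<otimes>\<^bsub>C\<^esub> k"])
        (use k in \<open>auto simp: i\<close>)
    then show ?thesis using x k by (simp add: PA.sel e)
  qed (auto simp: PA.sel)
qed

lemma A_cocommutative: "hcomult A u (i, j) = hcomult A u (j, i)"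
proof -
  interpret C: comm_group C by (rule abC)
  show ?thesis by (cases i; cases j) (auto simp: PA.sel C.m_comm)
qed

lemma A_cocommuting: "cocommuting A F G"
proof -
  have e: "(\<lambda>(i, j). hcomult A x (j, i)) = hcomult A x" for x
    using A_cocommutative by (auto simp: fun_eq_iff)
  show ?thesis
    unfolding cocommuting_def
    using lift_flip[of "hbasis A" "hbasis A" "\<lambda>a b. tens (F a) (G b)", of "hcomult A x" for x]
    by (simp add: e)
qed

text \<open>Expand \<open>g \<circ> iB\<close> and \<open>g \<circ> iA\<close> along
  \<open>id = iA pA * iB pB\<close> and apply \<open>pB \<circ> f\<close> or
  \<open>pA \<circ> f\<close>: these are the diagonal entries of the matrix product of
  \<open>f\<close> and \<open>g\<close>.\<close>

lemma inverse_components: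
  assumes f: "bialg_hom D D f" and g: "bialg_hom D D g" and fg: "\<And>x. x \<in> hspace D \<Longrightarrow> f (g x) = x"
  shows "PB.central_hom (\<lambda>x. pB (f (iA (pA (g (iB x))))))"
    and "x \<in> hspace B \<Longrightarrow> PB.D.conv (hmult B) (\<lambda>x. pB (f (iA (pA (g (iB x))))))
      (\<lambda>x. pB (f (iB (pB (g (iB x)))))) x = x"
    and "y \<in> hspace A \<Longrightarrow> PA.D.conv (hmult A) (\<lambda>x. pA (f (iB (pB (g (iA x))))))
      (\<lambda>x. pA (f (iA (pA (g (iA x)))))) y = y"
proof -
  define \<alpha> \<beta> \<gamma> \<delta> where "\<alpha> = (\<lambda>x. pA (f (iA x)))" and "\<beta> = (\<lambda>x. pA (f (iB x)))"
    and "\<gamma> = (\<lambda>x. pB (f (iA x)))" and "\<delta> = (\<lambda>x. pB (f (iB x)))"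
  define \<alpha>' \<beta>' \<gamma>' \<delta>' where "\<alpha>' = (\<lambda>x. pA (g (iA x)))" and "\<beta>' = (\<lambda>x. pA (g (iB x)))"
    and "\<gamma>' = (\<lambda>x. pB (g (iA x)))" and "\<delta>' = (\<lambda>x. pB (g (iB x)))"
  note cAD = bialg_hom_compose[OF hA hD] and cBD = bialg_hom_compose[OF hB hD]
  note cBA = bialg_hom_compose[OF hB hA]
  have fA: "bialg_hom A D (\<lambda>x. f (iA x))" and fB: "bialg_hom B D (\<lambda>x. f (iB x))"
    and gA: "bialg_hom A D (\<lambda>x. g (iA x))" and gB: "bialg_hom B D (\<lambda>x. g (iB x))"
    using cAD[OF bialg_hom_iA f] cBD[OF bialg_hom_iB f] cAD[OF bialg_hom_iA g] cBD[OF bialg_hom_iB g] .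
  have h: "bialg_hom A A \<alpha>" "bialg_hom B A \<beta>" "bialg_hom A B \<gamma>" "bialg_hom B B \<delta>"
    unfolding \<alpha>_def \<beta>_def \<gamma>_def \<delta>_def using cAD[OF fA bialg_hom_pA] cBD[OF fB bialg_hom_pA] cAD[OF fA bialg_hom_pB] cBD[OF fB bialg_hom_pB] .
  have h': "bialg_hom A A \<alpha>'" "bialg_hom B A \<beta>'" "bialg_hom A B \<gamma>'" "bialg_hom B B \<delta>'"
    unfolding \<alpha>'_def \<beta>'_def \<gamma>'_def \<delta>'_def using cAD[OF gA bialg_hom_pA] cBD[OF gB bialg_hom_pA] cAD[OF gA bialg_hom_pB] cBD[OF gB bialg_hom_pB] .
  note l = bialg_hom_linear
  have idB: "PB.D.conv (hmult B) (\<lambda>x. \<gamma> (\<beta>' x)) (\<lambda>x. \<delta> (\<delta>' x)) x = x" if x: "x \<in> hspace B" for x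
  proof -
    have "x = pB (f (g (iB x)))" using fg bialg_hom_in[OF bialg_hom_iB x] pB_iB[OF x] by simp
    also have "g (iB x) = PB.D.conv (hmult D) (\<lambda>x. iA (\<beta>' x)) (\<lambda>x. iB (\<delta>' x)) x"
      unfolding \<beta>'_def \<delta>'_def by (rule comp_B[OF gB x])
    also have "pB (f \<dots>) = PB.D.conv (hmult B) (\<lambda>x. \<gamma> (\<beta>' x)) (\<lambda>x. \<delta> (\<delta>' x)) x"
      unfolding \<gamma>_def \<delta>_def
      by (rule conv_comp_hom[OF hB hD hB bialg_hom_compose[OF hD hD f bialg_hom_pB]
            linear_on_compose[OF l[OF h'(2)] l[OF bialg_hom_iA]] linear_on_compose[OF l[OF h'(4)] l[OF bialg_hom_iB]]])
    finally show ?thesis by (rule sym)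
  qed
  then show "x \<in> hspace B \<Longrightarrow> PB.D.conv (hmult B) (\<lambda>x. pB (f (iA (pA (g (iB x))))))
      (\<lambda>x. pB (f (iB (pB (g (iB x)))))) x = x"
    by (simp add: \<gamma>_def \<beta>'_def \<delta>_def \<delta>'_def)
  have "PA.D.conv (hmult A) (\<lambda>x. \<alpha> (\<alpha>' x)) (\<lambda>x. \<beta> (\<gamma>' x)) y = y" if y: "y \<in> hspace A" for y
  proof -
    have "y = pA (f (g (iA y)))" using fg bialg_hom_in[OF bialg_hom_iA y] pA_iA[OF y] by simp
    also have "g (iA y) = PA.D.conv (hmult D) (\<lambda>x. iA (\<alpha>' x)) (\<lambda>x. iB (\<gamma>' x)) y"
      unfolding \<alpha>'_def \<gamma>'_def by (rule comp_A[OF gA y])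
    also have "pA (f \<dots>) = PA.D.conv (hmult A) (\<lambda>x. \<alpha> (\<alpha>' x)) (\<lambda>x. \<beta> (\<gamma>' x)) y"
      unfolding \<alpha>_def \<beta>_def
      by (rule conv_comp_hom[OF hA hD hA bialg_hom_compose[OF hD hD f bialg_hom_pA]
            linear_on_compose[OF l[OF h'(1)] l[OF bialg_hom_iA]] linear_on_compose[OF l[OF h'(3)] l[OF bialg_hom_iB]]])
    finally show ?thesis by (rule sym)
  qed
  \<comment> \<open>Reversal puts \<open>\<beta>\<gamma>'\<close>, the factor that will turn out
    nilpotent, into the first slot expected by \<open>nilpotent_complement\<close>. It is legitimate
    as \<open>A\<close> is commutative and cocommutative.\<close>
  moreover have "PA.D.conv (hmult A) (\<lambda>x. \<beta> (\<gamma>' x)) (\<lambda>x. \<alpha> (\<alpha>' x)) y =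
      PA.D.conv (hmult A) (\<lambda>x. \<alpha> (\<alpha>' x)) (\<lambda>x. \<beta> (\<gamma>' x)) y" for y
  proof -
    have "(\<lambda>(i, j). hcomult A y (j, i)) = hcomult A y"
      using A_cocommutative by (auto simp: fun_eq_iff)
    then have "PA.D.conv (hmult A) (\<lambda>x. \<beta> (\<gamma>' x)) (\<lambda>x. \<alpha> (\<alpha>' x)) y =
        lift (hbasis A) (hbasis A) (\<lambda>a b. hmult A (\<beta> (\<gamma>' b)) (\<alpha> (\<alpha>' a))) (hcomult A y)"
      using lift_flip[of "hbasis A" "hbasis A" "\<lambda>a b. hmult A (\<beta> (\<gamma>' a)) (\<alpha> (\<alpha>' b))" "hcomult A y"]
      by (simp add: PA.D.conv_def)
    also have "\<dots> = PA.D.conv (hmult A) (\<lambda>x. \<alpha> (\<alpha>' x)) (\<lambda>x. \<beta> (\<gamma>' x)) y"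
      unfolding PA.D.conv_def
      by (rule lift_cong, rule A_commutative)
        (simp_all add: bialg_hom_in[OF h(1)] bialg_hom_in[OF h(2)] bialg_hom_in[OF h'(1)] bialg_hom_in[OF h'(3)])
    finally show ?thesis .
  qed
  ultimately show "y \<in> hspace A \<Longrightarrow> PA.D.conv (hmult A) (\<lambda>x. pA (f (iB (pB (g (iA x))))))
      (\<lambda>x. pA (f (iA (pA (g (iA x)))))) y = y"
    by (simp add: \<alpha>_def \<alpha>'_def \<beta>_def \<gamma>'_def)
  \<comment> \<open>The element commutes with the image of \<open>\<gamma>\<close> because
    \<open>A\<close> is commutative, and with the image of \<open>\<delta>\<close> because
    \<open>iA\<close> and \<open>iB\<close> have commuting images. By \<open>idB\<close> every
    \<open>y\<close> is built from such values.\<close>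
  have "hmult B (\<gamma> (\<beta>' x)) y = hmult B y (\<gamma> (\<beta>' x))" if x: "x \<in> hspace B" and y: "y \<in> hspace B" for x y
  proof -
    let ?z = "\<gamma> (\<beta>' x)"
    let ?M = "{w \<in> hspace B. hmult B ?z w = hmult B w ?z}"
    note bx = bialg_hom_in[OF h'(2) x]
    have z: "?z \<in> hspace B" by (rule bialg_hom_in[OF h(3) bx])
    have 1: "\<gamma> a \<in> ?M" if "a \<in> hspace A" for a
      using that bx A_commutative[OF bx that] bialg_hom_in[OF h(3)]
      by (simp add: bialg_hom_mult[OF h(3), symmetric])
    have 2: "\<delta> b \<in> ?M" if b: "b \<in> hspace B" for b
    proof -
      have "pB (f (hmult D (iA (\<beta>' x)) (iB b))) = pB (f (hmult D (iB b) (iA (\<beta>' x))))"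
        using iA_iB_commute[OF bx b] by simp
      then have "hmult B (\<gamma> (\<beta>' x)) (\<delta> b) = hmult B (\<delta> b) (\<gamma> (\<beta>' x))"
        using bx b by (simp add: \<gamma>_def \<delta>_def bialg_hom_mult[OF f] bialg_hom_mult[OF bialg_hom_pB]
            bialg_hom_in[OF bialg_hom_iA] bialg_hom_in[OF bialg_hom_iB] bialg_hom_in[OF f])
      then show ?thesis using bialg_hom_in[OF h(4) b] by simp
    qed
    have "PB.D.conv (hmult B) (\<lambda>x. \<gamma> (\<beta>' x)) (\<lambda>x. \<delta> (\<delta>' x)) y \<in> ?M"
      by (rule conv_in_subalg[OF hB PB.D.subalg_commutant[OF z]])
        (intro 1 2 bialg_hom_in[OF h'(2)] bialg_hom_in[OF h'(4)]; assumption)+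
    then show ?thesis using idB[OF y] by simp
  qed
  then show "PB.central_hom (\<lambda>x. pB (f (iA (pA (g (iB x))))))"
    using cBA[OF h'(2) h(3)] by (simp add: PB.central_hom_def \<gamma>_def \<beta>'_def)
qed

lemma components_bij:
  assumes f: "bialg_hom D D f" and g: "bialg_hom D D g"
    and fg: "\<And>x. x \<in> hspace D \<Longrightarrow> f (g x) = x" and gf: "\<And>x. x \<in> hspace D \<Longrightarrow> g (f x) = x"
  shows "bij_betw (\<lambda>x. pA (f (iA x))) (hspace A) (hspace A)"
    and "bij_betw (\<lambda>x. pB (f (iB x))) (hspace B) (hspace B)"
proof -
  note l = bialg_hom_linear
  note cD = bialg_hom_compose[OF hA hD] bialg_hom_compose[OF hB hD]
  have fA: "bialg_hom A D (\<lambda>x. f (iA x))" and fB: "bialg_hom B D (\<lambda>x. f (iB x))"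
    and gA: "bialg_hom A D (\<lambda>x. g (iA x))" and gB: "bialg_hom B D (\<lambda>x. g (iB x))"
    using cD(1)[OF bialg_hom_iA f] cD(2)[OF bialg_hom_iB f] cD(1)[OF bialg_hom_iA g] cD(2)[OF bialg_hom_iB g] .
  have \<alpha>: "bialg_hom A A (\<lambda>x. pA (f (iA x)))" and \<beta>: "bialg_hom B A (\<lambda>x. pA (f (iB x)))"
    and \<delta>: "bialg_hom B B (\<lambda>x. pB (f (iB x)))"
    using cD(1)[OF fA bialg_hom_pA] cD(2)[OF fB bialg_hom_pA] cD(2)[OF fB bialg_hom_pB] .
  have \<alpha>': "bialg_hom A A (\<lambda>x. pA (g (iA x)))" and \<gamma>': "bialg_hom A B (\<lambda>x. pB (g (iA x)))"
    and \<delta>': "bialg_hom B B (\<lambda>x. pB (g (iB x)))"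
    using cD(1)[OF gA bialg_hom_pA] cD(1)[OF gA bialg_hom_pB] cD(2)[OF gB bialg_hom_pB] .
  have c1: "PB.central_hom (\<lambda>x. pB (f (iA (pA (g (iB x))))))" by (rule inverse_components(1)[OF f g fg])
  obtain n where n: "\<forall>t\<in>hspace B. ((\<lambda>x. pB (f (iA (pA (g (iB x)))))) ^^ n) t = (\<lambda>p. hcounit B t * hunit B p)"
    using PB.central_hom_nilpotent[OF pnaH c1] by blast
  have "hspace B \<subseteq> (\<lambda>x. pB (f (iB x))) ` hspace B"
  proof (rule PB.D.nilpotent_complement[OF subalg_image[OF hB \<delta>] _ _ _ inverse_components(2)[OF f g fg]])
    show "bialg_hom B B (\<lambda>x. pB (f (iA (pA (g (iB x))))))" using c1 by (simp add: PB.central_hom_def)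
    show "linear_on PB.D.I PB.D.I (\<lambda>x. pB (f (iB (pB (g (iB x))))))"
      using linear_on_compose[OF l[OF \<delta>'] l[OF \<delta>]] .
    show "pB (f (iB (pB (g (iB x))))) \<in> (\<lambda>x. pB (f (iB x))) ` hspace B" if "x \<in> hspace B" for x
      using bialg_hom_in[OF \<delta>' that] by (rule imageI)
    show "((\<lambda>x. pB (f (iA (pA (g (iB x)))))) ^^ n) x = (\<lambda>p. hcounit B x * hunit B p)"
      if "x \<in> hspace B" for x using n that by blast
  qed
  then show "bij_betw (\<lambda>x. pB (f (iB x))) (hspace B) (hspace B)" by (rule PB.D.surj_imp_bij[OF \<delta>])
  \<comment> \<open>For \<open>A\<close> nilpotency is borrowed from \<open>B\<close>:
    \<open>?\<phi> = \<beta>\<gamma>'\<close> has powers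
    \<open>\<beta> ?\<theta>^k \<gamma>'\<close> with \<open>?\<theta> = \<gamma>'\<beta>\<close>,
    and exchanging the roles of \<open>f\<close> and \<open>g\<close> shows that
    \<open>?\<theta>\<close> is central. The outer \<open>\<beta>\<close>, \<open>\<gamma>'\<close>
    account for the exponent \<open>Suc m\<close>.\<close>
  let ?\<theta> = "\<lambda>x. pB (g (iA (pA (f (iB x)))))"
  have c2: "PB.central_hom ?\<theta>" by (rule inverse_components(1)[OF g f gf])
  obtain m where m: "\<forall>t\<in>hspace B. (?\<theta> ^^ m) t = (\<lambda>p. hcounit B t * hunit B p)"
    using PB.central_hom_nilpotent[OF pnaH c2] by blast
  let ?\<phi> = "\<lambda>x. pA (f (iB (pB (g (iA x)))))"
  have pow: "(?\<phi> ^^ Suc k) x = pA (f (iB ((?\<theta> ^^ k) (pB (g (iA x))))))" for k x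
    by (induction k) simp_all
  have "hspace A \<subseteq> (\<lambda>x. pA (f (iA x))) ` hspace A"
  proof (rule PA.D.nilpotent_complement[OF subalg_image[OF hA \<alpha>] _ _ _ inverse_components(3)[OF f g fg]])
    show "bialg_hom A A ?\<phi>" using bialg_hom_compose[OF hA hB \<gamma>' \<beta>] .
    show "linear_on PA.D.I PA.D.I (\<lambda>x. pA (f (iA (pA (g (iA x))))))"
      using linear_on_compose[OF l[OF \<alpha>'] l[OF \<alpha>]] .
    show "pA (f (iA (pA (g (iA x))))) \<in> (\<lambda>x. pA (f (iA x))) ` hspace A" if "x \<in> hspace A" for x
      using bialg_hom_in[OF \<alpha>' that] by (rule imageI)
    show "(?\<phi> ^^ Suc m) x = (\<lambda>p. hcounit A x * hunit A p)" if x: "x \<in> hspace A" for x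
    proof -
      note y = bialg_hom_in[OF \<gamma>' x]
      have "(?\<phi> ^^ Suc m) x = pA (f (iB (\<lambda>p. hcounit B (pB (g (iA x))) * hunit B p)))"
        unfolding pow using m y by simp
      also have "\<dots> = (\<lambda>p. hcounit A x * hunit A p)"
        using linear_on_scale[OF l[OF \<beta>] PB.D.alg.unit_in] bialg_hom_unit[OF \<beta>] bialg_hom_counit[OF \<gamma>' x]
        by simp
      finally show ?thesis .
    qed
  qed
  then show "bij_betw (\<lambda>x. pA (f (iA x))) (hspace A) (hspace A)" by (rule PA.D.surj_imp_bij[OF \<alpha>])
qed

section \<open>Matrices with the stated entries are automorphisms\<close>

context
  fixes \<alpha> \<beta> \<gamma> \<delta>
  assumes \<alpha>: "bialg_hom A A \<alpha>" and \<alpha>_bij: "bij_betw \<alpha> (hspace A) (hspace A)"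
    and \<beta>: "bialg_hom B A \<beta>" and \<beta>c: "cocommuting B \<beta> (\<lambda>x. x)"
    and \<gamma>: "bialg_hom A B \<gamma>"
    and \<gamma>c: "\<And>x y. x \<in> hspace A \<Longrightarrow> y \<in> hspace B \<Longrightarrow> hmult B (\<gamma> x) y = hmult B y (\<gamma> x)"
    and \<delta>: "bialg_hom B B \<delta>" and \<delta>_bij: "bij_betw \<delta> (hspace B) (hspace B)"
begin

text \<open>\<open>F1\<close> and \<open>F2\<close> are the columns of the matrix as maps from
  \<open>A\<close> and \<open>B\<close> to \<open>D\<close>; \<open>mat\<close> glues them along the
  projections.\<close>

abbreviation "F1 \<equiv> PA.D.conv (hmult D) (\<lambda>x. iA (\<alpha> x)) (\<lambda>x. iB (\<gamma> x))"
abbreviation "F2 \<equiv> PB.D.conv (hmult D) (\<lambda>x. iA (\<beta> x)) (\<lambda>x. iB (\<delta> x))"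
abbreviation "mat \<equiv> PD.D.conv (hmult D) (\<lambda>t. F1 (pA t)) (\<lambda>t. F2 (pB t))"

lemmas a1 = bialg_hom_compose[OF hA hA \<alpha> bialg_hom_iA] and b1 = bialg_hom_compose[OF hB hA \<beta> bialg_hom_iA]
lemmas g1 = bialg_hom_compose[OF hA hB \<gamma> bialg_hom_iB] and d1 = bialg_hom_compose[OF hB hB \<delta> bialg_hom_iB]

lemma bialg_hom_F1: "bialg_hom A D F1"
  by (rule bialg_hom_conv[OF hA hD a1 g1 _ A_cocommuting])
    (simp add: iA_iB_commute bialg_hom_in[OF \<alpha>] bialg_hom_in[OF \<gamma>])

lemma bialg_hom_F2: "bialg_hom B D F2"
proof (rule bialg_hom_conv[OF hB hD b1 d1])
  show "hmult D (iA (\<beta> x)) (iB (\<delta> y)) = hmult D (iB (\<delta> y)) (iA (\<beta> x))"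
    if "x \<in> hspace B" "y \<in> hspace B" for x y
    using that by (simp add: iA_iB_commute bialg_hom_in[OF \<beta>] bialg_hom_in[OF \<delta>])
  show "cocommuting B (\<lambda>x. iA (\<beta> x)) (\<lambda>x. iB (\<delta> x))"
    by (rule cocommuting_compose_left[OF hB \<beta>c PA.D.fin PB.D.fin bialg_hom_linear[OF \<beta>] linear_on_id
          bialg_hom_linear[OF bialg_hom_iA] bialg_hom_linear[OF d1]])
qed

text \<open>Four pairs of entries are checked: \<open>\<alpha>\<close> with \<open>\<beta>\<close>
  by commutativity of \<open>A\<close>, \<open>\<gamma>\<close> with \<open>\<delta>\<close> by
  centrality of \<open>\<gamma>\<close>, and the two mixed pairs because \<open>iA\<close> and
  \<open>iB\<close> have commuting images.\<close>

lemma F1_F2_commute: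
  assumes x: "x \<in> hspace A" and y: "y \<in> hspace B"
  shows "hmult D (F1 x) (F2 y) = hmult D (F2 y) (F1 x)"
proof -
  let ?M = "\<lambda>z. {w \<in> hspace D. hmult D z w = hmult D w z}"
  note i = bialg_hom_in[OF \<alpha>] bialg_hom_in[OF \<beta>] bialg_hom_in[OF \<gamma>] bialg_hom_in[OF \<delta>]
    bialg_hom_in[OF bialg_hom_iA] bialg_hom_in[OF bialg_hom_iB]
  have 1: "F2 y \<in> ?M (iA (\<alpha> a))" if a: "a \<in> hspace A" for a
  proof (rule conv_in_subalg[OF hB PD.D.subalg_commutant])
    show "iA (\<alpha> a) \<in> hspace D" using a i by simp
    fix b assume b: "b \<in> hspace B"
    have "hmult D (iA (\<alpha> a)) (iA (\<beta> b)) = hmult D (iA (\<beta> b)) (iA (\<alpha> a))"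
      using a b i A_commutative[of "\<alpha> a" "\<beta> b"] by (simp flip: bialg_hom_mult[OF bialg_hom_iA])
    then show "iA (\<beta> b) \<in> ?M (iA (\<alpha> a))" using a b i by simp
    show "iB (\<delta> b) \<in> ?M (iA (\<alpha> a))" using a b i by (simp add: iA_iB_commute)
  qed
  have 2: "F2 y \<in> ?M (iB (\<gamma> a))" if a: "a \<in> hspace A" for a
  proof (rule conv_in_subalg[OF hB PD.D.subalg_commutant])
    show "iB (\<gamma> a) \<in> hspace D" using a i by simp
    fix b assume b: "b \<in> hspace B"
    have "hmult D (iB (\<gamma> a)) (iB (\<delta> b)) = hmult D (iB (\<delta> b)) (iB (\<gamma> a))"
      using a b i \<gamma>c[of a "\<delta> b"] by (simp flip: bialg_hom_mult[OF bialg_hom_iB])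
    then show "iB (\<delta> b) \<in> ?M (iB (\<gamma> a))" using a b i by simp
    show "iA (\<beta> b) \<in> ?M (iB (\<gamma> a))" using a b i by (simp add: iA_iB_commute)
  qed
  have "F1 x \<in> ?M (F2 y)"
    by (rule conv_in_subalg[OF hA PD.D.subalg_commutant[OF bialg_hom_in[OF bialg_hom_F2 y]]])
      (use 1 2 i in auto)
  then show ?thesis by simp
qed

lemma bialg_hom_mat: "bialg_hom D D mat"
proof (rule bialg_hom_conv[OF hD hD])
  show "bialg_hom D D (\<lambda>t. F1 (pA t))" by (rule bialg_hom_compose[OF hD hA bialg_hom_pA bialg_hom_F1])
  show "bialg_hom D D (\<lambda>t. F2 (pB t))" by (rule bialg_hom_compose[OF hD hB bialg_hom_pB bialg_hom_F2])
  show "hmult D (F1 (pA x)) (F2 (pB y)) = hmult D (F2 (pB y)) (F1 (pA x))"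
    if "x \<in> hspace D" "y \<in> hspace D" for x y
    by (rule F1_F2_commute[OF bialg_hom_in[OF bialg_hom_pA that(1)] bialg_hom_in[OF bialg_hom_pB that(2)]])
  show "cocommuting D (\<lambda>t. F1 (pA t)) (\<lambda>t. F2 (pB t))"
    by (rule cocommuting_compose_left[OF hD pA_pB_cocommuting PA.D.fin PB.D.fin bialg_hom_linear[OF bialg_hom_pA]
          bialg_hom_linear[OF bialg_hom_pB] bialg_hom_linear[OF bialg_hom_F1] bialg_hom_linear[OF bialg_hom_F2]])
qed

text \<open>\<open>pB \<circ> iA\<close> is trivial, so the second column contributes only the unit
  of convolution.\<close>

lemma mat_iA:
  assumes x: "x \<in> hspace A"
  shows "mat (iA x) = F1 x"
proof -
  note T = PD.D.alg.fd_algebra_axioms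
  note l1 = bialg_hom_linear[OF bialg_hom_F1] and l2 = bialg_hom_linear[OF bialg_hom_F2]
  have e: "F2 (pB (iA y)) = (\<lambda>r. hcounit A y * hunit D r)" if "y \<in> hspace A" for y
    using linear_on_scale[OF l2 PB.D.alg.unit_in] bialg_hom_unit[OF bialg_hom_F2] by (simp add: pB_iA)
  have "mat (iA x) = PA.D.conv (hmult D) (\<lambda>x. F1 (pA (iA x))) (\<lambda>x. F2 (pB (iA x))) x"
    by (rule conv_comp_right[OF hA hD T bialg_hom_iA linear_on_compose[OF bialg_hom_linear[OF bialg_hom_pA] l1]
          linear_on_compose[OF bialg_hom_linear[OF bialg_hom_pB] l2] x])
  also have "\<dots> = PA.D.conv (hmult D) F1 (\<lambda>x r. hcounit A x * hunit D r) x"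
    by (rule PA.D.conv_cong) (simp_all add: pA_iA e)
  also have "\<dots> = F1 x" by (rule PA.D.conv_unit_right[OF T l1 x])
  finally show ?thesis .
qed

lemma mat_iB:
  assumes x: "x \<in> hspace B"
  shows "mat (iB x) = F2 x"
proof -
  note T = PD.D.alg.fd_algebra_axioms
  note l1 = bialg_hom_linear[OF bialg_hom_F1] and l2 = bialg_hom_linear[OF bialg_hom_F2]
  have e: "F1 (pA (iB y)) = (\<lambda>r. hcounit B y * hunit D r)" if "y \<in> hspace B" for y
    using linear_on_scale[OF l1 PA.D.alg.unit_in] bialg_hom_unit[OF bialg_hom_F1] by (simp add: pA_iB)
  have "mat (iB x) = PB.D.conv (hmult D) (\<lambda>x. F1 (pA (iB x))) (\<lambda>x. F2 (pB (iB x))) x"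
    by (rule conv_comp_right[OF hB hD T bialg_hom_iB linear_on_compose[OF bialg_hom_linear[OF bialg_hom_pA] l1]
          linear_on_compose[OF bialg_hom_linear[OF bialg_hom_pB] l2] x])
  also have "\<dots> = PB.D.conv (hmult D) (\<lambda>x r. hcounit B x * hunit D r) F2 x"
    by (rule PB.D.conv_cong) (simp_all add: pB_iB e)
  also have "\<dots> = F2 x" by (rule PB.D.conv_unit_left[OF T l2 x])
  finally show ?thesis .
qed

text \<open>Gaussian elimination inside the image \<open>?M\<close>. The columns give
  \<open>F1 \<circ> \<kappa> = iA \<beta>\<delta>^-1 * iB \<theta>\<close> and
  \<open>F2 \<circ> \<delta>^-1 = iA \<beta>\<delta>^-1 * iB\<close>. Precomposed with
  \<open>\<theta>^k\<close>, the first identity passes from \<open>iB \<theta>^(k+1)\<close> to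
  \<open>iA \<beta>\<delta>^-1 \<theta>^k\<close>, the second from there to
  \<open>iB \<theta>^k\<close>; nilpotency of \<open>\<theta>\<close> starts the descent.\<close>

lemma mat_bij: "bij_betw mat (hspace D) (hspace D)"
proof -
  obtain ai where ai: "bialg_hom A A ai" "\<And>x. x \<in> hspace A \<Longrightarrow> ai (\<alpha> x) = x"
    "\<And>y. y \<in> hspace A \<Longrightarrow> \<alpha> (ai y) = y"
    using bialg_hom_bij_inverse[OF hA hA \<alpha> \<alpha>_bij] by blast
  obtain di where di: "bialg_hom B B di" "\<And>x. x \<in> hspace B \<Longrightarrow> di (\<delta> x) = x"
    "\<And>y. y \<in> hspace B \<Longrightarrow> \<delta> (di y) = y"
    using bialg_hom_bij_inverse[OF hB hB \<delta> \<delta>_bij] by blast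
  note T = PD.D.alg.fd_algebra_axioms and l = bialg_hom_linear
  \<comment> \<open>Chosen so that \<open>\<alpha>\<kappa> = \<beta>\<delta>^-1\<close>: the two
    columns then share their \<open>A\<close>-component.\<close>
  let ?\<kappa> = "\<lambda>x. ai (\<beta> (di x))"
  let ?\<theta> = "\<lambda>x. \<gamma> (?\<kappa> x)"
  have \<beta>d: "bialg_hom B A (\<lambda>x. \<beta> (di x))" by (rule bialg_hom_compose[OF hB hB di(1) \<beta>])
  have \<kappa>: "bialg_hom B A ?\<kappa>" by (rule bialg_hom_compose[OF hB hA \<beta>d ai(1)])
  have \<theta>: "bialg_hom B B ?\<theta>" by (rule bialg_hom_compose[OF hB hA \<kappa> \<gamma>])
  have "PB.central_hom ?\<theta>"
    using \<theta> \<gamma>c bialg_hom_in[OF \<kappa>] by (simp add: PB.central_hom_def)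
  then obtain n where n: "\<forall>t\<in>hspace B. (?\<theta> ^^ n) t = (\<lambda>p. hcounit B t * hunit B p)"
    using PB.central_hom_nilpotent[OF pnaH] by blast
  let ?M = "mat ` hspace D"
  have M: "subalg D ?M" by (rule subalg_image[OF hD bialg_hom_mat])
  have F1M: "F1 x \<in> ?M" if "x \<in> hspace A" for x
    using mat_iA[OF that, symmetric] bialg_hom_in[OF bialg_hom_iA that] by (rule image_eqI)
  have F2M: "F2 x \<in> ?M" if "x \<in> hspace B" for x
    using mat_iB[OF that, symmetric] bialg_hom_in[OF bialg_hom_iB that] by (rule image_eqI)
  have \<theta>k: "bialg_hom B B (?\<theta> ^^ k)" for k by (rule PB.bialg_hom_funpow[OF \<theta>])
  have "(\<forall>x\<in>hspace B. iB ((?\<theta> ^^ k) x) \<in> ?M) \<Longrightarrow> \<forall>x\<in>hspace B. iB x \<in> ?M" for k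
  proof (induction k)
    case (Suc k)
    let ?t = "?\<theta> ^^ k"
    have tk: "?t x \<in> hspace B" if "x \<in> hspace B" for x by (rule bialg_hom_in[OF \<theta>k that])
    have P: "bialg_hom B D (\<lambda>x. iA (\<beta> (di (?t x))))"
      by (rule bialg_hom_compose[OF hB hA bialg_hom_compose[OF hB hB \<theta>k \<beta>d] bialg_hom_iA])
    have Q: "bialg_hom B D (\<lambda>x. iB (?\<theta> (?t x)))"
      by (rule bialg_hom_compose[OF hB hB bialg_hom_compose[OF hB hB \<theta>k \<theta>] bialg_hom_iB])
    have R: "bialg_hom B D (\<lambda>x. iB (?t x))" by (rule bialg_hom_compose[OF hB hB \<theta>k bialg_hom_iB])
    have PM: "iA (\<beta> (di (?t x))) \<in> ?M" if x: "x \<in> hspace B" for x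
    proof -
      have c: "PB.D.conv (hmult D) (\<lambda>x. iA (\<beta> (di (?t x)))) (\<lambda>x. iB (?\<theta> (?t x))) y = F1 (?\<kappa> (?t y))"
        if y: "y \<in> hspace B" for y
      proof -
        have "F1 (?\<kappa> (?t y)) =
            PB.D.conv (hmult D) (\<lambda>x. iA (\<alpha> (?\<kappa> (?t x)))) (\<lambda>x. iB (?\<theta> (?t x))) y"
          by (rule conv_comp_right[OF hB hA T bialg_hom_compose[OF hB hB \<theta>k \<kappa>] l[OF a1] l[OF g1] y])
        also have "\<dots> = PB.D.conv (hmult D) (\<lambda>x. iA (\<beta> (di (?t x)))) (\<lambda>x. iB (?\<theta> (?t x))) y"
          by (rule PB.D.conv_cong) (simp_all add: ai(3) bialg_hom_in[OF \<beta>d] tk)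
        finally show ?thesis by simp
      qed
      show ?thesis
      proof (subst conv_cancel_right[OF hB hD l[OF P] Q x], rule conv_in_subalg[OF hB M])
        fix y assume y: "y \<in> hspace B"
        show "PB.D.conv (hmult D) (\<lambda>x. iA (\<beta> (di (?t x)))) (\<lambda>x. iB (?\<theta> (?t x))) y \<in> ?M"
          unfolding c[OF y] by (rule F1M[OF bialg_hom_in[OF \<kappa> tk[OF y]]])
        show "iB (?\<theta> (?t (hantipode B y))) \<in> ?M"
          using Suc.prems linear_on_in[OF PB.D.antipode_linear y] by simp
      qed
    qed
    have "iB (?t x) \<in> ?M" if x: "x \<in> hspace B" for x
    proof -
      have c: "PB.D.conv (hmult D) (\<lambda>x. iA (\<beta> (di (?t x)))) (\<lambda>x. iB (?t x)) y = F2 (di (?t y))"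
        if y: "y \<in> hspace B" for y
      proof -
        have "F2 (di (?t y)) =
            PB.D.conv (hmult D) (\<lambda>x. iA (\<beta> (di (?t x)))) (\<lambda>x. iB (\<delta> (di (?t x)))) y"
          by (rule conv_comp_right[OF hB hB T bialg_hom_compose[OF hB hB \<theta>k di(1)] l[OF b1] l[OF d1] y])
        also have "\<dots> = PB.D.conv (hmult D) (\<lambda>x. iA (\<beta> (di (?t x)))) (\<lambda>x. iB (?t x)) y"
          by (rule PB.D.conv_cong) (simp_all add: di(3) tk)
        finally show ?thesis by simp
      qed
      show ?thesis
      proof (subst conv_cancel_left[OF hB hD l[OF R] P x], rule conv_in_subalg[OF hB M])
        fix y assume y: "y \<in> hspace B"
        show "iA (\<beta> (di (?t (hantipode B y)))) \<in> ?M"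
          by (rule PM[OF linear_on_in[OF PB.D.antipode_linear y]])
        show "PB.D.conv (hmult D) (\<lambda>x. iA (\<beta> (di (?t x)))) (\<lambda>x. iB (?t x)) y \<in> ?M"
          unfolding c[OF y] by (rule F2M[OF bialg_hom_in[OF di(1) tk[OF y]]])
      qed
    qed
    then show ?case using Suc.IH by blast
  qed simp
  moreover have "iB ((?\<theta> ^^ n) x) \<in> ?M" if x: "x \<in> hspace B" for x
  proof -
    have "iB ((?\<theta> ^^ n) x) = (\<lambda>p. hcounit B x * hunit D p)"
      using n x linear_on_scale[OF l[OF bialg_hom_iB] PB.D.alg.unit_in] bialg_hom_unit[OF bialg_hom_iB] by simp
    also have "\<dots> \<in> ?M" by (rule subalg_scale[OF M]) (use M in \<open>simp add: subalg_def\<close>)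
    finally show ?thesis .
  qed
  ultimately have iBM: "iB x \<in> ?M" if "x \<in> hspace B" for x using that by blast
  \<comment> \<open>With all of \<open>iB\<close> inside \<open>?M\<close>, the second factor of
    \<open>F1\<close> cancels and leaves \<open>iA \<circ> \<alpha>\<close>, where
    \<open>\<alpha>\<close> is onto.\<close>
  have iAM: "iA x \<in> ?M" if x: "x \<in> hspace A" for x
  proof -
    have "iA (\<alpha> y) \<in> ?M" if y: "y \<in> hspace A" for y
    proof (subst conv_cancel_right[OF hA hD l[OF a1] g1 y], rule conv_in_subalg[OF hA M])
      fix z assume z: "z \<in> hspace A"
      show "F1 z \<in> ?M" by (rule F1M[OF z])
      show "iB (\<gamma> (hantipode A z)) \<in> ?M"
        by (rule iBM[OF bialg_hom_in[OF \<gamma> linear_on_in[OF PA.D.antipode_linear z]]])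
    qed
    from this[OF bialg_hom_in[OF ai(1) x]] show ?thesis by (simp only: ai(3)[OF x])
  qed
  have "t \<in> ?M" if t: "t \<in> hspace D" for t
  proof (subst conv_id[OF t, symmetric], rule conv_in_subalg[OF hD M])
    fix s assume s: "s \<in> hspace D"
    show "iA (pA s) \<in> ?M" by (rule iAM[OF bialg_hom_in[OF bialg_hom_pA s]])
    show "iB (pB s) \<in> ?M" by (rule iBM[OF bialg_hom_in[OF bialg_hom_pB s]])
  qed
  then show ?thesis by (intro PD.D.surj_imp_bij[OF bialg_hom_mat]) blast
qed

end

end

section \<open>Return to extensional morphisms and the two inclusions\<close>

lemma hopf_homc_iff:
  assumes "hopf_alg A" "hopf_alg B"
  shows "b \<in> hopf_homc A B \<longleftrightarrow> b \<in> extensional (hspace A) \<and> bialg_hom A B b \<and>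
    (\<forall>x\<in>hspace A. \<forall>y\<in>hspace B. hmult B (b x) y = hmult B y (b x)) \<and>
    cocommuting A b (\<lambda>x. x)"
proof -
  have "tensor_map (hbasis A) (hbasis A) b id (\<lambda>(i, j). T (j, i)) =
      lift (hbasis A) (hbasis A) (\<lambda>p q. tens (b q) p) T" for T
    unfolding tensor_map_lift by (subst lift_flip) simp
  then show ?thesis
    unfolding hopf_homc_def hopf_hom_iff[OF assms] cocommuting_def
    by (simp add: tensor_map_lift)
qed

lemma hopf_aut_iff:
  assumes "hopf_alg A"
  shows "f \<in> hopf_aut A \<longleftrightarrow> f \<in> extensional (hspace A) \<and> bialg_hom A A f \<and>
    bij_betw f (hspace A) (hspace A)"
  by (auto simp: hopf_aut_def hopf_hom_iff[OF assms assms])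

lemma bij_betw_restrict: "bij_betw (restrict f A) A B \<longleftrightarrow> bij_betw f A B"
  by (rule bij_betw_cong) simp

lemma hopf_matrix_restrict:
  "hopf_matrix A B (restrict \<alpha> (hspace A)) (restrict \<beta> (hspace B)) (restrict \<gamma> (hspace A))
    (restrict \<delta> (hspace B)) = hopf_matrix A B \<alpha> \<beta> \<gamma> \<delta>"
  by (simp add: hopf_matrix_def)

context double_prod_abelian
begin

lemma double_transport_restrict:
  "double_transport C H (restrict f (hspace D)) = double_transport C H f"
  unfolding double_transport_def
proof (rule restrict_ext)
  fix t :: "('c \<times> 'c) \<times> ('h \<times> 'h) \<Rightarrow> 'k" assume "t \<in> hspace (hopf_tensor (double C) (double H))"
  then have "(\<lambda>((x, y), (c, h)). t ((x, c), (y, h))) \<in> hspace D"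
    by (auto simp: fspace_def hopf_tensor_def PA.sel(1)[unfolded A_def] PB.sel(1)[unfolded B_def] PD.sel(1))
  then show "double_ident (restrict f (hspace D) (\<lambda>((x, y), (c, h)). t ((x, c), (y, h)))) =
    double_ident (f (\<lambda>((x, y), (c, h)). t ((x, c), (y, h))))" by simp
qed

theorem aut_double_prod:
  "double_transport C H ` hopf_aut D =
    {hopf_matrix A B \<alpha> \<beta> \<gamma> \<delta> | \<alpha> \<beta> \<gamma> \<delta>.
       \<alpha> \<in> hopf_aut A \<and> \<beta> \<in> hopf_homc B A \<and> \<gamma> \<in> hopf_homc A B \<and> \<delta> \<in> hopf_aut B}"
proof (intro subset_antisym subsetI)
  fix F assume "F \<in> double_transport C H ` hopf_aut D"
  then obtain f where F: "F = double_transport C H f" and f: "bialg_hom D D f"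
    and bij: "bij_betw f (hspace D) (hspace D)"
    using hopf_aut_iff[OF hD] by auto
  obtain g where g: "bialg_hom D D g" and gf: "\<And>x. x \<in> hspace D \<Longrightarrow> g (f x) = x"
    and fg: "\<And>x. x \<in> hspace D \<Longrightarrow> f (g x) = x"
    using bialg_hom_bij_inverse[OF hD hD f bij] by blast
  note cD = bialg_hom_compose[OF hA hD] bialg_hom_compose[OF hB hD]
  have fA: "bialg_hom A D (\<lambda>x. f (iA x))" and fB: "bialg_hom B D (\<lambda>x. f (iB x))"
    using cD(1)[OF bialg_hom_iA f] cD(2)[OF bialg_hom_iB f] .
  let ?\<alpha> = "\<lambda>x. pA (f (iA x))" and ?\<beta> = "\<lambda>x. pA (f (iB x))"
    and ?\<gamma> = "\<lambda>x. pB (f (iA x))" and ?\<delta> = "\<lambda>x. pB (f (iB x))"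
  have h: "bialg_hom A A ?\<alpha>" "bialg_hom B A ?\<beta>" "bialg_hom A B ?\<gamma>" "bialg_hom B B ?\<delta>"
    using cD(1)[OF fA bialg_hom_pA] cD(2)[OF fB bialg_hom_pA] cD(1)[OF fA bialg_hom_pB] cD(2)[OF fB bialg_hom_pB] .
  note l = bialg_hom_linear
  note \<alpha>_bij = components_bij(1)[OF f g fg gf] and \<delta>_bij = components_bij(2)[OF f g fg gf]
  obtain di where di: "bialg_hom B B di" "\<And>x. x \<in> hspace B \<Longrightarrow> di (?\<delta> x) = x"
    "\<And>y. y \<in> hspace B \<Longrightarrow> ?\<delta> (di y) = y"
    using bialg_hom_bij_inverse[OF hB hB h(4) \<delta>_bij] by blast
  \<comment> \<open>Inherited from the two projections of \<open>D\<close> by precomposition with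
    \<open>f \<circ> iB\<close>; applying \<open>\<delta>^-1\<close> to the second leg then replaces
    \<open>\<delta>\<close> by the identity.\<close>
  have "cocommuting B ?\<beta> ?\<delta>"
    by (rule cocommuting_compose_right[OF hB hD pA_pB_cocommuting l[OF bialg_hom_pA] l[OF bialg_hom_pB] fB])
  then have "cocommuting B ?\<beta> (\<lambda>x. di (?\<delta> x))"
    using cocommuting_compose_left[OF hB _ PA.D.fin PB.D.fin l[OF h(2)] l[OF h(4)] linear_on_id l[OF di(1)]]
    by blast
  then have \<beta>c: "cocommuting B ?\<beta> (\<lambda>x. x)"
    by (rule cocommuting_cong) (simp_all add: di(2))
  \<comment> \<open>Dually, \<open>\<gamma>\<close> and \<open>\<delta>\<close> have commuting
    images since \<open>iA\<close> and \<open>iB\<close> do, and \<open>\<delta>\<close> is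
    onto.\<close>
  have \<gamma>c: "hmult B (?\<gamma> x) y = hmult B y (?\<gamma> x)" if x: "x \<in> hspace A" and y: "y \<in> hspace B" for x y
  proof -
    note dy = bialg_hom_in[OF di(1) y]
    have "pB (f (hmult D (iA x) (iB (di y)))) = pB (f (hmult D (iB (di y)) (iA x)))"
      using iA_iB_commute[OF x dy] by simp
    then have "hmult B (?\<gamma> x) (?\<delta> (di y)) = hmult B (?\<delta> (di y)) (?\<gamma> x)"
      using x dy by (simp add: bialg_hom_mult[OF f] bialg_hom_mult[OF bialg_hom_pB]
          bialg_hom_in[OF bialg_hom_iA] bialg_hom_in[OF bialg_hom_iB] bialg_hom_in[OF f])
    then show ?thesis by (simp only: di(3)[OF y])
  qed
  have "F = hopf_matrix A B ?\<alpha> ?\<beta> ?\<gamma> ?\<delta>"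
    unfolding F
    by (rule double_transport_eq_hopf_matrix[OF f l[OF h(1)] l[OF h(2)] l[OF h(3)] l[OF h(4)]
          comp_A[OF fA] comp_B[OF fB]])
  then have "F = hopf_matrix A B (restrict ?\<alpha> (hspace A)) (restrict ?\<beta> (hspace B))
      (restrict ?\<gamma> (hspace A)) (restrict ?\<delta> (hspace B))"
    by (simp only: hopf_matrix_restrict)
  moreover have "restrict ?\<alpha> (hspace A) \<in> hopf_aut A"
    using bialg_hom_cong[OF hA h(1)] \<alpha>_bij by (simp add: hopf_aut_iff[OF hA] bij_betw_restrict)
  moreover have "restrict ?\<delta> (hspace B) \<in> hopf_aut B"
    using bialg_hom_cong[OF hB h(4)] \<delta>_bij by (simp add: hopf_aut_iff[OF hB] bij_betw_restrict)
  moreover have "restrict ?\<beta> (hspace B) \<in> hopf_homc B A"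
    using bialg_hom_cong[OF hB h(2)] cocommuting_cong[OF \<beta>c] A_commutative bialg_hom_in[OF h(2)]
    by (simp add: hopf_homc_iff[OF hB hA])
  moreover have "restrict ?\<gamma> (hspace A) \<in> hopf_homc A B"
    using bialg_hom_cong[OF hA h(3)] A_cocommuting \<gamma>c by (simp add: hopf_homc_iff[OF hA hB])
  ultimately show "F \<in> {hopf_matrix A B \<alpha> \<beta> \<gamma> \<delta> | \<alpha> \<beta> \<gamma> \<delta>.
       \<alpha> \<in> hopf_aut A \<and> \<beta> \<in> hopf_homc B A \<and> \<gamma> \<in> hopf_homc A B \<and> \<delta> \<in> hopf_aut B}"
    by blast
next
  fix F assume "F \<in> {hopf_matrix A B \<alpha> \<beta> \<gamma> \<delta> | \<alpha> \<beta> \<gamma> \<delta>.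
       \<alpha> \<in> hopf_aut A \<and> \<beta> \<in> hopf_homc B A \<and> \<gamma> \<in> hopf_homc A B \<and> \<delta> \<in> hopf_aut B}"
  then obtain \<alpha> \<beta> \<gamma> \<delta> where F: "F = hopf_matrix A B \<alpha> \<beta> \<gamma> \<delta>"
    and "\<alpha> \<in> hopf_aut A" "\<beta> \<in> hopf_homc B A" "\<gamma> \<in> hopf_homc A B" "\<delta> \<in> hopf_aut B"
    by blast
  then have h: "bialg_hom A A \<alpha>" "bij_betw \<alpha> (hspace A) (hspace A)"
    "bialg_hom B A \<beta>" "cocommuting B \<beta> (\<lambda>x. x)" "bialg_hom A B \<gamma>"
    "\<And>x y. x \<in> hspace A \<Longrightarrow> y \<in> hspace B \<Longrightarrow> hmult B (\<gamma> x) y = hmult B y (\<gamma> x)"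
    "bialg_hom B B \<delta>" "bij_betw \<delta> (hspace B) (hspace B)"
    by (auto simp: hopf_aut_iff[OF hA] hopf_aut_iff[OF hB] hopf_homc_iff[OF hA hB] hopf_homc_iff[OF hB hA])
  let ?f = "PD.D.conv (hmult D)
    (\<lambda>t. PA.D.conv (hmult D) (\<lambda>x. iA (\<alpha> x)) (\<lambda>x. iB (\<gamma> x)) (pA t))
    (\<lambda>t. PB.D.conv (hmult D) (\<lambda>x. iA (\<beta> x)) (\<lambda>x. iB (\<delta> x)) (pB t))"
  note l = bialg_hom_linear
  have "F = double_transport C H ?f"
    unfolding F
    by (rule double_transport_eq_hopf_matrix[OF bialg_hom_mat[OF h] l[OF h(1)] l[OF h(3)] l[OF h(5)] l[OF h(7)]
          mat_iA[OF h] mat_iB[OF h], symmetric])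
  then have "F = double_transport C H (restrict ?f (hspace D))"
    by (simp only: double_transport_restrict)
  moreover have "restrict ?f (hspace D) \<in> hopf_aut D"
    using bialg_hom_cong[OF hD bialg_hom_mat[OF h]] mat_bij[OF h]
    by (simp add: hopf_aut_iff[OF hD] bij_betw_restrict)
  ultimately show "F \<in> double_transport C H ` hopf_aut D" by blast
qed

end

theorem theorem9p9:
  fixes C :: "('c, 'm) monoid_scheme" and H :: "('h, 'n) monoid_scheme"
  assumes "comm_group C" and "finite (carrier C)"
    and "group H" and "finite (carrier H)" and "purely_nonabelian H"
  shows "double_transport C H ` hopf_aut (double (C \<times>\<times> H) :: (('c \<times> 'h) \<times> ('c \<times> 'h), 'k::field) hopf) =
    {hopf_matrix (double C) (double H) \<alpha> \<beta> \<gamma> \<delta> | \<alpha> \<beta> \<gamma> \<delta>.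
       \<alpha> \<in> hopf_aut (double C) \<and> \<beta> \<in> hopf_homc (double H) (double C) \<and>
       \<gamma> \<in> hopf_homc (double C) (double H) \<and> \<delta> \<in> hopf_aut (double H)}"
proof -
  interpret double_prod_abelian C H "double C" "double H"
    "double (C \<times>\<times> H) :: (('c \<times> 'h) \<times> ('c \<times> 'h), 'k) hopf"
    using assms by (intro double_prod_abelian.intro double_prod.intro double_prod_abelian_axioms.intro)
      (auto simp: comm_group_def)
  show ?thesis by (rule aut_double_prod)
qed

end
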